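(* Let $A,B$ be Artin algebras, ${}_AM_B$ an exchangeable bimodule with $A$-$B$-bimodule isomorphism $g:\mathrm D({}_AA_A)\otimes_AM\cong M\otimes_B\mathrm D({}_BB_B)$, $\Lambda=\begin{bmatrix}A&M\\0&B\end{bmatrix}$, and let ${}_\Lambda T_\Lambda$ be the $\Lambda$-$\Lambda$-bimodule $T=\begin{bmatrix}\mathrm D(A)&M\otimes_B\mathrm D(B)\\0&\mathrm D(B)\end{bmatrix}$ whose structure is described in the context. Then there is an algebra isomorphism $\rho:\mathrm{End}_\Lambda({}_\Lambda T)^{op}\cong\Lambda$ such that under $\rho$ the right module $T_{\mathrm{End}_\Lambda({}_\Lambda T)^{op}}$ coincides with the right module $T_\Lambda$; and there is an algebra isomorphism $\mathrm{End}_\Lambda(T_\Lambda)\cong\Lambda$ such that under this isomorphism the left module ${}_{\mathrm{End}_\Lambda(T_\Lambda)}T$ coincides with the left module ${}_\Lambda T$.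
   Context: All algebras are Artin algebras over a commutative artinian ring $R$ (bimodules are such that $\Lambda$ is again an Artin $R$-algebra); all modules are finitely generated. $\mathrm D$ is the standard duality between left and right modules. ${}_AM_B$ is exchangeable if both ${}_AM$ and $M_B$ are projective and there is an $A$-$B$-bimodule isomorphism $\mathrm D({}_AA_A)\otimes_AM\cong M\otimes_B\mathrm D({}_BB_B)$. Left $\Lambda$-modules are identified with triples $\begin{bmatrix}X\\ Y\end{bmatrix}_\phi$, with $X\in A\text{-mod}$, $Y\in B\text{-mod}$ and $\phi:M\otimes_BY\to X$ a left $A$-map (omitted if zero). The bimodule $T$: as a left $\Lambda$-module, ${}_\Lambda T=\begin{bmatrix}\mathrm DA\\0\end{bmatrix}\oplus\begin{bmatrix}M\otimes_B\mathrm DB\\ \mathrm DB\end{bmatrix}_{\mathrm{Id}}$ (the two summands being the two columns of the matrix form of $T$), and the right $\Lambda$-action is $$\begin{pmatrix}\alpha&m'\otimes_B\beta\\0&\beta'\end{pmatrix}\begin{pmatrix}a&m\\0&b\end{pmatrix}=\begin{pmatrix}\alpha a&g(\alpha\otimes_Am)+m'\otimes_B\beta b\\0&\beta'b\end{pmatrix}.$$ These two actions make $T$ a $\Lambda$-$\Lambda$-bimodule. *)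

theory Defs
  imports "HOL-Algebra.Module" "HOL-Algebra.QuotRing" "HOL-Algebra.Free_Abelian_Groups"
begin

section \<open>Modules over non-commutative rings\<close>

text \<open>
  The library's locale \<open>module\<close> requires a commutative ring of scalars, and its locale \<open>algebra\<close> a
  commutative algebra, so the non-commutative notions are set up here on the same records. As in
  \<open>HOL-Algebra\<close>, a module is a record whose additive part is the underlying abelian group and whose
  fields \<open>mult\<close> and \<open>one\<close> are irrelevant.

  A right \<open>B\<close>-module is a left module over the opposite ring \<open>opp B\<close>, so that every notion for
  left modules (homomorphisms, projectivity, endomorphism algebra) applies to right modules too.
\<close>

definition opp :: "('a, 'z) ring_scheme \<Rightarrow> ('a, 'z) ring_scheme" where
  "opp A = A\<lparr>mult := (\<lambda>x y. y \<otimes>\<^bsub>A\<^esub> x)\<rparr>"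

locale left_module = A?: ring A + M?: abelian_group M
  for A :: "('a, 'y) ring_scheme" (structure) and M :: "('a, 'm, 'z) module_scheme" (structure) +
  assumes smult_closed:
      "\<lbrakk>a \<in> carrier A; x \<in> carrier M\<rbrakk> \<Longrightarrow> a \<odot>\<^bsub>M\<^esub> x \<in> carrier M"
    and smult_l_distr:
      "\<lbrakk>a \<in> carrier A; b \<in> carrier A; x \<in> carrier M\<rbrakk> \<Longrightarrow>
        (a \<oplus>\<^bsub>A\<^esub> b) \<odot>\<^bsub>M\<^esub> x = a \<odot>\<^bsub>M\<^esub> x \<oplus>\<^bsub>M\<^esub> b \<odot>\<^bsub>M\<^esub> x"
    and smult_r_distr:
      "\<lbrakk>a \<in> carrier A; x \<in> carrier M; y \<in> carrier M\<rbrakk> \<Longrightarrow>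
        a \<odot>\<^bsub>M\<^esub> (x \<oplus>\<^bsub>M\<^esub> y) = a \<odot>\<^bsub>M\<^esub> x \<oplus>\<^bsub>M\<^esub> a \<odot>\<^bsub>M\<^esub> y"
    and smult_assoc:
      "\<lbrakk>a \<in> carrier A; b \<in> carrier A; x \<in> carrier M\<rbrakk> \<Longrightarrow>
        (a \<otimes>\<^bsub>A\<^esub> b) \<odot>\<^bsub>M\<^esub> x = a \<odot>\<^bsub>M\<^esub> (b \<odot>\<^bsub>M\<^esub> x)"
    and smult_one:
      "x \<in> carrier M \<Longrightarrow> \<one>\<^bsub>A\<^esub> \<odot>\<^bsub>M\<^esub> x = x"

text \<open>Homomorphisms are taken extensional, so that equality of functions is equality of maps.\<close>

definition mhom ::
  "('a, 'y) ring_scheme \<Rightarrow> ('a, 'm, 'z) module_scheme \<Rightarrow> ('a, 'n, 'w) module_scheme \<Rightarrow> ('m \<Rightarrow> 'n) set"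
where
  "mhom A M N = {f \<in> carrier M \<rightarrow>\<^sub>E carrier N.
     (\<forall>x\<in>carrier M. \<forall>y\<in>carrier M. f (x \<oplus>\<^bsub>M\<^esub> y) = f x \<oplus>\<^bsub>N\<^esub> f y) \<and>
     (\<forall>a\<in>carrier A. \<forall>x\<in>carrier M. f (a \<odot>\<^bsub>M\<^esub> x) = a \<odot>\<^bsub>N\<^esub> f x)}"

definition fin_gen :: "('a, 'y) ring_scheme \<Rightarrow> ('a, 'm, 'z) module_scheme \<Rightarrow> bool" where
  "fin_gen A M \<longleftrightarrow> (\<exists>S. finite S \<and> S \<subseteq> carrier M \<and>
     (\<forall>H. submodule H A M \<and> S \<subseteq> H \<longrightarrow> H = carrier M))"

text \<open>
  Projectivity and injectivity are the usual lifting and extension properties. Since one cannot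
  quantify over types, the test modules range over all modules with carrier in the type
  \<open>(nat \<Rightarrow> 'a) set\<close>. This type contains all quotients of the free modules \<open>A\<^sup>n\<close> (as sets of cosets),
  hence a copy of every finitely generated \<open>A\<close>-module. For a finitely generated \<open>P\<close>, a surjection
  \<open>A\<^sup>n \<rightarrow> P\<close> is among the tests, and the ideals of \<open>A\<close> with their inclusions into \<open>A\<close> (Baer's
  criterion) are among the tests for injectivity.
\<close>

definition projective_mod :: "('a, 'y) ring_scheme \<Rightarrow> ('a, 'm, 'z) module_scheme \<Rightarrow> bool" where
  "projective_mod A P \<longleftrightarrow> left_module A P \<and>
     (\<forall>X :: ('a, (nat \<Rightarrow> 'a) set) module. \<forall>Y :: ('a, (nat \<Rightarrow> 'a) set) module. \<forall>p f.
        left_module A X \<and> left_module A Y \<and>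
        p \<in> mhom A X Y \<and> p ` carrier X = carrier Y \<and> f \<in> mhom A P Y \<longrightarrow>
        (\<exists>h \<in> mhom A P X. \<forall>x\<in>carrier P. p (h x) = f x))"

definition injective_mod :: "('a, 'y) ring_scheme \<Rightarrow> ('a, 'm, 'z) module_scheme \<Rightarrow> bool" where
  "injective_mod A J \<longleftrightarrow> left_module A J \<and>
     (\<forall>X :: ('a, (nat \<Rightarrow> 'a) set) module. \<forall>Y :: ('a, (nat \<Rightarrow> 'a) set) module. \<forall>i f.
        left_module A X \<and> left_module A Y \<and>
        i \<in> mhom A X Y \<and> inj_on i (carrier X) \<and> f \<in> mhom A X J \<longrightarrow>
        (\<exists>h \<in> mhom A Y J. \<forall>x\<in>carrier X. h (i x) = f x))"

definition injective_envelope ::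
  "('a, 'y) ring_scheme \<Rightarrow> ('a, 'm, 'z) module_scheme \<Rightarrow> ('a, 'n, 'w) module_scheme \<Rightarrow> bool"
where
  "injective_envelope A X J \<longleftrightarrow> injective_mod A J \<and>
     (\<exists>\<iota> \<in> mhom A X J. inj_on \<iota> (carrier X) \<and>
        (\<forall>N. submodule N A J \<and> N \<inter> \<iota> ` carrier X = {\<zero>\<^bsub>J\<^esub>} \<longrightarrow> N = {\<zero>\<^bsub>J\<^esub>}))"

section \<open>Artin algebras\<close>

definition artinian :: "('r, 'y) ring_scheme \<Rightarrow> bool" where
  "artinian R \<longleftrightarrow> (\<forall>I :: nat \<Rightarrow> 'r set.
     (\<forall>n. ideal (I n) R \<and> I (Suc n) \<subseteq> I n) \<longrightarrow> (\<exists>N. \<forall>n\<ge>N. I n = I N))"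

text \<open>An \<open>R\<close>-algebra is one record, the action of \<open>R\<close> being its field \<open>smult\<close>.\<close>

locale artin_algebra = module R A + ring A
  for R :: "('r, 'y) ring_scheme" (structure) and A :: "('r, 'a, 'z) module_scheme" (structure) +
  assumes artinian: "artinian R"
    and smult_mult_left:
      "\<lbrakk>r \<in> carrier R; x \<in> carrier A; y \<in> carrier A\<rbrakk> \<Longrightarrow>
        (r \<odot>\<^bsub>A\<^esub> x) \<otimes>\<^bsub>A\<^esub> y = r \<odot>\<^bsub>A\<^esub> (x \<otimes>\<^bsub>A\<^esub> y)"
    and smult_mult_right:
      "\<lbrakk>r \<in> carrier R; x \<in> carrier A; y \<in> carrier A\<rbrakk> \<Longrightarrow>
        x \<otimes>\<^bsub>A\<^esub> (r \<odot>\<^bsub>A\<^esub> y) = r \<odot>\<^bsub>A\<^esub> (x \<otimes>\<^bsub>A\<^esub> y)"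
    and fin_gen: "fin_gen R A"

definition alg_iso ::
  "('r, 'y) ring_scheme \<Rightarrow> ('r, 'a, 'z) module_scheme \<Rightarrow> ('r, 'b, 'w) module_scheme \<Rightarrow> ('a \<Rightarrow> 'b) set"
where
  "alg_iso R A B = {h \<in> ring_iso A B.
     \<forall>r\<in>carrier R. \<forall>x\<in>carrier A. h (r \<odot>\<^bsub>A\<^esub> x) = r \<odot>\<^bsub>B\<^esub> h x}"

text \<open>The \<open>R\<close>-module underlying a module over the \<open>R\<close>-algebra \<open>A\<close>.\<close>

definition restrict_scalars ::
  "('r, 'a, 'y) module_scheme \<Rightarrow> ('a, 'm, 'z) module_scheme \<Rightarrow> ('r, 'm) module"
where
  "restrict_scalars A M =
     \<lparr>carrier = carrier M, mult = mult M, one = monoid.one M, ring.zero = ring.zero M,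
      add = add M,
      smult = (\<lambda>r x. (r \<odot>\<^bsub>A\<^esub> \<one>\<^bsub>A\<^esub>) \<odot>\<^bsub>M\<^esub> x)\<rparr>"

text \<open>
  The endomorphism algebra with multiplication the composition \<open>(f g)(x) = f (g x)\<close>. Hence \<open>M\<close> is a
  left module over \<open>End_alg A M\<close> and a right module over \<open>opp (End_alg A M)\<close>, with action given in
  both cases by evaluation \<open>f x\<close>.
\<close>

definition End_alg ::
  "('r, 'a, 'y) module_scheme \<Rightarrow> ('a, 'm, 'z) module_scheme \<Rightarrow> ('r, 'm \<Rightarrow> 'm) module"
where
  "End_alg A M =
     \<lparr>carrier = mhom A M M,
      mult = (\<lambda>f g. compose (carrier M) f g),
      one = (\<lambda>x\<in>carrier M. x),
      ring.zero = (\<lambda>x\<in>carrier M. \<zero>\<^bsub>M\<^esub>),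
      add = (\<lambda>f g. \<lambda>x\<in>carrier M. f x \<oplus>\<^bsub>M\<^esub> g x),
      smult = (\<lambda>r f. \<lambda>x\<in>carrier M. r \<odot>\<^bsub>restrict_scalars A M\<^esub> f x)\<rparr>"

section \<open>Bimodules\<close>

record ('a, 'b, 'm) bimodule = "'m ring" +
  lact :: "'a \<Rightarrow> 'm \<Rightarrow> 'm"
  ract :: "'m \<Rightarrow> 'b \<Rightarrow> 'm"

definition lmod :: "('a, 'b, 'm, 'z) bimodule_scheme \<Rightarrow> ('a, 'm) module" where
  "lmod M = \<lparr>carrier = carrier M, mult = mult M, one = monoid.one M,
             ring.zero = ring.zero M, add = add M,
             smult = lact M\<rparr>"

text \<open>As a left module over the opposite ring.\<close>

definition rmod :: "('a, 'b, 'm, 'z) bimodule_scheme \<Rightarrow> ('b, 'm) module" where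
  "rmod M = \<lparr>carrier = carrier M, mult = mult M, one = monoid.one M,
             ring.zero = ring.zero M, add = add M,
             smult = (\<lambda>b x. ract M x b)\<rparr>"

text \<open>
  The assumptions \<open>central\<close> and \<open>bimod_fin_gen\<close> express that the triangular matrix ring below is
  again an Artin \<open>R\<close>-algebra.
\<close>

locale artin_bimodule =
  A: artin_algebra R A + B: artin_algebra R B +
  L: left_module A "lmod M" + R: left_module "opp B" "rmod M"
  for R :: "('r, 'y) ring_scheme" (structure)
    and A :: "('r, 'a, 'z) module_scheme"
    and B :: "('r, 'b, 'w) module_scheme"
    and M :: "('a, 'b, 'm) bimodule" +
  assumes lact_ract:
      "\<lbrakk>a \<in> carrier A; x \<in> carrier M; b \<in> carrier B\<rbrakk> \<Longrightarrow>
        ract M (lact M a x) b = lact M a (ract M x b)"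
    and central:
      "\<lbrakk>r \<in> carrier R; x \<in> carrier M\<rbrakk> \<Longrightarrow>
        lact M (r \<odot>\<^bsub>A\<^esub> \<one>\<^bsub>A\<^esub>) x = ract M x (r \<odot>\<^bsub>B\<^esub> \<one>\<^bsub>B\<^esub>)"
    and bimod_fin_gen: "fin_gen R (restrict_scalars A (lmod M))"

definition bimod_iso ::
  "('a, 'y) ring_scheme \<Rightarrow> ('b, 'z) ring_scheme \<Rightarrow> ('a, 'b, 'm) bimodule \<Rightarrow> ('a, 'b, 'n) bimodule \<Rightarrow>
   ('m \<Rightarrow> 'n) set"
where
  "bimod_iso A B X Y =
     {h \<in> mhom A (lmod X) (lmod Y) \<inter> mhom (opp B) (rmod X) (rmod Y).
        bij_betw h (carrier X) (carrier Y)}"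

definition regular_bimod :: "('a, 'z) ring_scheme \<Rightarrow> ('a, 'a, 'a) bimodule" where
  "regular_bimod A =
     \<lparr>carrier = carrier A, mult = mult A, one = monoid.one A, ring.zero = ring.zero A, add = add A,
      lact = mult A, ract = mult A\<rparr>"

section \<open>Tensor products\<close>

text \<open>
  \<open>M \<otimes>\<^sub>B N\<close> is the free abelian group on \<open>M \<times> N\<close> modulo the subgroup generated by the usual relations.
\<close>

definition tensor_rel ::
  "('b, 'z) ring_scheme \<Rightarrow> ('a, 'b, 'm) bimodule \<Rightarrow> ('b, 'c, 'n) bimodule \<Rightarrow> (('m \<times> 'n) \<Rightarrow>\<^sub>0 int) set"
where
  "tensor_rel B M N = generate (free_Abelian_group (carrier M \<times> carrier N))
     ({frag_of (x \<oplus>\<^bsub>M\<^esub> x', y) - frag_of (x, y) - frag_of (x', y) | x x' y.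
         x \<in> carrier M \<and> x' \<in> carrier M \<and> y \<in> carrier N} \<union>
      {frag_of (x, y \<oplus>\<^bsub>N\<^esub> y') - frag_of (x, y) - frag_of (x, y') | x y y'.
         x \<in> carrier M \<and> y \<in> carrier N \<and> y' \<in> carrier N} \<union>
      {frag_of (ract M x b, y) - frag_of (x, lact N b y) | x b y.
         x \<in> carrier M \<and> b \<in> carrier B \<and> y \<in> carrier N})"

definition tensor_class ::
  "('b, 'z) ring_scheme \<Rightarrow> ('a, 'b, 'm) bimodule \<Rightarrow> ('b, 'c, 'n) bimodule \<Rightarrow>
   (('m \<times> 'n) \<Rightarrow>\<^sub>0 int) \<Rightarrow> (('m \<times> 'n) \<Rightarrow>\<^sub>0 int) set"
where
  "tensor_class B M N c = tensor_rel B M N #>\<^bsub>free_Abelian_group (carrier M \<times> carrier N)\<^esub> c"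

definition pure_tensor ::
  "('b, 'z) ring_scheme \<Rightarrow> ('a, 'b, 'm) bimodule \<Rightarrow> ('b, 'c, 'n) bimodule \<Rightarrow>
   'm \<Rightarrow> 'n \<Rightarrow> (('m \<times> 'n) \<Rightarrow>\<^sub>0 int) set"
where
  "pure_tensor B M N x y = tensor_class B M N (frag_of (x, y))"

text \<open>
  \<open>tensor_map B M N \<phi>\<close> is the additive map with \<open>x \<otimes> y \<mapsto> x' \<otimes> y'\<close> for \<open>(x', y') = \<phi> (x, y)\<close>. The
  union runs over the representatives of a class and is a single class whenever the map is
  well defined.
\<close>

definition tensor_map ::
  "('b, 'z) ring_scheme \<Rightarrow> ('a, 'b, 'm) bimodule \<Rightarrow> ('b, 'c, 'n) bimodule \<Rightarrow>
   ('m \<times> 'n \<Rightarrow> 'm \<times> 'n) \<Rightarrow> (('m \<times> 'n) \<Rightarrow>\<^sub>0 int) set \<Rightarrow> (('m \<times> 'n) \<Rightarrow>\<^sub>0 int) set"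
where
  "tensor_map B M N \<phi> C = (\<Union>c\<in>C. tensor_class B M N (frag_extend (frag_of \<circ> \<phi>) c))"

definition tensor ::
  "('b, 'z) ring_scheme \<Rightarrow> ('a, 'b, 'm) bimodule \<Rightarrow> ('b, 'c, 'n) bimodule \<Rightarrow>
   ('a, 'c, (('m \<times> 'n) \<Rightarrow>\<^sub>0 int) set) bimodule"
where
  "tensor B M N =
     (let Q = free_Abelian_group (carrier M \<times> carrier N) Mod tensor_rel B M N
      in \<lparr>carrier = carrier Q, mult = undefined, one = undefined, ring.zero = one Q, add = mult Q,
          lact = (\<lambda>a. tensor_map B M N (\<lambda>(x, y). (lact M a x, y))),
          ract = (\<lambda>t c. tensor_map B M N (\<lambda>(x, y). (x, ract N y c)) t)\<rparr>)"

section \<open>The standard duality\<close>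

definition jacobson_radical :: "('r, 'y) ring_scheme \<Rightarrow> 'r set" where
  "jacobson_radical R = carrier R \<inter> \<Inter>{I. maximalideal I R}"

definition quot_mod :: "('r, 'y) ring_scheme \<Rightarrow> 'r set \<Rightarrow> ('r, 'r set) module" where
  "quot_mod R I =
     \<lparr>carrier = carrier (R Quot I), mult = mult (R Quot I), one = monoid.one (R Quot I),
      ring.zero = ring.zero (R Quot I), add = add (R Quot I),
      smult = (\<lambda>r C. (I +>\<^bsub>R\<^esub> r) \<otimes>\<^bsub>R Quot I\<^esub> C)\<rparr>"

text \<open>
  The standard duality of Artin \<open>R\<close>-algebras is \<open>D = Hom\<^sub>R(-, J)\<close>, where \<open>J\<close> is an injective envelope
  of \<open>R / rad R\<close>.
\<close>

definition dualizing :: "('r, 'y) ring_scheme \<Rightarrow> ('r, 'j, 'z) module_scheme \<Rightarrow> bool" where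
  "dualizing R J \<longleftrightarrow> injective_envelope R (quot_mod R (jacobson_radical R)) J"

text \<open>The dual of an \<open>A\<close>-\<open>B\<close>-bimodule, a \<open>B\<close>-\<open>A\<close>-bimodule via \<open>(b f a)(x) = f (a x b)\<close>.\<close>

definition dual ::
  "('r, 'y) ring_scheme \<Rightarrow> ('r, 'j, 'z) module_scheme \<Rightarrow> ('r, 'a, 'w) module_scheme \<Rightarrow>
   ('a, 'b, 'm) bimodule \<Rightarrow> ('b, 'a, 'm \<Rightarrow> 'j) bimodule"
where
  "dual R J A X =
     \<lparr>carrier = mhom R (restrict_scalars A (lmod X)) J, mult = undefined, one = undefined,
      ring.zero = (\<lambda>x\<in>carrier X. \<zero>\<^bsub>J\<^esub>),
      add = (\<lambda>f h. \<lambda>x\<in>carrier X. f x \<oplus>\<^bsub>J\<^esub> h x),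
      lact = (\<lambda>b f. \<lambda>x\<in>carrier X. f (ract X x b)),
      ract = (\<lambda>f a. \<lambda>x\<in>carrier X. f (lact X a x))\<rparr>"

abbreviation dual_alg ::
  "('r, 'y) ring_scheme \<Rightarrow> ('r, 'j, 'z) module_scheme \<Rightarrow> ('r, 'a, 'w) module_scheme \<Rightarrow>
   ('a, 'a, 'a \<Rightarrow> 'j) bimodule"
where
  "dual_alg R J A \<equiv> dual R J A (regular_bimod A)"

section \<open>Exchangeable bimodules, triangular matrix algebras and the bimodule T\<close>

abbreviation DA_tensor_M where
  "DA_tensor_M R J A M \<equiv> tensor A (dual_alg R J A) M"

abbreviation M_tensor_DB where
  "M_tensor_DB R J B M \<equiv> tensor B M (dual_alg R J B)"

definition exchangeable ::
  "('r, 'y) ring_scheme \<Rightarrow> ('r, 'j, 'z) module_scheme \<Rightarrow> ('r, 'a, 'v) module_scheme \<Rightarrow>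
   ('r, 'b, 'w) module_scheme \<Rightarrow> ('a, 'b, 'm) bimodule \<Rightarrow> bool"
where
  "exchangeable R J A B M \<longleftrightarrow>
     projective_mod A (lmod M) \<and> projective_mod (opp B) (rmod M) \<and>
     (\<exists>g. g \<in> bimod_iso A B (DA_tensor_M R J A M) (M_tensor_DB R J B M))"

text \<open>The triple \<open>(a, m, b)\<close> stands for the matrix with rows \<open>(a, m)\<close> and \<open>(0, b)\<close>.\<close>

definition tri_alg ::
  "('r, 'a, 'v) module_scheme \<Rightarrow> ('r, 'b, 'w) module_scheme \<Rightarrow> ('a, 'b, 'm) bimodule \<Rightarrow>
   ('r, 'a \<times> 'm \<times> 'b) module"
where
  "tri_alg A B M =
     \<lparr>carrier = carrier A \<times> carrier M \<times> carrier B,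
      mult = (\<lambda>(a, m, b) (a', m', b').
                (a \<otimes>\<^bsub>A\<^esub> a', lact M a m' \<oplus>\<^bsub>M\<^esub> ract M m b', b \<otimes>\<^bsub>B\<^esub> b')),
      one = (\<one>\<^bsub>A\<^esub>, \<zero>\<^bsub>M\<^esub>, \<one>\<^bsub>B\<^esub>),
      ring.zero = (\<zero>\<^bsub>A\<^esub>, \<zero>\<^bsub>M\<^esub>, \<zero>\<^bsub>B\<^esub>),
      add = (\<lambda>(a, m, b) (a', m', b'). (a \<oplus>\<^bsub>A\<^esub> a', m \<oplus>\<^bsub>M\<^esub> m', b \<oplus>\<^bsub>B\<^esub> b')),
      smult = (\<lambda>r (a, m, b). (r \<odot>\<^bsub>A\<^esub> a, lact M (r \<odot>\<^bsub>A\<^esub> \<one>\<^bsub>A\<^esub>) m, r \<odot>\<^bsub>B\<^esub> b))\<rparr>"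

text \<open>
  The triple \<open>(\<alpha>, t, \<beta>)\<close> stands for the matrix with rows \<open>(\<alpha>, t)\<close> and \<open>(0, \<beta>)\<close>. A left module over
  the triangular matrix algebra given by \<open>X\<close>, \<open>Y\<close> and \<open>\<phi> : M \<otimes>\<^sub>B Y \<rightarrow> X\<close> is \<open>X \<times> Y\<close> with
  \<open>(a, m, b) (x, y) = (a x + \<phi> (m \<otimes> y), b y)\<close>. The left action below is this one on each of the two
  columns, \<open>(DA, 0)\<close> with \<open>\<phi> = 0\<close> and \<open>(M \<otimes>\<^sub>B DB, DB)\<close> with \<open>\<phi> = Id\<close>.
\<close>

definition T_bimod ::
  "('r, 'y) ring_scheme \<Rightarrow> ('r, 'j, 'z) module_scheme \<Rightarrow> ('r, 'a, 'v) module_scheme \<Rightarrow>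
   ('r, 'b, 'w) module_scheme \<Rightarrow> ('a, 'b, 'm) bimodule \<Rightarrow>
   (((('a \<Rightarrow> 'j) \<times> 'm) \<Rightarrow>\<^sub>0 int) set \<Rightarrow> (('m \<times> ('b \<Rightarrow> 'j)) \<Rightarrow>\<^sub>0 int) set) \<Rightarrow>
   ('a \<times> 'm \<times> 'b, 'a \<times> 'm \<times> 'b,
    ('a \<Rightarrow> 'j) \<times> (('m \<times> ('b \<Rightarrow> 'j)) \<Rightarrow>\<^sub>0 int) set \<times> ('b \<Rightarrow> 'j)) bimodule"
where
  "T_bimod R J A B M g =
     (let DA = dual_alg R J A; DB = dual_alg R J B; MDB = M_tensor_DB R J B M
      in \<lparr>carrier = carrier DA \<times> carrier MDB \<times> carrier DB, mult = undefined, one = undefined,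
          ring.zero = (\<zero>\<^bsub>DA\<^esub>, \<zero>\<^bsub>MDB\<^esub>, \<zero>\<^bsub>DB\<^esub>),
          add = (\<lambda>(\<alpha>, t, \<beta>) (\<alpha>', t', \<beta>'). (\<alpha> \<oplus>\<^bsub>DA\<^esub> \<alpha>', t \<oplus>\<^bsub>MDB\<^esub> t', \<beta> \<oplus>\<^bsub>DB\<^esub> \<beta>')),
          lact = (\<lambda>(a, m, b) (\<alpha>, t, \<beta>).
                    (lact DA a \<alpha>, lact MDB a t \<oplus>\<^bsub>MDB\<^esub> pure_tensor B M DB m \<beta>, lact DB b \<beta>)),
          ract = (\<lambda>(\<alpha>, t, \<beta>) (a, m, b).
                    (ract DA \<alpha> a, g (pure_tensor A DA M \<alpha> m) \<oplus>\<^bsub>MDB\<^esub> ract MDB t b, ract DB \<beta> b))\<rparr>)"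

end

theory Submission
  imports Defs
begin

text \<open>
  Multiplication from either side gives algebra maps between \<open>\<Lambda>\<close> and the endomorphism algebras of the
  two module structures of \<open>T\<close>, and the point is that they are bijective. A left endomorphism of \<open>T\<close>
  splits along the columns of \<open>T\<close> into endomorphisms of \<open>DA\<close> and \<open>DB\<close> and a map \<open>DA \<rightarrow> M \<otimes> DB\<close>; the
  remaining component vanishes, and \<open>M \<otimes> DB \<rightarrow> M \<otimes> DB\<close> is determined by \<open>DB \<rightarrow> DB\<close>. Since \<open>DDA = A\<close>,
  the endomorphisms of \<open>DA\<close> are the multiplications by elements of \<open>A\<close>. Through \<open>g\<close> and a dual basis
  of the projective module \<open>M\<close> this also yields \<open>Hom(DA, M \<otimes> DB) = Hom(DA, DA \<otimes> M) = M\<close>. Right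
  endomorphisms split along the rows of \<open>T\<close> in the same way.

  The equality \<open>V = DDV\<close> for finitely generated \<open>V\<close> over the artinian ring \<open>R\<close> is obtained without
  length arguments: every submodule of \<open>Hom(V, J)\<close> equals its double annihilator, because this property
  passes from \<open>N\<close> to \<open>N + R u\<close> whenever \<open>(N + R u) / N\<close> is simple and because the annihilators in \<open>V\<close>
  satisfy the descending chain condition. Hence \<open>DV\<close> is finitely generated as well, and the same
  applied to \<open>DV\<close> shows that the evaluations exhaust \<open>DDV\<close>.
\<close>

section \<open>Modules and homomorphisms\<close>

text \<open>The component \<open>M \<otimes> DB \<rightarrow> DA\<close> vanishes because the middle
  entry of \<open>T\<close> is reached from an outer one:
  \<open>(0, m, 0) (0, 0, \<beta>) = (0, m \<otimes> \<beta>, 0)\<close> on the left and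
  \<open>(\<alpha>, 0, 0) (0, m, 0) = (0, g (\<alpha> \<otimes> m), 0)\<close> on the right, while
  the diagonal idempotents of \<open>\<Lambda>\<close> confine the images of the outer entries. The
  two sides draw on exchangeability differently. On the left, maps
  \<open>DA \<rightarrow> M \<otimes> DB\<close> are pulled back along \<open>g\<close> and
  projectivity of \<open>M\<close> over \<open>A\<close> is used; on the right, maps
  \<open>DB \<rightarrow> M \<otimes> DB\<close> are treated directly with projectivity of
  \<open>M\<close> over \<open>B\<close>, and \<open>g\<close> enters through its surjectivity,
  which says that the elements \<open>g (\<alpha> \<otimes> m)\<close> generate. Two facts about the
  socle of \<open>J\<close> carry the duality. Each simple module occurs in it at most once: this
  makes \<open>V \<rightarrow> DDV\<close> surjective, hence the multiplication maps surjective.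
  Each simple module occurs at least once: with the injectivity of \<open>J\<close> this makes
  \<open>J\<close> a cogenerator, hence the multiplication maps injective. Both facts come from the
  essential embedding of \<open>R / rad R\<close> into \<open>J\<close>.\<close>

context left_module
begin

declare smult_closed [simp] smult_one [simp]

lemma smult_l_null [simp]: "x \<in> carrier M \<Longrightarrow> \<zero>\<^bsub>A\<^esub> \<odot>\<^bsub>M\<^esub> x = \<zero>\<^bsub>M\<^esub>"
  using smult_l_distr[of "\<zero>\<^bsub>A\<^esub>" "\<zero>\<^bsub>A\<^esub>" x] by (metis A.l_zero A.zero_closed M.add.r_cancel_one' smult_closed)

lemma smult_r_null [simp]: "a \<in> carrier A \<Longrightarrow> a \<odot>\<^bsub>M\<^esub> \<zero>\<^bsub>M\<^esub> = \<zero>\<^bsub>M\<^esub>"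
  using smult_r_distr[of a "\<zero>\<^bsub>M\<^esub>" "\<zero>\<^bsub>M\<^esub>"] by (metis M.l_zero M.zero_closed M.add.r_cancel_one' smult_closed)

lemma smult_l_minus:
  assumes "a \<in> carrier A" "x \<in> carrier M"
  shows "(\<ominus>\<^bsub>A\<^esub> a) \<odot>\<^bsub>M\<^esub> x = \<ominus>\<^bsub>M\<^esub> (a \<odot>\<^bsub>M\<^esub> x)"
  using assms smult_l_distr[of "\<ominus>\<^bsub>A\<^esub> a" a x]
  by (metis A.a_inv_closed A.l_neg M.minus_equality smult_closed smult_l_null)

lemma finsum_smult:
  "\<lbrakk>finite I; a \<in> carrier A; f \<in> I \<rightarrow> carrier M\<rbrakk> \<Longrightarrow>
     a \<odot>\<^bsub>M\<^esub> (\<Oplus>\<^bsub>M\<^esub> i \<in> I. f i) = (\<Oplus>\<^bsub>M\<^esub> i \<in> I. a \<odot>\<^bsub>M\<^esub> f i)"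
proof (induct set: finite)
  case (insert x F)
  then show ?case by (simp add: Pi_def smult_r_distr)
qed simp

text \<open>Closure under negation comes for free, the negative of \<open>x\<close> being its
  multiple by \<open>-1\<close>.\<close>

lemma submoduleI:
  assumes "H \<subseteq> carrier M" "\<zero>\<^bsub>M\<^esub> \<in> H"
    and "\<And>x y. \<lbrakk>x \<in> H; y \<in> H\<rbrakk> \<Longrightarrow> x \<oplus>\<^bsub>M\<^esub> y \<in> H"
    and smult: "\<And>a x. \<lbrakk>a \<in> carrier A; x \<in> H\<rbrakk> \<Longrightarrow> a \<odot>\<^bsub>M\<^esub> x \<in> H"
  shows "submodule H A M"
proof -
  have "\<ominus>\<^bsub>M\<^esub> x \<in> H" if "x \<in> H" for x
    using smult[of "\<ominus>\<^bsub>A\<^esub> \<one>\<^bsub>A\<^esub>" x] that assms(1) by (auto simp: smult_l_minus subset_iff)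
  then show ?thesis
    using assms by (intro submodule.intro subgroup.intro) (simp_all add: submodule_axioms_def a_inv_def)
qed

section \<open>Submodules and the adjunction of one element\<close>

lemma submodule_zero: "submodule {\<zero>\<^bsub>M\<^esub>} A M"
  by (rule submoduleI) auto

context
  fixes H assumes H: "submodule H A M"
begin

lemma sub_carrier: "x \<in> H \<Longrightarrow> x \<in> carrier M"
  using subgroup.mem_carrier[OF submodule.axioms(1)[OF H]] by simp

lemma sub_zero: "\<zero>\<^bsub>M\<^esub> \<in> H"
  using subgroup.one_closed[OF submodule.axioms(1)[OF H]] by simp

lemma sub_add: "x \<in> H \<Longrightarrow> y \<in> H \<Longrightarrow> x \<oplus>\<^bsub>M\<^esub> y \<in> H"
  using subgroup.m_closed[OF submodule.axioms(1)[OF H]] by simp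

lemma sub_neg: "x \<in> H \<Longrightarrow> \<ominus>\<^bsub>M\<^esub> x \<in> H"
  using subgroup.m_inv_closed[OF submodule.axioms(1)[OF H]] by (simp add: a_inv_def)

lemma sub_minus: "x \<in> H \<Longrightarrow> y \<in> H \<Longrightarrow> x \<ominus>\<^bsub>M\<^esub> y \<in> H"
  by (simp add: a_minus_def sub_add sub_neg)

lemma sub_smult: "a \<in> carrier A \<Longrightarrow> x \<in> H \<Longrightarrow> a \<odot>\<^bsub>M\<^esub> x \<in> H"
  using submodule.smult_closed[OF H] .

text \<open>This is \<open>H + A v\<close>. Adjoining one element at a time drives all later
  inductions: chain conditions, extension of homomorphisms and double annihilators.\<close>

definition adjoin where
  "adjoin v = {h \<oplus>\<^bsub>M\<^esub> r \<odot>\<^bsub>M\<^esub> v | h r. h \<in> H \<and> r \<in> carrier A}"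

lemma adjoin_iff: "x \<in> adjoin v \<longleftrightarrow> (\<exists>h\<in>H. \<exists>r\<in>carrier A. x = h \<oplus>\<^bsub>M\<^esub> r \<odot>\<^bsub>M\<^esub> v)"
  by (auto simp: adjoin_def)

lemma adjoin_self: "v \<in> carrier M \<Longrightarrow> v \<in> adjoin v"
  unfolding adjoin_iff by (rule bexI[OF _ sub_zero], rule bexI[of _ "\<one>\<^bsub>A\<^esub>"]) auto

lemma subset_adjoin: "v \<in> carrier M \<Longrightarrow> H \<subseteq> adjoin v"
proof
  fix x assume "v \<in> carrier M" "x \<in> H"
  then show "x \<in> adjoin v"
    unfolding adjoin_iff
    by (intro bexI[of _ x] bexI[of _ "\<zero>\<^bsub>A\<^esub>"]) (auto simp: sub_carrier)
qed

lemma submodule_adjoin: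
  assumes v: "v \<in> carrier M"
  shows "submodule (adjoin v) A M"
proof (rule submoduleI)
  show "adjoin v \<subseteq> carrier M"
    using v by (auto simp: adjoin_def sub_carrier)
  show "\<zero>\<^bsub>M\<^esub> \<in> adjoin v"
    using subset_adjoin[OF v] sub_zero by blast
next
  fix x y assume "x \<in> adjoin v" "y \<in> adjoin v"
  then obtain h r h' r' where *: "h \<in> H" "r \<in> carrier A" "x = h \<oplus>\<^bsub>M\<^esub> r \<odot>\<^bsub>M\<^esub> v"
      "h' \<in> H" "r' \<in> carrier A" "y = h' \<oplus>\<^bsub>M\<^esub> r' \<odot>\<^bsub>M\<^esub> v"
    by (auto simp: adjoin_def)
  then have "x \<oplus>\<^bsub>M\<^esub> y = (h \<oplus>\<^bsub>M\<^esub> h') \<oplus>\<^bsub>M\<^esub> (r \<oplus>\<^bsub>A\<^esub> r') \<odot>\<^bsub>M\<^esub> v"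
    using v by (simp add: smult_l_distr sub_carrier M.a_ac)
  then show "x \<oplus>\<^bsub>M\<^esub> y \<in> adjoin v"
    using * by (auto simp: adjoin_iff intro!: bexI[of _ "h \<oplus>\<^bsub>M\<^esub> h'"] sub_add)
next
  fix a x assume a: "a \<in> carrier A" and "x \<in> adjoin v"
  then obtain h r where *: "h \<in> H" "r \<in> carrier A" "x = h \<oplus>\<^bsub>M\<^esub> r \<odot>\<^bsub>M\<^esub> v"
    by (auto simp: adjoin_def)
  then have "a \<odot>\<^bsub>M\<^esub> x = a \<odot>\<^bsub>M\<^esub> h \<oplus>\<^bsub>M\<^esub> (a \<otimes>\<^bsub>A\<^esub> r) \<odot>\<^bsub>M\<^esub> v"
    using a v by (simp add: smult_r_distr smult_assoc sub_carrier)
  then show "a \<odot>\<^bsub>M\<^esub> x \<in> adjoin v"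
    using * a by (auto simp: adjoin_iff intro!: bexI[of _ "a \<odot>\<^bsub>M\<^esub> h"] sub_smult)
qed

lemma adjoin_least:
  assumes "submodule K A M" "H \<subseteq> K" "v \<in> K"
  shows "adjoin v \<subseteq> K"
proof
  interpret K: submodule K A M by fact
  fix x assume "x \<in> adjoin v"
  then obtain h r where "h \<in> H" "r \<in> carrier A" "x = h \<oplus>\<^bsub>M\<^esub> r \<odot>\<^bsub>M\<^esub> v"
    by (auto simp: adjoin_def)
  then show "x \<in> K"
    using assms K.m_closed K.smult_closed by (auto simp: subset_iff)
qed

end

lemma eq_if_minus_eq_zero: "\<lbrakk>x \<in> carrier M; y \<in> carrier M; x \<ominus>\<^bsub>M\<^esub> y = \<zero>\<^bsub>M\<^esub>\<rbrakk> \<Longrightarrow> x = y"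
  by (simp add: a_minus_def M.add.inv_solve_right')

end

section \<open>Homomorphisms, additive maps and modules of homomorphisms\<close>

lemma mhomD:
  assumes "f \<in> mhom A M N"
  shows "x \<in> carrier M \<Longrightarrow> f x \<in> carrier N"
    and "\<lbrakk>x \<in> carrier M; y \<in> carrier M\<rbrakk> \<Longrightarrow> f (x \<oplus>\<^bsub>M\<^esub> y) = f x \<oplus>\<^bsub>N\<^esub> f y"
    and "\<lbrakk>a \<in> carrier A; x \<in> carrier M\<rbrakk> \<Longrightarrow> f (a \<odot>\<^bsub>M\<^esub> x) = a \<odot>\<^bsub>N\<^esub> f x"
    and "f \<in> extensional (carrier M)"
  using assms by (auto simp: mhom_def PiE_def)

lemma mhom_eqI:
  assumes "f \<in> mhom A M N" "h \<in> mhom A M' N'" "carrier M = carrier M'" "\<And>x. x \<in> carrier M \<Longrightarrow> f x = h x"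
  shows "f = h"
  using assms mhomD(4) by (metis extensionalityI)

lemma (in left_module) mhom_restrictI:
  assumes "\<And>x. x \<in> carrier M \<Longrightarrow> f x \<in> carrier N"
    and "\<And>x y. \<lbrakk>x \<in> carrier M; y \<in> carrier M\<rbrakk> \<Longrightarrow> f (x \<oplus>\<^bsub>M\<^esub> y) = f x \<oplus>\<^bsub>N\<^esub> f y"
    and "\<And>a x. \<lbrakk>a \<in> carrier A; x \<in> carrier M\<rbrakk> \<Longrightarrow> f (a \<odot>\<^bsub>M\<^esub> x) = a \<odot>\<^bsub>N\<^esub> f x"
  shows "restrict f (carrier M) \<in> mhom A M N"
  using assms by (auto simp: mhom_def)

text \<open>Kept apart from \<open>mhom\<close> for maps that are neither extensional nor linear
  over a fixed ring, such as \<open>x \<mapsto> m \<otimes> x\<close> or the maps obtained from the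
  universal property of the tensor product.\<close>

locale additive_map = M: abelian_group M + N: abelian_group N
  for M :: "('m, 'y) ring_scheme" and N :: "('n, 'z) ring_scheme" and f :: "'m \<Rightarrow> 'n" +
  assumes closed: "x \<in> carrier M \<Longrightarrow> f x \<in> carrier N"
    and add: "\<lbrakk>x \<in> carrier M; y \<in> carrier M\<rbrakk> \<Longrightarrow> f (x \<oplus>\<^bsub>M\<^esub> y) = f x \<oplus>\<^bsub>N\<^esub> f y"
begin

lemma zero: "f \<zero>\<^bsub>M\<^esub> = \<zero>\<^bsub>N\<^esub>"
  using add[of "\<zero>\<^bsub>M\<^esub>" "\<zero>\<^bsub>M\<^esub>"] closed by (metis M.l_zero M.zero_closed N.add.r_cancel_one')

lemma neg: "x \<in> carrier M \<Longrightarrow> f (\<ominus>\<^bsub>M\<^esub> x) = \<ominus>\<^bsub>N\<^esub> f x"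
  using add[of "\<ominus>\<^bsub>M\<^esub> x" x] closed zero by (metis M.a_inv_closed M.l_neg N.minus_equality)

lemma minus: "\<lbrakk>x \<in> carrier M; y \<in> carrier M\<rbrakk> \<Longrightarrow> f (x \<ominus>\<^bsub>M\<^esub> y) = f x \<ominus>\<^bsub>N\<^esub> f y"
  by (simp add: a_minus_def add neg)

lemma finsum:
  "finite I \<Longrightarrow> h \<in> I \<rightarrow> carrier M \<Longrightarrow> f (\<Oplus>\<^bsub>M\<^esub>i\<in>I. h i) = (\<Oplus>\<^bsub>N\<^esub>i\<in>I. f (h i))"
proof (induct set: finite)
  case (insert x F)
  then show ?case by (simp add: Pi_def add closed)
qed (simp add: zero)

end

lemma mhom_additive:
  assumes "f \<in> mhom A M N" "abelian_group M" "abelian_group N"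
  shows "additive_map M N f"
  using assms by (simp add: additive_map_def additive_map_axioms_def mhomD)

text \<open>The \<open>R\<close>-module underlying \<open>dual\<close>. As it is again an
  \<open>R\<close>-module, the double dual is simply \<open>hom_mod\<close> applied twice.\<close>

definition hom_mod ::
  "('r, 'y) ring_scheme \<Rightarrow> ('r, 'v, 'z1) module_scheme \<Rightarrow> ('r, 'j, 'z2) module_scheme \<Rightarrow> ('r, 'v \<Rightarrow> 'j) module"
where
  "hom_mod R V J =
     \<lparr>carrier = mhom R V J, mult = undefined, one = undefined,
      ring.zero = (\<lambda>x\<in>carrier V. \<zero>\<^bsub>J\<^esub>),
      add = (\<lambda>f h. \<lambda>x\<in>carrier V. f x \<oplus>\<^bsub>J\<^esub> h x),
      smult = (\<lambda>r f. \<lambda>x\<in>carrier V. r \<odot>\<^bsub>J\<^esub> f x)\<rparr>"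

lemma hom_mod_simps [simp]:
  "carrier (hom_mod R V J) = mhom R V J"
  "\<zero>\<^bsub>hom_mod R V J\<^esub> = (\<lambda>x\<in>carrier V. \<zero>\<^bsub>J\<^esub>)"
  "f \<oplus>\<^bsub>hom_mod R V J\<^esub> h = (\<lambda>x\<in>carrier V. f x \<oplus>\<^bsub>J\<^esub> h x)"
  "r \<odot>\<^bsub>hom_mod R V J\<^esub> f = (\<lambda>x\<in>carrier V. r \<odot>\<^bsub>J\<^esub> f x)"
  by (simp_all add: hom_mod_def)

text \<open>Commutativity of \<open>R\<close> is what makes \<open>r f\<close> linear again:
  \<open>r (a f x) = a (r f x)\<close>. Negatives are multiples by \<open>-1\<close>.\<close>

lemma left_module_hom_mod:
  assumes "cring R" "left_module R V" "left_module R J"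
  shows "left_module R (hom_mod R V J)"
proof -
  interpret R: cring R by fact
  interpret V: left_module R V by fact
  interpret J: left_module R J by fact
  let ?U = "hom_mod R V J"
  note h = mhomD(1-3)
  have eqI: "f = g" if "f \<in> carrier ?U" "g \<in> carrier ?U" "\<And>x. x \<in> carrier V \<Longrightarrow> f x = g x" for f g
    using that mhom_eqI[of f R V J g V J] by simp
  have eval: "(f \<oplus>\<^bsub>?U\<^esub> g) x = f x \<oplus>\<^bsub>J\<^esub> g x" "(r \<odot>\<^bsub>?U\<^esub> f) x = r \<odot>\<^bsub>J\<^esub> f x" "\<zero>\<^bsub>?U\<^esub> x = \<zero>\<^bsub>J\<^esub>"
    if "x \<in> carrier V" for f g r x using that by simp_all
  have add: "f \<oplus>\<^bsub>?U\<^esub> g \<in> carrier ?U" if "f \<in> carrier ?U" "g \<in> carrier ?U" for f g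
    using that by (auto intro!: V.mhom_restrictI simp: h J.smult_r_distr J.M.a_ac)
  have smult: "r \<odot>\<^bsub>?U\<^esub> f \<in> carrier ?U" if "r \<in> carrier R" "f \<in> carrier ?U" for r f
    using that by (auto intro!: V.mhom_restrictI simp: h J.smult_r_distr R.m_comm simp flip: J.smult_assoc)
  have zero: "\<zero>\<^bsub>?U\<^esub> \<in> carrier ?U"
    by (auto intro!: V.mhom_restrictI)
  have closed: "f x \<in> carrier J" if "f \<in> carrier ?U" "x \<in> carrier V" for f x
    using that by (simp add: h)
  show ?thesis
  proof (intro left_module.intro left_module_axioms.intro R.ring_axioms abelian_groupI)
    fix f assume f: "f \<in> carrier ?U"
    show "\<exists>g\<in>carrier ?U. g \<oplus>\<^bsub>?U\<^esub> f = \<zero>\<^bsub>?U\<^esub>"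
    proof
      show neg: "(\<ominus>\<^bsub>R\<^esub> \<one>\<^bsub>R\<^esub>) \<odot>\<^bsub>?U\<^esub> f \<in> carrier ?U" using f by (intro smult) simp_all
      show "(\<ominus>\<^bsub>R\<^esub> \<one>\<^bsub>R\<^esub>) \<odot>\<^bsub>?U\<^esub> f \<oplus>\<^bsub>?U\<^esub> f = \<zero>\<^bsub>?U\<^esub>"
        by (rule eqI[OF add[OF neg f] zero])
          (simp add: eval closed[OF f] J.smult_l_minus J.M.l_neg del: hom_mod_simps)
    qed
  qed (rule eqI add smult zero | assumption
      | simp add: eval closed add smult zero J.M.a_ac J.smult_l_distr J.smult_r_distr J.smult_assoc del: hom_mod_simps)+
qed

text \<open>
  Transport along an injection brings copies of arbitrary modules into the type over which the
  test modules of \<open>projective_mod\<close> and \<open>injective_mod\<close> range.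
\<close>

definition transport :: "('m \<Rightarrow> 'n) \<Rightarrow> ('a, 'm, 'z) module_scheme \<Rightarrow> ('a, 'n) module" where
  "transport e M =
     (let i = the_inv_into (carrier M) e in
      \<lparr>carrier = e ` carrier M, mult = undefined, one = undefined, ring.zero = e \<zero>\<^bsub>M\<^esub>,
       add = (\<lambda>x y. e (i x \<oplus>\<^bsub>M\<^esub> i y)), smult = (\<lambda>a x. e (a \<odot>\<^bsub>M\<^esub> i x))\<rparr>)"

lemma (in left_module)
  assumes e: "inj_on e (carrier M)"
  shows left_module_transport: "left_module A (transport e M)"
    and transport_mhom: "restrict e (carrier M) \<in> mhom A M (transport e M)"
    and transport_inv_mhom: "restrict (the_inv_into (carrier M) e) (e ` carrier M) \<in> mhom A (transport e M) M"
proof -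
  have [simp]: "carrier (transport e M) = e ` carrier M" "\<zero>\<^bsub>transport e M\<^esub> = e \<zero>\<^bsub>M\<^esub>"
    by (simp_all add: transport_def Let_def)
  have [simp]: "e x \<oplus>\<^bsub>transport e M\<^esub> e y = e (x \<oplus>\<^bsub>M\<^esub> y)"
    if "x \<in> carrier M" "y \<in> carrier M" for x y
    using that e by (simp add: transport_def Let_def the_inv_into_f_f)
  have [simp]: "a \<odot>\<^bsub>transport e M\<^esub> e x = e (a \<odot>\<^bsub>M\<^esub> x)" if "x \<in> carrier M" for a x
    using that e by (simp add: transport_def Let_def the_inv_into_f_f)
  show "left_module A (transport e M)"
    by (intro left_module.intro left_module_axioms.intro A.ring_axioms abelian_groupI)
      (auto simp: M.a_ac smult_l_distr smult_r_distr smult_assoc intro: M.l_neg M.r_neg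
        intro!: bexI[of _ "\<ominus>\<^bsub>M\<^esub> _"] arg_cong[of _ _ e])
  show "restrict e (carrier M) \<in> mhom A M (transport e M)"
    by (rule mhom_restrictI) auto
  show "restrict (the_inv_into (carrier M) e) (e ` carrier M) \<in> mhom A (transport e M) M"
    using e by (auto simp: mhom_def the_inv_into_f_f)
qed

lemma carrier_transport [simp]: "carrier (transport e M) = e ` carrier M"
  by (simp add: transport_def Let_def)

section \<open>The regular module, ideals and restriction to submodules\<close>

lemma lmod_simps [simp]:
  "carrier (lmod M) = carrier M" "\<zero>\<^bsub>lmod M\<^esub> = \<zero>\<^bsub>M\<^esub>" "x \<oplus>\<^bsub>lmod M\<^esub> y = x \<oplus>\<^bsub>M\<^esub> y" "a \<odot>\<^bsub>lmod M\<^esub> x = lact M a x"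
  by (simp_all add: lmod_def)

lemma rmod_simps [simp]:
  "carrier (rmod M) = carrier M" "\<zero>\<^bsub>rmod M\<^esub> = \<zero>\<^bsub>M\<^esub>" "x \<oplus>\<^bsub>rmod M\<^esub> y = x \<oplus>\<^bsub>M\<^esub> y" "a \<odot>\<^bsub>rmod M\<^esub> x = ract M x a"
  by (simp_all add: rmod_def)

lemma regular_bimod_simps [simp]:
  "carrier (regular_bimod A) = carrier A" "\<zero>\<^bsub>regular_bimod A\<^esub> = \<zero>\<^bsub>A\<^esub>"
  "x \<oplus>\<^bsub>regular_bimod A\<^esub> y = x \<oplus>\<^bsub>A\<^esub> y"
  "lact (regular_bimod A) x y = x \<otimes>\<^bsub>A\<^esub> y" "ract (regular_bimod A) x y = x \<otimes>\<^bsub>A\<^esub> y"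
  by (simp_all add: regular_bimod_def)

abbreviation self_mod where "self_mod A \<equiv> lmod (regular_bimod A)"

lemma left_module_self: "ring A \<Longrightarrow> left_module A (self_mod A)"
proof -
  assume "ring A"
  then interpret A: ring A .
  show ?thesis
    by (intro left_module.intro left_module_axioms.intro A.ring_axioms abelian_groupI)
      (auto simp: A.l_distr A.r_distr A.m_assoc A.a_ac intro: A.l_neg intro!: bexI[of _ "\<ominus>\<^bsub>A\<^esub> _"])
qed

text \<open>Makes the submodule constructions, \<open>adjoin\<close> in particular, available for
  ideals.\<close>

lemma (in cring) submodule_self_iff_ideal: "submodule I R (self_mod R) \<longleftrightarrow> ideal I R"
proof
  interpret S: left_module R "self_mod R" by (rule left_module_self) (rule ring_axioms)
  assume I: "submodule I R (self_mod R)"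
  note s = S.sub_carrier[OF I, simplified] S.sub_zero[OF I, simplified] S.sub_add[OF I, simplified]
    S.sub_smult[OF I, simplified]
  show "ideal I R"
  proof (rule idealI[OF ring_axioms])
    have "\<ominus> x \<in> I" if "x \<in> I" for x
      using s(4)[of "\<ominus> \<one>" x] s(1)[of x] that by (simp add: l_minus)
    then show "subgroup I (add_monoid R)"
      using s by (intro subgroup.intro) (auto simp: a_inv_def)
    show x_a: "x \<otimes> a \<in> I" if "a \<in> I" "x \<in> carrier R" for a x
      using s(4) that by blast
    show "a \<otimes> x \<in> I" if "a \<in> I" "x \<in> carrier R" for a x
      using x_a[OF that] s(1) that by (simp add: m_comm)
  qed
next
  interpret S: left_module R "self_mod R" by (rule left_module_self) (rule ring_axioms)
  assume "ideal I R"
  then interpret I: ideal I R .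
  show "submodule I R (self_mod R)"
    by (rule S.submoduleI) (auto intro: I.I_l_closed I.a_closed)
qed

text \<open>The ideal \<open>I + R r\<close> is strictly larger than \<open>I\<close>, so it
  contains \<open>1\<close>. In other words, \<open>u\<close> inverts \<open>r\<close> modulo
  \<open>I\<close>.\<close>

lemma (in cring) maximalideal_coprime:
  assumes "maximalideal I R" "r \<in> carrier R" "r \<notin> I"
  obtains u q where "u \<in> carrier R" "q \<in> I" "\<one> = q \<oplus> u \<otimes> r"
proof -
  interpret I: maximalideal I R by fact
  interpret S: left_module R "self_mod R" by (rule left_module_self) (rule ring_axioms)
  have I: "submodule I R (self_mod R)"
    by (simp add: submodule_self_iff_ideal I.ideal_axioms)
  have "ideal (S.adjoin I r) R"
    using S.submodule_adjoin[OF I] assms(2) by (simp add: submodule_self_iff_ideal)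
  moreover have "I \<subseteq> S.adjoin I r" "r \<in> S.adjoin I r"
    using S.subset_adjoin[OF I] S.adjoin_self[OF I] assms by auto
  moreover have "S.adjoin I r \<subseteq> carrier R"
    using S.sub_carrier[OF S.submodule_adjoin[OF I]] assms by auto
  ultimately have "S.adjoin I r = carrier R"
    using I.I_maximal assms(3) by blast
  then have "\<one> \<in> S.adjoin I r" by simp
  then show thesis
    using that unfolding S.adjoin_iff[OF I] by auto
qed

lemma (in left_module) left_module_sub:
  assumes H: "submodule H A M"
  shows "left_module A (M\<lparr>carrier := H\<rparr>)"
  using sub_carrier[OF H] sub_zero[OF H] sub_add[OF H] sub_smult[OF H] sub_neg[OF H]
  by (intro left_module.intro left_module_axioms.intro A.ring_axioms abelian_groupI)
    (auto simp: M.a_ac smult_l_distr smult_r_distr smult_assoc intro: M.l_neg M.r_neg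
      intro!: bexI[of _ "\<ominus>\<^bsub>M\<^esub> _"])

lemma mhom_compose:
  assumes "f \<in> mhom A M N" "g \<in> mhom A N P" "left_module A M"
  shows "compose (carrier M) g f \<in> mhom A M P"
proof -
  interpret M: left_module A M by fact
  show ?thesis
    unfolding compose_def
    by (rule M.mhom_restrictI) (simp_all add: mhomD(1-3)[OF assms(1)] mhomD(1-3)[OF assms(2)])
qed

lemma mhom_inverse:
  assumes f: "f \<in> mhom A M N" and M: "left_module A M" and N: "left_module A N"
    and bij: "bij_betw f (carrier M) (carrier N)"
  shows "restrict (the_inv_into (carrier M) f) (carrier N) \<in> mhom A N M"
proof -
  interpret M: left_module A M by fact
  interpret N: left_module A N by fact
  have inj: "inj_on f (carrier M)" and im: "f ` carrier M = carrier N"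
    using bij by (auto simp: bij_betw_def)
  let ?i = "the_inv_into (carrier M) f"
  have i: "?i y \<in> carrier M" "f (?i y) = y" if "y \<in> carrier N" for y
    using that by (auto simp: im the_inv_into_into[OF inj] f_the_inv_into_f[OF inj])
  have eq: "?i y = x" if "x \<in> carrier M" "f x = y" for x y
    using that by (auto simp: the_inv_into_f_f[OF inj])
  show ?thesis
    by (rule N.mhom_restrictI) (auto simp: i mhomD(2,3)[OF f] intro!: eq)
qed

text \<open>Since each scalar of \<open>R\<close> acts on an element as some scalar of
  \<open>A\<close>, every \<open>A\<close>-submodule is an \<open>R\<close>-submodule, and
  generators over \<open>R\<close> generate over \<open>A\<close>.\<close>

lemma (in left_module) fin_gen_restrict:
  assumes R: "left_module R V" and fg: "fin_gen R V" and carrier: "carrier V = carrier M"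
    and add: "\<And>x y. \<lbrakk>x \<in> carrier M; y \<in> carrier M\<rbrakk> \<Longrightarrow> x \<oplus>\<^bsub>V\<^esub> y = x \<oplus>\<^bsub>M\<^esub> y" and zero: "\<zero>\<^bsub>V\<^esub> = \<zero>\<^bsub>M\<^esub>"
    and smult: "\<And>r x. \<lbrakk>r \<in> carrier R; x \<in> carrier M\<rbrakk> \<Longrightarrow> \<exists>a\<in>carrier A. r \<odot>\<^bsub>V\<^esub> x = a \<odot>\<^bsub>M\<^esub> x"
  shows "fin_gen A M"
proof -
  interpret V: left_module R V by fact
  have sub: "submodule H R V" if H: "submodule H A M" for H
  proof (rule V.submoduleI)
    show "r \<odot>\<^bsub>V\<^esub> x \<in> H" if "r \<in> carrier R" "x \<in> H" for r x
      using smult[OF that(1) sub_carrier[OF H that(2)]] sub_smult[OF H _ that(2)] by auto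
  qed (use sub_carrier[OF H] sub_zero[OF H] sub_add[OF H] in \<open>auto simp: carrier add zero\<close>)
  obtain S where S: "finite S" "S \<subseteq> carrier V" "\<forall>H. submodule H R V \<and> S \<subseteq> H \<longrightarrow> H = carrier V"
    using fg unfolding fin_gen_def by blast
  show ?thesis
    unfolding fin_gen_def by (rule exI[of _ S]) (use S sub carrier in simp)
qed

section \<open>Chain conditions\<close>

text \<open>Without a minimal member, choosing a strictly smaller one again and again gives an
  infinite strict chain. The ideals are indexed because the index of a minimal one is what is wanted
  later, for instance a submodule whose coefficient ideal is minimal.\<close>

lemma artinian_minimal_ideal:
  assumes "artinian R" "X \<noteq> {}" "\<And>i. i \<in> X \<Longrightarrow> ideal (f i) R"
  obtains i where "i \<in> X" "\<And>k. k \<in> X \<Longrightarrow> f k \<subseteq> f i \<Longrightarrow> f k = f i"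
proof (rule ccontr)
  assume "\<not> thesis"
  with that have "\<forall>i\<in>X. \<exists>k\<in>X. f k \<subset> f i" by blast
  then obtain s where s: "\<And>i. i \<in> X \<Longrightarrow> s i \<in> X" "\<And>i. i \<in> X \<Longrightarrow> f (s i) \<subset> f i" by metis
  obtain i0 where "i0 \<in> X" using assms by blast
  define c where "c n = (s ^^ n) i0" for n
  have c: "c n \<in> X" for n
    by (induction n) (simp_all add: c_def \<open>i0 \<in> X\<close> s)
  have Suc: "f (c (Suc n)) \<subset> f (c n)" for n using s(2)[OF c[of n]] by (simp add: c_def)
  have "\<forall>n. ideal (f (c n)) R \<and> f (c (Suc n)) \<subseteq> f (c n)"
    using assms(3)[OF c] Suc by blast
  then obtain N where "\<forall>n\<ge>N. f (c n) = f (c N)"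
    using assms(1)[unfolded artinian_def, rule_format, of "\<lambda>n. f (c n)"] by blast
  then have "f (c (Suc N)) = f (c N)" by (meson le_Suc_eq order_refl)
  then show False using Suc[of N] by simp
qed

text \<open>The condition is relative to \<open>H\<close> so that it can be built up by adjoining
  generators to \<open>H\<close>.\<close>

definition dcc_on where
  "dcc_on A M H \<longleftrightarrow> (\<forall>F. F \<noteq> {} \<and> (\<forall>N\<in>F. submodule N A M \<and> N \<subseteq> H) \<longrightarrow>
     (\<exists>N\<in>F. \<forall>N'\<in>F. N' \<subseteq> N \<longrightarrow> N' = N))"

lemma dcc_on_minimal:
  assumes "dcc_on A M H" "X \<noteq> {}" "\<And>i. i \<in> X \<Longrightarrow> submodule (f i) A M" "\<And>i. i \<in> X \<Longrightarrow> f i \<subseteq> H"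
  obtains i where "i \<in> X" "\<And>k. k \<in> X \<Longrightarrow> f k \<subseteq> f i \<Longrightarrow> f k = f i"
proof -
  have "f ` X \<noteq> {} \<and> (\<forall>N\<in>f ` X. submodule N A M \<and> N \<subseteq> H)"
    using assms(2-4) by blast
  then have "\<exists>N\<in>f ` X. \<forall>N'\<in>f ` X. N' \<subseteq> N \<longrightarrow> N' = N"
    by (rule assms(1)[unfolded dcc_on_def, THEN spec, THEN mp])
  then obtain i where "i \<in> X" "\<forall>k\<in>X. f k \<subseteq> f i \<longrightarrow> f k = f i" by auto
  then show thesis using that[of i] by metis
qed

context left_module
begin

lemma submodule_Int:
  assumes "submodule H A M" "submodule K A M"
  shows "submodule (H \<inter> K) A M"
  by (rule submoduleI)
    (auto intro: sub_carrier[OF assms(1)] sub_zero[OF assms(1)] sub_add[OF assms(1)] sub_smult[OF assms(1)]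
       sub_zero[OF assms(2)] sub_add[OF assms(2)] sub_smult[OF assms(2)])

lemma ideal_colon:
  assumes "cring A" and N: "submodule N A M" and v: "v \<in> carrier M"
  shows "ideal {r \<in> carrier A. r \<odot>\<^bsub>M\<^esub> v \<in> N} A"
proof -
  interpret cring A by fact
  interpret S: left_module A "self_mod A" by (rule left_module_self) (rule ring_axioms)
  show ?thesis
    unfolding submodule_self_iff_ideal[symmetric]
    by (rule S.submoduleI)
      (auto simp: v smult_l_distr smult_assoc sub_zero[OF N] intro: sub_add[OF N] sub_smult[OF N])
qed

lemma submodule_sum:
  assumes H: "submodule H A M" and K: "submodule K A M"
  shows "submodule {h \<oplus>\<^bsub>M\<^esub> k | h k. h \<in> H \<and> k \<in> K} A M"
proof (rule submoduleI)
  note c = sub_carrier[OF H] sub_carrier[OF K]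
  show "{h \<oplus>\<^bsub>M\<^esub> k | h k. h \<in> H \<and> k \<in> K} \<subseteq> carrier M"
    using c by auto
  have "\<zero>\<^bsub>M\<^esub> = \<zero>\<^bsub>M\<^esub> \<oplus>\<^bsub>M\<^esub> \<zero>\<^bsub>M\<^esub>" by simp
  then show "\<zero>\<^bsub>M\<^esub> \<in> {h \<oplus>\<^bsub>M\<^esub> k | h k. h \<in> H \<and> k \<in> K}"
    using sub_zero[OF H] sub_zero[OF K] by blast
  fix x y assume "x \<in> {h \<oplus>\<^bsub>M\<^esub> k | h k. h \<in> H \<and> k \<in> K}" "y \<in> {h \<oplus>\<^bsub>M\<^esub> k | h k. h \<in> H \<and> k \<in> K}"
  then obtain h k h' k' where *: "h \<in> H" "k \<in> K" "h' \<in> H" "k' \<in> K" "x = h \<oplus>\<^bsub>M\<^esub> k" "y = h' \<oplus>\<^bsub>M\<^esub> k'" by blast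
  then have "x \<oplus>\<^bsub>M\<^esub> y = (h \<oplus>\<^bsub>M\<^esub> h') \<oplus>\<^bsub>M\<^esub> (k \<oplus>\<^bsub>M\<^esub> k')" by (simp add: c M.a_ac)
  then show "x \<oplus>\<^bsub>M\<^esub> y \<in> {h \<oplus>\<^bsub>M\<^esub> k | h k. h \<in> H \<and> k \<in> K}"
    using * sub_add[OF H] sub_add[OF K] by blast
next
  fix a x assume a: "a \<in> carrier A" and "x \<in> {h \<oplus>\<^bsub>M\<^esub> k | h k. h \<in> H \<and> k \<in> K}"
  then obtain h k where *: "h \<in> H" "k \<in> K" "x = h \<oplus>\<^bsub>M\<^esub> k" by blast
  then have "a \<odot>\<^bsub>M\<^esub> x = a \<odot>\<^bsub>M\<^esub> h \<oplus>\<^bsub>M\<^esub> a \<odot>\<^bsub>M\<^esub> k"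
    using a by (simp add: sub_carrier[OF H] sub_carrier[OF K] smult_r_distr)
  then show "a \<odot>\<^bsub>M\<^esub> x \<in> {h \<oplus>\<^bsub>M\<^esub> k | h k. h \<in> H \<and> k \<in> K}"
    using * a sub_smult[OF H] sub_smult[OF K] by blast
qed

text \<open>Since \<open>adjoin H v\<close> modulo \<open>H\<close> is cyclic, a submodule
  \<open>N\<close> has two invariants: its trace \<open>N \<inter> H\<close>, and the ideal
  \<open>I N\<close> of those \<open>r\<close> with \<open>r v \<in> H + N\<close>. If
  \<open>N' \<subseteq> N\<close> have the same invariants, they are equal. Minimizing first the
  trace and then the ideal therefore yields a minimal member.\<close>

lemma dcc_on_adjoin:
  assumes "cring A" "artinian A" and H: "submodule H A M" and v: "v \<in> carrier M" and dcc: "dcc_on A M H"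
  shows "dcc_on A M (adjoin H v)"
  unfolding dcc_on_def
proof (intro allI impI, elim conjE)
  fix F assume "F \<noteq> {}" and "\<forall>N\<in>F. submodule N A M \<and> N \<subseteq> adjoin H v"
  then have F: "\<And>N. N \<in> F \<Longrightarrow> submodule N A M" "\<And>N. N \<in> F \<Longrightarrow> N \<subseteq> adjoin H v" by auto
  define S where "S N = {h \<oplus>\<^bsub>M\<^esub> k | h k. h \<in> H \<and> k \<in> N}" for N
  define I where "I N = {r \<in> carrier A. r \<odot>\<^bsub>M\<^esub> v \<in> S N}" for N
  obtain N1 where N1: "N1 \<in> F" "\<And>N. N \<in> F \<Longrightarrow> N \<inter> H \<subseteq> N1 \<inter> H \<Longrightarrow> N \<inter> H = N1 \<inter> H"
    using dcc_on_minimal[OF dcc \<open>F \<noteq> {}\<close>, of "\<lambda>N. N \<inter> H"] submodule_Int[OF F(1) H] by blast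
  define G where "G = {N \<in> F. N \<inter> H = N1 \<inter> H}"
  have "G \<noteq> {}" using N1(1) by (auto simp: G_def)
  moreover have "ideal (I K) A" if "K \<in> G" for K
  proof -
    have "submodule K A M" using that F(1) by (simp add: G_def)
    then have "submodule (S K) A M" unfolding S_def by (rule submodule_sum[OF H])
    then show ?thesis unfolding I_def using v by (rule ideal_colon[OF assms(1)])
  qed
  ultimately obtain N where N: "N \<in> G" "\<And>N'. N' \<in> G \<Longrightarrow> I N' \<subseteq> I N \<Longrightarrow> I N' = I N"
    using artinian_minimal_ideal[OF assms(2), of G I] by metis
  show "\<exists>N\<in>F. \<forall>N'\<in>F. N' \<subseteq> N \<longrightarrow> N' = N"
  proof (intro bexI ballI impI)
    show "N \<in> F" using N(1) by (simp add: G_def)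
    fix N' assume N': "N' \<in> F" "N' \<subseteq> N"
    have NH: "N \<inter> H = N1 \<inter> H" using N(1) by (simp add: G_def)
    then have NH': "N' \<inter> H = N1 \<inter> H" using N1(2)[OF N'(1)] N'(2) by blast
    have IN: "I N' = I N"
      using N' NH' by (intro N(2)) (auto simp: G_def I_def S_def)
    note sN = F(1)[OF \<open>N \<in> F\<close>] and sN' = F(1)[OF N'(1)]
    have "N \<subseteq> N'"
    proof
      fix n assume n: "n \<in> N"
      then obtain h r where hr: "h \<in> H" "r \<in> carrier A" "n = h \<oplus>\<^bsub>M\<^esub> r \<odot>\<^bsub>M\<^esub> v"
        using F(2)[OF \<open>N \<in> F\<close>] unfolding adjoin_def[OF H] by blast
      have "r \<odot>\<^bsub>M\<^esub> v = \<ominus>\<^bsub>M\<^esub> h \<oplus>\<^bsub>M\<^esub> n"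
        using hr v sub_carrier[OF H] by (simp add: M.r_neg1)
      then have "r \<in> I N"
        using hr n sub_neg[OF H] unfolding I_def S_def by blast
      then have "r \<in> I N'" by (simp add: IN)
      then obtain h' n' where hn: "h' \<in> H" "n' \<in> N'" "r \<odot>\<^bsub>M\<^esub> v = h' \<oplus>\<^bsub>M\<^esub> n'"
        unfolding I_def S_def by blast
      have c: "h \<in> carrier M" "h' \<in> carrier M" "n' \<in> carrier M"
        using hr hn sub_carrier[OF H] sub_carrier[OF sN'] by auto
      then have eq: "n = (h \<oplus>\<^bsub>M\<^esub> h') \<oplus>\<^bsub>M\<^esub> n'"
        using hr(3) hn(3) by (simp add: M.a_ac)
      \<comment> \<open>Subtracting \<open>n'\<close>, which lies in
        \<open>N' \<subseteq> N\<close>, moves \<open>n\<close> into the trace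
        \<open>N \<inter> H\<close>, and this is also the trace of \<open>N'\<close>.\<close>
      have "n \<ominus>\<^bsub>M\<^esub> n' \<in> N"
        using n hn N'(2) by (intro sub_minus[OF sN]) auto
      moreover have "n \<ominus>\<^bsub>M\<^esub> n' = h \<oplus>\<^bsub>M\<^esub> h'"
        using eq c by (simp add: a_minus_def M.a_assoc M.r_neg)
      ultimately have "h \<oplus>\<^bsub>M\<^esub> h' \<in> N \<inter> H"
        using hr hn sub_add[OF H] by auto
      then have "h \<oplus>\<^bsub>M\<^esub> h' \<in> N'" using NH NH' by blast
      then show "n \<in> N'" unfolding eq using sub_add[OF sN'] hn(2) by simp
    qed
    then show "N' = N" using N'(2) by blast
  qed
qed

text \<open>Starting from the zero submodule, the generators are adjoined one by one; the final
  \<open>H\<close> contains all of them and is the whole module.\<close>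

lemma fin_gen_dcc:
  assumes "cring A" "artinian A" "fin_gen A M"
  shows "dcc_on A M (carrier M)"
proof -
  obtain S where S: "finite S" "S \<subseteq> carrier M" "\<And>H. submodule H A M \<Longrightarrow> S \<subseteq> H \<Longrightarrow> H = carrier M"
    using assms(3) unfolding fin_gen_def by blast
  have "\<exists>H. submodule H A M \<and> S \<subseteq> H \<and> dcc_on A M H"
    using S(1,2)
  proof (induction S rule: finite_induct)
    case empty
    have "dcc_on A M {\<zero>\<^bsub>M\<^esub>}"
      unfolding dcc_on_def
    proof (intro allI impI, elim conjE)
      fix F assume "F \<noteq> {}" and F: "\<forall>N\<in>F. submodule N A M \<and> N \<subseteq> {\<zero>\<^bsub>M\<^esub>}"
      then have "N = {\<zero>\<^bsub>M\<^esub>}" if "N \<in> F" for N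
        using that sub_zero[of N] by blast
      then show "\<exists>N\<in>F. \<forall>N'\<in>F. N' \<subseteq> N \<longrightarrow> N' = N"
        using \<open>F \<noteq> {}\<close> by blast
    qed
    then show ?case using submodule_zero by blast
  next
    case (insert x S)
    then obtain H where H: "submodule H A M" "S \<subseteq> H" "dcc_on A M H" by auto
    have x: "x \<in> carrier M" using insert by auto
    show ?case
      using dcc_on_adjoin[OF assms(1,2) H(1) x H(3)] submodule_adjoin[OF H(1) x]
        subset_adjoin[OF H(1) x] adjoin_self[OF H(1) x] H(2) by blast
  qed
  then show ?thesis using S(3) by metis
qed

text \<open>Over an artinian ring the nonzero cyclic module generated by \<open>y\<close> modulo
  \<open>N\<close> contains a simple one. Take an ideal \<open>I\<close> minimal among those with
  \<open>I y\<close> not inside \<open>N\<close>, and \<open>r \<in> I\<close> with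
  \<open>r y \<notin> N\<close>. Whenever \<open>s r y \<notin> N\<close>, minimality makes
  \<open>s r\<close> generate \<open>I\<close>, so \<open>r\<close> is a multiple of
  \<open>s r\<close>; hence \<open>r y\<close> generates a simple submodule of the quotient.\<close>

lemma simple_in_quotient:
  assumes "cring A" "artinian A" and N: "submodule N A M" and y: "y \<in> carrier M" "y \<notin> N"
  obtains r where "r \<in> carrier A" "r \<odot>\<^bsub>M\<^esub> y \<notin> N"
    "maximalideal {s \<in> carrier A. s \<odot>\<^bsub>M\<^esub> (r \<odot>\<^bsub>M\<^esub> y) \<in> N} A"
proof -
  interpret cring A by fact
  interpret S: left_module A "self_mod A" by (rule left_module_self) (rule ring_axioms)
  define K where "K = {r \<in> carrier A. r \<odot>\<^bsub>M\<^esub> y \<in> N}"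
  define F where "F = {I. ideal I A \<and> \<not> I \<subseteq> K}"
  have "\<one>\<^bsub>A\<^esub> \<notin> K" using y by (simp add: K_def)
  then have "F \<noteq> {}" using oneideal by (auto simp: F_def)
  moreover have "ideal I A" if "I \<in> F" for I using that by (simp add: F_def)
  ultimately obtain I where I: "I \<in> F" "\<And>Q. Q \<in> F \<Longrightarrow> Q \<subseteq> I \<Longrightarrow> Q = I"
    using artinian_minimal_ideal[OF assms(2), of F "\<lambda>I. I"] by metis
  obtain r where r: "r \<in> I" "r \<notin> K" using I(1) by (auto simp: F_def)
  interpret I: ideal I A using I(1) by (simp add: F_def)
  have rc: "r \<in> carrier A" using r by auto
  define m where "m = {s \<in> carrier A. s \<odot>\<^bsub>M\<^esub> (r \<odot>\<^bsub>M\<^esub> y) \<in> N}"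
  have ry: "r \<odot>\<^bsub>M\<^esub> y \<notin> N" using r rc by (simp add: K_def)
  have m: "ideal m A"
    unfolding m_def using ideal_colon[OF assms(1) N] rc y by simp
  have "maximalideal m A"
  proof (rule maximalidealI[OF m])
    have "\<one>\<^bsub>A\<^esub> \<notin> m" using ry rc y by (simp add: m_def)
    then show "carrier A \<noteq> m" by blast
    fix Q assume Q: "ideal Q A" "m \<subseteq> Q" "Q \<subseteq> carrier A"
    interpret Q: ideal Q A by fact
    show "Q = m \<or> Q = carrier A"
    proof (cases "Q = m")
      case False
      then obtain s where s: "s \<in> Q" "s \<notin> m" using Q(2) by blast
      then have sc: "s \<in> carrier A" using Q(3) by blast
      have "PIdl (s \<otimes>\<^bsub>A\<^esub> r) \<in> F"
      proof -
        have "s \<otimes>\<^bsub>A\<^esub> r \<in> PIdl (s \<otimes>\<^bsub>A\<^esub> r)" using sc rc by (simp add: cgenideal_self)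
        moreover have "s \<otimes>\<^bsub>A\<^esub> r \<notin> K" using s sc rc y by (auto simp: K_def m_def smult_assoc)
        ultimately show ?thesis using sc rc by (auto simp: F_def intro: cgenideal_ideal)
      qed
      moreover have "PIdl (s \<otimes>\<^bsub>A\<^esub> r) \<subseteq> I"
        using cgenideal_minimal[OF I.ideal_axioms] I.I_l_closed r sc by blast
      ultimately have "r \<in> PIdl (s \<otimes>\<^bsub>A\<^esub> r)" using I(2) r by blast
      then obtain u where u: "u \<in> carrier A" "r = u \<otimes>\<^bsub>A\<^esub> (s \<otimes>\<^bsub>A\<^esub> r)"
        by (auto simp: cgenideal_def)
      \<comment> \<open>From \<open>r = u s r\<close> one gets \<open>e r = 0\<close>. So
        \<open>e\<close> lies in the annihilator \<open>m \<subseteq> Q\<close>, and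
        \<open>1 = e + u s\<close> lies in \<open>Q\<close>.\<close>
      define e where "e = \<one>\<^bsub>A\<^esub> \<ominus>\<^bsub>A\<^esub> u \<otimes>\<^bsub>A\<^esub> s"
      have ec: "e \<in> carrier A" using u sc by (simp add: e_def)
      have "e \<otimes>\<^bsub>A\<^esub> r = r \<ominus>\<^bsub>A\<^esub> (u \<otimes>\<^bsub>A\<^esub> s) \<otimes>\<^bsub>A\<^esub> r"
        using u(1) sc rc by (simp add: e_def a_minus_def l_distr l_minus)
      also have "\<dots> = \<zero>\<^bsub>A\<^esub>"
        using u sc rc by (simp add: m_assoc flip: u(2)) (simp add: a_minus_def A.r_neg)
      finally have "e \<in> m"
        using ec rc y sub_zero[OF N] by (simp add: m_def flip: smult_assoc)
      then have "e \<oplus>\<^bsub>A\<^esub> u \<otimes>\<^bsub>A\<^esub> s \<in> Q"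
        using Q(2) s u by (intro Q.a_closed Q.I_l_closed) auto
      moreover have "e \<oplus>\<^bsub>A\<^esub> u \<otimes>\<^bsub>A\<^esub> s = \<one>\<^bsub>A\<^esub>"
        using u(1) sc by (simp add: e_def a_minus_def A.a_assoc A.l_neg)
      ultimately show ?thesis using Q.one_imp_carrier by simp
    qed simp
  qed
  then show thesis using that rc ry by (simp add: m_def)
qed

end

section \<open>Double annihilators\<close>

text \<open>
  The hypothesis \<open>line\<close> says that the socle of \<open>J\<close> contains every simple module at most once; it is
  all that is used of \<open>J\<close> to see that submodules are determined by their annihilators.
\<close>

locale dual_pairing = R: cring R + V: left_module R V + U: left_module R U + J: left_module R J
  for R :: "('r, 'y) ring_scheme" and V :: "('r, 'v, 'z1) module_scheme"
    and U :: "('r, 'u, 'z2) module_scheme" and J :: "('r, 'j, 'z3) module_scheme" +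
  fixes e :: "'v \<Rightarrow> 'u \<Rightarrow> 'j"
  assumes art: "artinian R"
    and line: "\<And>m x y. \<lbrakk>maximalideal m R; x \<in> carrier J; y \<in> carrier J; x \<noteq> \<zero>\<^bsub>J\<^esub>;
        \<And>s. s \<in> m \<Longrightarrow> s \<odot>\<^bsub>J\<^esub> x = \<zero>\<^bsub>J\<^esub>; \<And>s. s \<in> m \<Longrightarrow> s \<odot>\<^bsub>J\<^esub> y = \<zero>\<^bsub>J\<^esub>\<rbrakk> \<Longrightarrow>
        \<exists>r\<in>carrier R. y = r \<odot>\<^bsub>J\<^esub> x"
    and dcc: "dcc_on R V (carrier V)"
    and e_closed [simp]: "\<lbrakk>v \<in> carrier V; u \<in> carrier U\<rbrakk> \<Longrightarrow> e v u \<in> carrier J"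
    and e_add_l: "\<lbrakk>v \<in> carrier V; v' \<in> carrier V; u \<in> carrier U\<rbrakk> \<Longrightarrow> e (v \<oplus>\<^bsub>V\<^esub> v') u = e v u \<oplus>\<^bsub>J\<^esub> e v' u"
    and e_add_r: "\<lbrakk>v \<in> carrier V; u \<in> carrier U; u' \<in> carrier U\<rbrakk> \<Longrightarrow> e v (u \<oplus>\<^bsub>U\<^esub> u') = e v u \<oplus>\<^bsub>J\<^esub> e v u'"
    and e_smult_l: "\<lbrakk>r \<in> carrier R; v \<in> carrier V; u \<in> carrier U\<rbrakk> \<Longrightarrow> e (r \<odot>\<^bsub>V\<^esub> v) u = r \<odot>\<^bsub>J\<^esub> e v u"
    and e_smult_r: "\<lbrakk>r \<in> carrier R; v \<in> carrier V; u \<in> carrier U\<rbrakk> \<Longrightarrow> e v (r \<odot>\<^bsub>U\<^esub> u) = r \<odot>\<^bsub>J\<^esub> e v u"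
    and faithful: "\<lbrakk>u \<in> carrier U; \<And>v. v \<in> carrier V \<Longrightarrow> e v u = \<zero>\<^bsub>J\<^esub>\<rbrakk> \<Longrightarrow> u = \<zero>\<^bsub>U\<^esub>"
begin

lemma additive_l: "u \<in> carrier U \<Longrightarrow> additive_map V J (\<lambda>v. e v u)"
  by unfold_locales (auto simp: e_add_l)

lemma additive_r: "v \<in> carrier V \<Longrightarrow> additive_map U J (e v)"
  by unfold_locales (auto simp: e_add_r)

lemma e_zero [simp]:
  "u \<in> carrier U \<Longrightarrow> e \<zero>\<^bsub>V\<^esub> u = \<zero>\<^bsub>J\<^esub>" "v \<in> carrier V \<Longrightarrow> e v \<zero>\<^bsub>U\<^esub> = \<zero>\<^bsub>J\<^esub>"
  using additive_map.zero[OF additive_l] additive_map.zero[OF additive_r] by auto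

definition perp where "perp N = {v \<in> carrier V. \<forall>n\<in>N. e v n = \<zero>\<^bsub>J\<^esub>}"

lemma perpD: "v \<in> perp N \<Longrightarrow> n \<in> N \<Longrightarrow> e v n = \<zero>\<^bsub>J\<^esub>"
  by (simp add: perp_def)

text \<open>Being one's own double annihilator, of which only the nontrivial inclusion is
  recorded.\<close>

definition closed where
  "closed N \<longleftrightarrow> (\<forall>y\<in>carrier U. (\<forall>v\<in>perp N. e v y = \<zero>\<^bsub>J\<^esub>) \<longrightarrow> y \<in> N)"

lemma submodule_perp:
  assumes "N \<subseteq> carrier U"
  shows "submodule (perp N) R V"
  using assms by (intro V.submoduleI) (auto simp: perp_def e_add_l e_smult_l subset_iff)

text \<open>On \<open>perp N\<close> the map \<open>v \<mapsto> e v a\<close> takes values killed by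
  \<open>m\<close>, hence in one line of \<open>J\<close>. If \<open>y\<close> is annihilated by
  \<open>perp (N + R a)\<close>, then \<open>v \<mapsto> e v y\<close> takes values in the same line
  and vanishes on the kernel of the former map, so it is \<open>r\<close> times it. Then
  \<open>y - r a\<close> is annihilated by \<open>perp N\<close> and lies in
  \<open>N\<close>.\<close>

lemma closed_adjoin:
  assumes N: "submodule N R U" and cl: "closed N" and a: "a \<in> carrier U"
    and m: "maximalideal m R" and ma: "\<And>s. s \<in> m \<Longrightarrow> s \<odot>\<^bsub>U\<^esub> a \<in> N"
  shows "closed (U.adjoin N a)"
  unfolding closed_def
proof (intro ballI impI)
  note Nc = U.sub_carrier[OF N]
  interpret m: maximalideal m R by fact
  fix y assume y: "y \<in> carrier U" and kill: "\<forall>v\<in>perp (U.adjoin N a). e v y = \<zero>\<^bsub>J\<^esub>"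
  have perp: "v \<in> perp (U.adjoin N a)" if "v \<in> perp N" "e v a = \<zero>\<^bsub>J\<^esub>" for v
    using that a Nc unfolding perp_def U.adjoin_def[OF N] by (auto simp: e_add_r e_smult_r)
  have pc: "v \<in> carrier V" if "v \<in> perp N" for v using that by (simp add: perp_def)
  have sP: "submodule (perp N) R V" using Nc by (intro submodule_perp) auto
  show "y \<in> U.adjoin N a"
  proof (cases "\<forall>v\<in>perp N. e v a = \<zero>\<^bsub>J\<^esub>")
    case True
    then have "y \<in> N" using cl y kill perp unfolding closed_def by blast
    then show ?thesis using U.subset_adjoin[OF N a] by blast
  next
    case False
    then obtain t where t: "t \<in> perp N" "e t a \<noteq> \<zero>\<^bsub>J\<^esub>" by blast
    have killa: "s \<odot>\<^bsub>J\<^esub> e v a = \<zero>\<^bsub>J\<^esub>" if "s \<in> m" "v \<in> perp N" for s v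
      using ma[OF that(1)] that(2) a m.Icarr[OF that(1)]
      by (auto simp: perp_def simp flip: e_smult_r)
    \<comment> \<open>For \<open>s \<in> m\<close> the element \<open>s v\<close> kills
      \<open>a\<close> as well as \<open>N\<close>, hence kills \<open>y\<close>.\<close>
    have killy: "s \<odot>\<^bsub>J\<^esub> e v y = \<zero>\<^bsub>J\<^esub>" if s: "s \<in> m" and v: "v \<in> perp N" for s v
    proof -
      have "s \<odot>\<^bsub>V\<^esub> v \<in> perp (U.adjoin N a)"
        using V.sub_smult[OF sP m.Icarr[OF s] v] killa[OF s v]
        by (intro perp) (simp_all add: e_smult_l m.Icarr[OF s] pc[OF v] a)
      then show ?thesis using kill pc[OF v] m.Icarr[OF s] y by (auto simp flip: e_smult_l)
    qed
    obtain r where r: "r \<in> carrier R" "e t y = r \<odot>\<^bsub>J\<^esub> e t a"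
      using line[OF m, of "e t a" "e t y"] t killa killy pc a y by auto
    have "y \<ominus>\<^bsub>U\<^esub> r \<odot>\<^bsub>U\<^esub> a \<in> N"
    proof (rule cl[unfolded closed_def, rule_format])
      show "y \<ominus>\<^bsub>U\<^esub> r \<odot>\<^bsub>U\<^esub> a \<in> carrier U" using y r a by simp
      fix v assume v: "v \<in> perp N"
      obtain u where u: "u \<in> carrier R" "e v a = u \<odot>\<^bsub>J\<^esub> e t a"
        using line[OF m, of "e t a" "e v a"] t v killa pc a by auto
      \<comment> \<open>Subtracting a multiple of \<open>t\<close> from \<open>v\<close> makes the
        result kill \<open>a\<close>, so it falls into the smaller annihilator, which kills
        \<open>y\<close>.\<close>
      define w where "w = v \<ominus>\<^bsub>V\<^esub> u \<odot>\<^bsub>V\<^esub> t"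
      have w: "w \<in> perp N"
        unfolding w_def using v t u V.sub_smult[OF sP] by (intro V.sub_minus[OF sP]) auto
      have e_w: "e w z = e v z \<ominus>\<^bsub>J\<^esub> u \<odot>\<^bsub>J\<^esub> e t z" if "z \<in> carrier U" for z
        using additive_map.minus[OF additive_l[OF that], of v "u \<odot>\<^bsub>V\<^esub> t"] v t u pc that
        by (simp add: w_def e_smult_l)
      have "e w a = \<zero>\<^bsub>J\<^esub>"
        using u pc t a by (simp add: e_w a_minus_def J.M.r_neg)
      then have "e w y = \<zero>\<^bsub>J\<^esub>" using kill perp[OF w] by blast
      then have "e v y \<ominus>\<^bsub>J\<^esub> u \<odot>\<^bsub>J\<^esub> e t y = \<zero>\<^bsub>J\<^esub>" using e_w[OF y] by simp
      then have "e v y = u \<odot>\<^bsub>J\<^esub> e t y"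
        using pc[OF v] pc[OF t(1)] u(1) y by (metis J.eq_if_minus_eq_zero J.smult_closed e_closed)
      also have "\<dots> = r \<odot>\<^bsub>J\<^esub> e v a"
        using r u pc[OF t(1)] a by (simp add: R.m_comm flip: J.smult_assoc)
      finally show "e v (y \<ominus>\<^bsub>U\<^esub> r \<odot>\<^bsub>U\<^esub> a) = \<zero>\<^bsub>J\<^esub>"
        using additive_map.minus[OF additive_r[OF pc[OF v]], of y "r \<odot>\<^bsub>U\<^esub> a"] r a y pc[OF v]
        by (simp add: e_smult_r a_minus_def J.M.r_neg)
    qed
    moreover have "y = (y \<ominus>\<^bsub>U\<^esub> r \<odot>\<^bsub>U\<^esub> a) \<oplus>\<^bsub>U\<^esub> r \<odot>\<^bsub>U\<^esub> a"
      using y r a by (simp add: a_minus_def U.M.a_assoc U.M.l_neg)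
    ultimately show ?thesis using r(1) unfolding U.adjoin_iff[OF N] by blast
  qed
qed

text \<open>A maximal closed \<open>K \<subseteq> N\<close> is wanted, but the chain condition is on
  \<open>V\<close> and descending; so \<open>perp K\<close> is taken minimal instead. If
  \<open>K\<close> were not all of \<open>N\<close>, some \<open>a \<in> N\<close> outside
  \<open>K\<close> would give a simple \<open>(K + R a) / K\<close>. Then \<open>K + R a\<close> is
  closed, minimality gives it the same annihilator as \<open>K\<close>, and closedness of
  \<open>K\<close> forces \<open>a \<in> K\<close>.\<close>

lemma submodule_closed:
  assumes N: "submodule N R U"
  shows "closed N"
proof -
  define F where "F = {K. submodule K R U \<and> K \<subseteq> N \<and> closed K}"
  have "closed {\<zero>\<^bsub>U\<^esub>}"
    unfolding closed_def
  proof (intro ballI impI)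
    fix y assume y: "y \<in> carrier U" and kill: "\<forall>v\<in>perp {\<zero>\<^bsub>U\<^esub>}. e v y = \<zero>\<^bsub>J\<^esub>"
    have "y = \<zero>\<^bsub>U\<^esub>"
      by (rule faithful[OF y], rule kill[rule_format]) (simp add: perp_def)
    then show "y \<in> {\<zero>\<^bsub>U\<^esub>}" by simp
  qed
  then have "{\<zero>\<^bsub>U\<^esub>} \<in> F"
    using U.submodule_zero U.sub_zero[OF N] by (simp add: F_def)
  then have "F \<noteq> {}" by blast
  moreover have "submodule (perp K) R V" if "K \<in> F" for K
    using that U.sub_carrier[OF N] by (intro submodule_perp) (auto simp: F_def)
  moreover have "perp K \<subseteq> carrier V" for K
    by (auto simp: perp_def)
  ultimately obtain K where "K \<in> F" and "\<And>L. L \<in> F \<Longrightarrow> perp L \<subseteq> perp K \<Longrightarrow> perp L = perp K"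
    using dcc_on_minimal[OF dcc, of F perp] by metis
  then have K: "submodule K R U" "K \<subseteq> N" "closed K"
    and min: "\<And>L. \<lbrakk>submodule L R U; L \<subseteq> N; closed L; perp L \<subseteq> perp K\<rbrakk> \<Longrightarrow> perp L = perp K"
    unfolding F_def by simp_all
  have "N \<subseteq> K"
  proof
    fix y assume y: "y \<in> N"
    show "y \<in> K"
    proof (rule ccontr)
      assume yK: "y \<notin> K"
      obtain r where r: "r \<in> carrier R" "r \<odot>\<^bsub>U\<^esub> y \<notin> K"
        "maximalideal {s \<in> carrier R. s \<odot>\<^bsub>U\<^esub> (r \<odot>\<^bsub>U\<^esub> y) \<in> K} R"
        by (rule U.simple_in_quotient[OF R.is_cring art K(1) U.sub_carrier[OF N y] yK])
      define a where "a = r \<odot>\<^bsub>U\<^esub> y"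
      have aN: "a \<in> N" unfolding a_def using U.sub_smult[OF N r(1) y] .
      then have a: "a \<in> carrier U" using U.sub_carrier[OF N] by blast
      have cl: "closed (U.adjoin K a)"
        using closed_adjoin[OF K(1,3) a r(3)] by (simp add: a_def)
      have "perp (U.adjoin K a) \<subseteq> perp K"
        using U.subset_adjoin[OF K(1) a] unfolding perp_def by blast
      then have eq: "perp (U.adjoin K a) = perp K"
        using min[OF U.submodule_adjoin[OF K(1) a] U.adjoin_least[OF K(1) N K(2) aN] cl] by blast
      have "e v a = \<zero>\<^bsub>J\<^esub>" if "v \<in> perp K" for v
        using perpD[of v "U.adjoin K a"] that eq U.adjoin_self[OF K(1) a] by simp
      then have "a \<in> K" using K(3) a unfolding closed_def by blast
      then show False using r by (simp add: a_def)
    qed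
  qed
  then show ?thesis using K by auto
qed

text \<open>Take a finite \<open>S\<close> with minimal annihilator. Inserting any \<open>y\<close>
  leaves the annihilator unchanged, so \<open>perp S\<close> kills everything, and a submodule
  containing \<open>S\<close>, being closed, is the whole of \<open>U\<close>.\<close>

lemma fin_gen_right: "fin_gen R U"
proof -
  define F where "F = {S. finite S \<and> S \<subseteq> carrier U}"
  have "F \<noteq> {}" by (auto simp: F_def)
  moreover have "submodule (perp S) R V" if "S \<in> F" for S
    using that by (intro submodule_perp) (auto simp: F_def)
  moreover have "perp S \<subseteq> carrier V" for S
    by (auto simp: perp_def)
  ultimately obtain S where "S \<in> F" and "\<And>S'. S' \<in> F \<Longrightarrow> perp S' \<subseteq> perp S \<Longrightarrow> perp S' = perp S"
    using dcc_on_minimal[OF dcc, of F perp] by metis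
  then have S: "finite S" "S \<subseteq> carrier U"
    and min: "\<And>S'. \<lbrakk>finite S'; S' \<subseteq> carrier U; perp S' \<subseteq> perp S\<rbrakk> \<Longrightarrow> perp S' = perp S"
    unfolding F_def by simp_all
  show ?thesis
    unfolding fin_gen_def
  proof (intro exI[of _ S] conjI S allI impI)
    fix H assume "submodule H R U \<and> S \<subseteq> H"
    then have H: "submodule H R U" "S \<subseteq> H" by auto
    have "y \<in> H" if y: "y \<in> carrier U" for y
    proof (rule submodule_closed[OF H(1), unfolded closed_def, rule_format, OF y])
      fix v assume "v \<in> perp H"
      then have "v \<in> perp S" using H(2) by (auto simp: perp_def)
      moreover have "perp (insert y S) = perp S"
        using S y by (intro min) (auto simp: perp_def)
      ultimately show "e v y = \<zero>\<^bsub>J\<^esub>" by (auto simp: perp_def)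
    qed
    then show "H = carrier U" using U.sub_carrier[OF H(1)] by blast
  qed
qed

end

section \<open>The dualizing module\<close>

text \<open>A linear map \<open>I \<rightarrow> J\<close> extends to \<open>R\<close>, and a linear
  map on \<open>R\<close> is multiplication by the image \<open>j\<close> of \<open>1\<close>. The
  work lies in moving \<open>I\<close> and \<open>R\<close> into the type of the test
  modules.\<close>

lemma injective_mod_Baer:
  assumes "cring R" and J: "injective_mod R J" and I: "ideal I R"
    and closed: "\<And>r. r \<in> I \<Longrightarrow> f r \<in> carrier J"
    and add: "\<And>r s. r \<in> I \<Longrightarrow> s \<in> I \<Longrightarrow> f (r \<oplus>\<^bsub>R\<^esub> s) = f r \<oplus>\<^bsub>J\<^esub> f s"
    and smult: "\<And>a r. a \<in> carrier R \<Longrightarrow> r \<in> I \<Longrightarrow> f (a \<otimes>\<^bsub>R\<^esub> r) = a \<odot>\<^bsub>J\<^esub> f r"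
  obtains j where "j \<in> carrier J" "\<And>r. r \<in> I \<Longrightarrow> f r = r \<odot>\<^bsub>J\<^esub> j"
proof -
  interpret R: cring R by fact
  interpret I: ideal I R by fact
  interpret S: left_module R "self_mod R" by (rule left_module_self) (rule R.ring_axioms)
  have sub: "submodule I R (self_mod R)" by (simp add: R.submodule_self_iff_ideal I)
  define M where "M = (self_mod R)\<lparr>carrier := I\<rparr>"
  have M_simps [simp]: "carrier M = I" "x \<oplus>\<^bsub>M\<^esub> y = x \<oplus>\<^bsub>R\<^esub> y" "a \<odot>\<^bsub>M\<^esub> x = a \<otimes>\<^bsub>R\<^esub> x" for x y a
    by (simp_all add: M_def)
  interpret M: left_module R M unfolding M_def by (rule S.left_module_sub[OF sub])
  \<comment> \<open>Any injection into the type of the test modules would serve; here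
    \<open>r\<close> becomes the singleton of the constant function \<open>r\<close>.\<close>
  define e :: "'a \<Rightarrow> (nat \<Rightarrow> 'a) set" where "e = (\<lambda>r. {\<lambda>_. r})"
  have e: "inj_on e X" for X by (auto simp: e_def inj_on_def dest: fun_cong)
  let ?X = "transport e M" and ?Y = "transport e (self_mod R)"
  define ie where "ie = restrict (the_inv_into (carrier M) e) (e ` carrier M)"
  have ie: "ie \<in> mhom R ?X M" "\<And>r. r \<in> I \<Longrightarrow> ie (e r) = r"
    using M.transport_inv_mhom[OF e] by (simp_all add: ie_def the_inv_into_f_f[OF e])
  have X: "left_module R ?X" and Y: "left_module R ?Y"
    by (rule M.left_module_transport[OF e], rule S.left_module_transport[OF e])
  have eS: "restrict e (carrier R) \<in> mhom R (self_mod R) ?Y"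
    using S.transport_mhom[OF e] by simp
  have "restrict e I \<in> mhom R M ?Y"
    using mhomD(1-3)[OF eS] by (auto simp: mhom_def I.Icarr I.I_l_closed)
  then have i: "compose (carrier ?X) (restrict e I) ie \<in> mhom R ?X ?Y"
    by (rule mhom_compose[OF ie(1) _ X])
  have i_e: "compose (carrier ?X) (restrict e I) ie (e r) = e r" if "r \<in> I" for r
    using that by (simp add: compose_def ie)
  have "restrict f I \<in> mhom R M J"
    using closed add smult M.mhom_restrictI[of f J] by simp
  then have f: "compose (carrier ?X) (restrict f I) ie \<in> mhom R ?X J"
    by (rule mhom_compose[OF ie(1) _ X])
  have "inj_on (compose (carrier ?X) (restrict e I) ie) (carrier ?X)"
    using i_e by (auto simp: inj_on_def)
  then have "\<exists>h\<in>mhom R ?Y J. \<forall>x\<in>carrier ?X.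
      h (compose (carrier ?X) (restrict e I) ie x) = compose (carrier ?X) (restrict f I) ie x"
    using J X Y i f unfolding injective_mod_def by blast
  then obtain h where h: "h \<in> mhom R ?Y J"
    "\<forall>x\<in>carrier ?X. h (compose (carrier ?X) (restrict e I) ie x) = compose (carrier ?X) (restrict f I) ie x"
    by blast
  have "f r = r \<odot>\<^bsub>J\<^esub> h (e \<one>\<^bsub>R\<^esub>)" if r: "r \<in> I" for r
  proof -
    have "f r = h (e r)"
      using h(2)[rule_format, of "e r"] i_e[OF r] r by (simp add: compose_def ie)
    also have "e r = r \<odot>\<^bsub>?Y\<^esub> e \<one>\<^bsub>R\<^esub>"
      using mhomD(3)[OF eS, of r "\<one>\<^bsub>R\<^esub>"] I.Icarr[OF r] by simp
    also have "h \<dots> = r \<odot>\<^bsub>J\<^esub> h (e \<one>\<^bsub>R\<^esub>)"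
      using mhomD(3)[OF h(1)] I.Icarr[OF r] by simp
    finally show ?thesis .
  qed
  moreover have "h (e \<one>\<^bsub>R\<^esub>) \<in> carrier J" using mhomD(1)[OF h(1)] by simp
  ultimately show thesis by (rule that[rotated])
qed

text \<open>The map \<open>f\<close> and the assignment \<open>v \<mapsto> j\<close> glue to
  \<open>H + A v\<close> because by \<open>compat\<close> they agree on the overlap of
  \<open>H\<close> and \<open>A v\<close>. This makes the value \<open>f h + r j\<close> independent
  of the representation \<open>h + r v\<close>.\<close>

lemma (in left_module) mhom_adjoin:
  assumes J: "left_module A J" and H: "submodule H A M" and v: "v \<in> carrier M"
    and f: "f \<in> mhom A (M\<lparr>carrier := H\<rparr>) J" and j: "j \<in> carrier J"
    and compat: "\<And>r. r \<in> carrier A \<Longrightarrow> r \<odot>\<^bsub>M\<^esub> v \<in> H \<Longrightarrow> f (r \<odot>\<^bsub>M\<^esub> v) = r \<odot>\<^bsub>J\<^esub> j"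
  obtains f' where "f' \<in> mhom A (M\<lparr>carrier := adjoin H v\<rparr>) J" "\<And>h. h \<in> H \<Longrightarrow> f' h = f h" "f' v = j"
proof -
  interpret J: left_module A J by fact
  note fD = mhomD(1-3)[OF f, simplified]
  note Hc = sub_carrier[OF H]
  define F where "F x = (SOME y. \<exists>h\<in>H. \<exists>r\<in>carrier A. x = h \<oplus>\<^bsub>M\<^esub> r \<odot>\<^bsub>M\<^esub> v \<and> y = f h \<oplus>\<^bsub>J\<^esub> r \<odot>\<^bsub>J\<^esub> j)" for x
  have unique: "f h \<oplus>\<^bsub>J\<^esub> r \<odot>\<^bsub>J\<^esub> j = f h' \<oplus>\<^bsub>J\<^esub> r' \<odot>\<^bsub>J\<^esub> j"
    if "h \<in> H" "h' \<in> H" "r \<in> carrier A" "r' \<in> carrier A" and eq: "h \<oplus>\<^bsub>M\<^esub> r \<odot>\<^bsub>M\<^esub> v = h' \<oplus>\<^bsub>M\<^esub> r' \<odot>\<^bsub>M\<^esub> v"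
    for h h' r r'
  proof -
    define s where "s = r \<oplus>\<^bsub>A\<^esub> \<ominus>\<^bsub>A\<^esub> r'"
    have s: "s \<in> carrier A" using that by (simp add: s_def)
    have r: "r = s \<oplus>\<^bsub>A\<^esub> r'" using that by (simp add: s_def A.a_assoc A.l_neg)
    have "h \<oplus>\<^bsub>M\<^esub> s \<odot>\<^bsub>M\<^esub> v \<oplus>\<^bsub>M\<^esub> r' \<odot>\<^bsub>M\<^esub> v = h' \<oplus>\<^bsub>M\<^esub> r' \<odot>\<^bsub>M\<^esub> v"
      using eq that s v Hc by (simp add: r smult_l_distr M.a_assoc)
    then have h': "h \<oplus>\<^bsub>M\<^esub> s \<odot>\<^bsub>M\<^esub> v = h'"
      using that s v Hc by simp
    then have "s \<odot>\<^bsub>M\<^esub> v = \<ominus>\<^bsub>M\<^esub> h \<oplus>\<^bsub>M\<^esub> h'"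
      using that s v Hc by (auto simp: M.r_neg1)
    then have sH: "s \<odot>\<^bsub>M\<^esub> v \<in> H" using sub_add[OF H] sub_neg[OF H] that by simp
    have "f h' = f h \<oplus>\<^bsub>J\<^esub> s \<odot>\<^bsub>J\<^esub> j"
      using fD(2)[OF that(1) sH] compat[OF s sH] h' by simp
    then show ?thesis
      using that s j fD(1) by (simp add: r J.smult_l_distr J.M.a_assoc)
  qed
  have F: "F (h \<oplus>\<^bsub>M\<^esub> r \<odot>\<^bsub>M\<^esub> v) = f h \<oplus>\<^bsub>J\<^esub> r \<odot>\<^bsub>J\<^esub> j" if "h \<in> H" "r \<in> carrier A" for h r
    unfolding F_def
  proof (rule some_equality)
    show "\<exists>h'\<in>H. \<exists>r'\<in>carrier A. h \<oplus>\<^bsub>M\<^esub> r \<odot>\<^bsub>M\<^esub> v = h' \<oplus>\<^bsub>M\<^esub> r' \<odot>\<^bsub>M\<^esub> v \<and>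
        f h \<oplus>\<^bsub>J\<^esub> r \<odot>\<^bsub>J\<^esub> j = f h' \<oplus>\<^bsub>J\<^esub> r' \<odot>\<^bsub>J\<^esub> j"
      using that by blast
  next
    fix y
    assume "\<exists>h'\<in>H. \<exists>r'\<in>carrier A. h \<oplus>\<^bsub>M\<^esub> r \<odot>\<^bsub>M\<^esub> v = h' \<oplus>\<^bsub>M\<^esub> r' \<odot>\<^bsub>M\<^esub> v \<and> y = f h' \<oplus>\<^bsub>J\<^esub> r' \<odot>\<^bsub>J\<^esub> j"
    then show "y = f h \<oplus>\<^bsub>J\<^esub> r \<odot>\<^bsub>J\<^esub> j" using unique that by metis
  qed
  interpret K: left_module A "M\<lparr>carrier := adjoin H v\<rparr>"
    by (rule left_module_sub[OF submodule_adjoin[OF H v]])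
  have "restrict F (carrier (M\<lparr>carrier := adjoin H v\<rparr>)) \<in> mhom A (M\<lparr>carrier := adjoin H v\<rparr>) J"
  proof (rule K.mhom_restrictI; simp)
    fix x assume "x \<in> adjoin H v"
    then obtain h r where x: "h \<in> H" "r \<in> carrier A" "x = h \<oplus>\<^bsub>M\<^esub> r \<odot>\<^bsub>M\<^esub> v"
      unfolding adjoin_iff[OF H] by blast
    then show "F x \<in> carrier J" using fD j by (simp add: F)
    show "F (a \<odot>\<^bsub>M\<^esub> x) = a \<odot>\<^bsub>J\<^esub> F x" if a: "a \<in> carrier A" for a
    proof -
      have "a \<odot>\<^bsub>M\<^esub> x = a \<odot>\<^bsub>M\<^esub> h \<oplus>\<^bsub>M\<^esub> (a \<otimes>\<^bsub>A\<^esub> r) \<odot>\<^bsub>M\<^esub> v"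
        using x a Hc v by (simp add: smult_r_distr smult_assoc)
      then show ?thesis
        using x a fD j sub_smult[OF H] by (simp add: F J.smult_r_distr J.smult_assoc)
    qed
    fix y assume "y \<in> adjoin H v"
    then obtain h' r' where y: "h' \<in> H" "r' \<in> carrier A" "y = h' \<oplus>\<^bsub>M\<^esub> r' \<odot>\<^bsub>M\<^esub> v"
      unfolding adjoin_iff[OF H] by blast
    have "x \<oplus>\<^bsub>M\<^esub> y = (h \<oplus>\<^bsub>M\<^esub> h') \<oplus>\<^bsub>M\<^esub> (r \<oplus>\<^bsub>A\<^esub> r') \<odot>\<^bsub>M\<^esub> v"
      using x y Hc v by (simp add: smult_l_distr M.a_ac)
    then show "F (x \<oplus>\<^bsub>M\<^esub> y) = F x \<oplus>\<^bsub>J\<^esub> F y"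
      using x y fD j sub_add[OF H] by (simp add: F J.smult_l_distr J.M.a_ac)
  qed
  moreover have "restrict F (adjoin H v) h = f h" if "h \<in> H" for h
    using F[OF that A.zero_closed] subset_adjoin[OF H v] that fD(1)[OF that] j v Hc[OF that] by auto
  moreover have "restrict F (adjoin H v) v = j"
    using F[OF sub_zero[OF H] A.one_closed] adjoin_self[OF H v] v j compat[of "\<zero>\<^bsub>A\<^esub>"] sub_zero[OF H] by simp
  ultimately show thesis using that by simp
qed

text \<open>\<open>injective_mod\<close> speaks of test modules of one type, whereas
  \<open>M\<close> has any type. Extending along one generator at a time involves only ideals of the
  ring, where Baer's criterion supplies \<open>j\<close>; finite generation takes the place of
  Zorn's lemma.\<close>

lemma (in left_module) injective_extend:
  assumes R: "cring A" and fg: "fin_gen A M" and J: "injective_mod A J"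
    and H: "submodule H A M" and f: "f \<in> mhom A (M\<lparr>carrier := H\<rparr>) J"
  obtains f' where "f' \<in> mhom A M J" "\<And>h. h \<in> H \<Longrightarrow> f' h = f h"
proof -
  have mJ: "left_module A J" using J by (simp add: injective_mod_def)
  obtain S where S: "finite S" "S \<subseteq> carrier M" "\<And>H. submodule H A M \<Longrightarrow> S \<subseteq> H \<Longrightarrow> H = carrier M"
    using fg unfolding fin_gen_def by blast
  have "\<exists>K f'. submodule K A M \<and> H \<subseteq> K \<and> S \<subseteq> K \<and> f' \<in> mhom A (M\<lparr>carrier := K\<rparr>) J \<and> (\<forall>h\<in>H. f' h = f h)"
    using S(1,2)
  proof (induction S rule: finite_induct)
    case empty
    then show ?case using H f by (intro exI[of _ H] exI[of _ f]) simp
  next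
    case (insert x S)
    then obtain K f' where K: "submodule K A M" "H \<subseteq> K" "S \<subseteq> K"
      and f': "f' \<in> mhom A (M\<lparr>carrier := K\<rparr>) J" "\<forall>h\<in>H. f' h = f h" by auto
    note fD = mhomD(1-3)[OF f'(1), simplified]
    have x: "x \<in> carrier M" using insert by auto
    define I where "I = {r \<in> carrier A. r \<odot>\<^bsub>M\<^esub> x \<in> K}"
    have I: "ideal I A" unfolding I_def by (rule ideal_colon[OF R K(1) x])
    obtain j where j: "j \<in> carrier J" "\<And>r. r \<in> I \<Longrightarrow> f' (r \<odot>\<^bsub>M\<^esub> x) = r \<odot>\<^bsub>J\<^esub> j"
    proof (rule injective_mod_Baer[OF R J I, of "\<lambda>r. f' (r \<odot>\<^bsub>M\<^esub> x)"])
    qed (auto simp: I_def fD x smult_l_distr smult_assoc)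
    obtain f'' where f'': "f'' \<in> mhom A (M\<lparr>carrier := adjoin K x\<rparr>) J" "\<And>h. h \<in> K \<Longrightarrow> f'' h = f' h"
    proof (rule mhom_adjoin[OF mJ K(1) x f'(1) j(1)])
      fix r assume "r \<in> carrier A" "r \<odot>\<^bsub>M\<^esub> x \<in> K"
      then show "f' (r \<odot>\<^bsub>M\<^esub> x) = r \<odot>\<^bsub>J\<^esub> j" by (intro j(2)) (simp add: I_def)
    qed blast
    show ?case
    proof (intro exI[of _ "adjoin K x"] exI[of _ f''] conjI)
      show "submodule (adjoin K x) A M" by (rule submodule_adjoin[OF K(1) x])
      show "H \<subseteq> adjoin K x" "insert x S \<subseteq> adjoin K x"
        using subset_adjoin[OF K(1) x] adjoin_self[OF K(1) x] K(2,3) by auto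
      show "\<forall>h\<in>H. f'' h = f h" using f''(2) f'(2) K(2) by (simp add: subset_iff)
    qed (rule f''(1))
  qed
  then obtain K f' where K: "submodule K A M" "S \<subseteq> K"
    "f' \<in> mhom A (M\<lparr>carrier := K\<rparr>) J" "\<forall>h\<in>H. f' h = f h" by blast
  have "K = carrier M" by (rule S(3)[OF K(1,2)])
  then have "f' \<in> mhom A M J" using K(3) by (simp add: mhom_def)
  then show thesis using that K(4) by simp
qed

section \<open>The socle of the dualizing module, cogeneration and reflexivity\<close>

lemma (in cring) ideal_jacobson_radical: "ideal (jacobson_radical R) R"
proof -
  interpret S: left_module R "self_mod R" by (rule left_module_self) (rule ring_axioms)
  show ?thesis
    unfolding submodule_self_iff_ideal[symmetric]
    by (rule S.submoduleI)
      (auto simp: jacobson_radical_def maximalideal_def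
        intro: additive_subgroup.zero_closed additive_subgroup.a_closed ideal.I_l_closed ideal.axioms(1))
qed

text \<open>The map \<open>k\<close> is the composite of \<open>R \<rightarrow> R / rad R\<close> with the embedding of \<open>R / rad R\<close> into \<open>J\<close>.\<close>

locale radical_embedding =
  fixes R :: "('r, 'y) ring_scheme" and J :: "('r, 'j, 'z) module_scheme" and k :: "'r \<Rightarrow> 'j"
  assumes closed: "c \<in> carrier R \<Longrightarrow> k c \<in> carrier J"
    and add: "\<lbrakk>c \<in> carrier R; d \<in> carrier R\<rbrakk> \<Longrightarrow> k (c \<oplus>\<^bsub>R\<^esub> d) = k c \<oplus>\<^bsub>J\<^esub> k d"
    and smult: "\<lbrakk>r \<in> carrier R; c \<in> carrier R\<rbrakk> \<Longrightarrow> k (r \<otimes>\<^bsub>R\<^esub> c) = r \<odot>\<^bsub>J\<^esub> k c"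
    and kernel: "c \<in> carrier R \<Longrightarrow> k c = \<zero>\<^bsub>J\<^esub> \<longleftrightarrow> c \<in> jacobson_radical R"
    and essential: "\<lbrakk>submodule N R J; N \<inter> k ` carrier R = {\<zero>\<^bsub>J\<^esub>}\<rbrakk> \<Longrightarrow> N = {\<zero>\<^bsub>J\<^esub>}"

lemma dualizing_embedding:
  assumes "cring R" "dualizing R J"
  obtains k where "radical_embedding R J k"
proof -
  interpret R: cring R by fact
  define I where "I = jacobson_radical R"
  interpret I: ideal I R unfolding I_def by (rule R.ideal_jacobson_radical)
  interpret J: left_module R J
    using assms(2) by (simp add: dualizing_def injective_envelope_def injective_mod_def)
  let ?Q = "quot_mod R I"
  obtain i where i: "i \<in> mhom R ?Q J" "inj_on i (carrier ?Q)"
    and ess: "\<And>N. \<lbrakk>submodule N R J; N \<inter> i ` carrier ?Q = {\<zero>\<^bsub>J\<^esub>}\<rbrakk> \<Longrightarrow> N = {\<zero>\<^bsub>J\<^esub>}"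
    using assms(2) unfolding dualizing_def injective_envelope_def I_def by auto
  define k where "k c = i (I +>\<^bsub>R\<^esub> c)" for c
  have carrier: "carrier ?Q = (\<lambda>c. I +>\<^bsub>R\<^esub> c) ` carrier R"
    by (auto simp: quot_mod_def FactRing_def A_RCOSETS_def')
  have Q: "I +>\<^bsub>R\<^esub> c \<in> carrier ?Q" if "c \<in> carrier R" for c
    using that by (simp add: carrier)
  note iD = mhomD(1-3)[OF i(1)]
  have 1: "k c \<in> carrier J" if "c \<in> carrier R" for c
    unfolding k_def using iD(1)[OF Q[OF that]] .
  have 2: "k (c \<oplus>\<^bsub>R\<^esub> d) = k c \<oplus>\<^bsub>J\<^esub> k d" if "c \<in> carrier R" "d \<in> carrier R" for c d
    unfolding k_def iD(2)[OF Q[OF that(1)] Q[OF that(2)], symmetric]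
    using that by (simp add: quot_mod_def FactRing_def I.a_rcos_sum)
  have 3: "k (r \<otimes>\<^bsub>R\<^esub> c) = r \<odot>\<^bsub>J\<^esub> k c" if "r \<in> carrier R" "c \<in> carrier R" for r c
    unfolding k_def iD(3)[OF that(1) Q[OF that(2)], symmetric]
    using that by (simp add: quot_mod_def FactRing_def I.rcoset_mult_add)
  have "k \<zero>\<^bsub>R\<^esub> = \<zero>\<^bsub>J\<^esub>"
    using 3[of "\<zero>\<^bsub>R\<^esub>" "\<zero>\<^bsub>R\<^esub>"] 1[of "\<zero>\<^bsub>R\<^esub>"] by simp
  then have k0: "k c = \<zero>\<^bsub>J\<^esub> \<longleftrightarrow> I +>\<^bsub>R\<^esub> c = I +>\<^bsub>R\<^esub> \<zero>\<^bsub>R\<^esub>" if "c \<in> carrier R" for c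
    using inj_on_eq_iff[OF i(2) Q[OF that] Q[OF R.zero_closed]] by (simp add: k_def)
  have 4: "k c = \<zero>\<^bsub>J\<^esub> \<longleftrightarrow> c \<in> I" if "c \<in> carrier R" for c
    unfolding k0[OF that]
    using that I.a_rcos_self[of c] I.a_rcos_const[of c] I.a_rcos_const[of "\<zero>\<^bsub>R\<^esub>"] by auto
  have "k ` carrier R = i ` carrier ?Q"
    unfolding carrier by (auto simp: k_def)
  then have "radical_embedding R J k"
    using 1 2 3 4 ess unfolding I_def by unfold_locales simp_all
  then show thesis by (rule that)
qed

locale artin_duality = R: cring R for R :: "('r, 'y) ring_scheme" (structure) and J :: "('r, 'j, 'z) module_scheme" +
  assumes artin: "artinian R" and dualizing: "dualizing R J"
begin

lemma injective: "injective_mod R J"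
  using dualizing by (simp add: dualizing_def injective_envelope_def)

sublocale J: left_module R J
  using injective by (simp add: injective_mod_def)

lemma maximalideal_eqI:
  assumes "maximalideal m R" "maximalideal m' R" "m \<subseteq> m'"
  shows "m = m'"
  using maximalideal.I_maximal[OF assms(1) maximalideal.axioms(1)[OF assms(2)] assms(3)]
    maximalideal.I_notcarr[OF assms(2)] ideal.Icarr[OF maximalideal.axioms(1)[OF assms(2)]] by blast

text \<open>Elements of \<open>J\<close> killed by \<open>m\<close> come from
  \<open>R / rad R\<close>, where the elements killed by a maximal ideal form at most a line. For
  \<open>x = k c\<close> the ideal \<open>m\<close> turns out to be the maximal ideal that avoids
  \<open>c\<close>, so \<open>c\<close> is invertible modulo \<open>m\<close>; since
  \<open>m\<close> kills \<open>y = k d\<close>, this expresses \<open>y\<close> through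
  \<open>c\<close>, and then through \<open>x\<close>.\<close>

lemma socle_line:
  assumes m: "maximalideal m R" and x: "x \<in> carrier J" "x \<noteq> \<zero>\<^bsub>J\<^esub>" "\<And>s. s \<in> m \<Longrightarrow> s \<odot>\<^bsub>J\<^esub> x = \<zero>\<^bsub>J\<^esub>"
    and y: "y \<in> carrier J" "\<And>s. s \<in> m \<Longrightarrow> s \<odot>\<^bsub>J\<^esub> y = \<zero>\<^bsub>J\<^esub>"
  shows "\<exists>r\<in>carrier R. y = r \<odot>\<^bsub>J\<^esub> x"
proof -
  interpret m: maximalideal m R by fact
  obtain k where k: "radical_embedding R J k"
    by (rule dualizing_embedding[OF R.is_cring dualizing])
  note k = radical_embedding.closed[OF k] radical_embedding.add[OF k] radical_embedding.smult[OF k]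
    radical_embedding.kernel[OF k] radical_embedding.essential[OF k]
  have "jacobson_radical R \<subseteq> carrier R" by (auto simp: jacobson_radical_def)
  have k0: "k \<zero> = \<zero>\<^bsub>J\<^esub>"
    using k(3)[of \<zero> \<zero>] k(1)[of \<zero>] by simp
  \<comment> \<open>By essentiality some nonzero multiple \<open>r z\<close> lies in the image of
    \<open>k\<close>. As \<open>r \<notin> m\<close> is invertible modulo \<open>m\<close>, and
    \<open>m\<close> kills \<open>z\<close>, the element \<open>z\<close> itself is a multiple of
    \<open>r z\<close>.\<close>
  have socle: "\<exists>c\<in>carrier R. z = k c" if z: "z \<in> carrier J" "\<And>s. s \<in> m \<Longrightarrow> s \<odot>\<^bsub>J\<^esub> z = \<zero>\<^bsub>J\<^esub>" for z
  proof (cases "z = \<zero>\<^bsub>J\<^esub>")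
    case True
    then show ?thesis using k0 by (intro bexI[of _ \<zero>]) auto
  next
    case False
    let ?N = "J.adjoin {\<zero>\<^bsub>J\<^esub>} z"
    note adj = J.adjoin_iff[OF J.submodule_zero]
    have sN: "submodule ?N R J" using J.submodule_adjoin[OF J.submodule_zero z(1)] .
    have "z \<in> ?N" using J.adjoin_self[OF J.submodule_zero z(1)] .
    then have "?N \<inter> k ` carrier R \<noteq> {\<zero>\<^bsub>J\<^esub>}" using k(5)[OF sN] False by blast
    moreover have "\<zero>\<^bsub>J\<^esub> \<in> ?N \<inter> k ` carrier R"
      using J.sub_zero[OF sN] k0 by (auto intro!: image_eqI[of _ _ \<zero>])
    ultimately obtain w where "w \<in> ?N" "w \<in> k ` carrier R" "w \<noteq> \<zero>\<^bsub>J\<^esub>" by blast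
    then obtain r c where rc: "r \<in> carrier R" "c \<in> carrier R" "r \<odot>\<^bsub>J\<^esub> z = k c" "k c \<noteq> \<zero>\<^bsub>J\<^esub>"
      using z(1) by (auto simp: adj)
    then have "r \<notin> m" using z(2)[of r] by auto
    then obtain u q where u: "u \<in> carrier R" "q \<in> m" "\<one> = q \<oplus> u \<otimes> r"
      using R.maximalideal_coprime[OF m rc(1)] by blast
    have qc: "q \<in> carrier R" using u m.Icarr by blast
    have "z = (q \<oplus> u \<otimes> r) \<odot>\<^bsub>J\<^esub> z" using z(1) by (simp flip: u(3))
    also have "\<dots> = u \<odot>\<^bsub>J\<^esub> (r \<odot>\<^bsub>J\<^esub> z)"
      using u(1) qc rc(1) z by (simp add: J.smult_l_distr J.smult_assoc u(2))
    also have "\<dots> = k (u \<otimes> c)" using rc u(1) k(3) by simp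
    finally show ?thesis using u(1) rc(2) by blast
  qed
  obtain c d where c: "c \<in> carrier R" "x = k c" and d: "d \<in> carrier R" "y = k d"
    using socle[OF x(1,3)] socle[OF y] by blast
  have rad: "p \<otimes> c \<in> jacobson_radical R" if p: "p \<in> m" for p
    using x(3)[OF p] k(3)[of p c] k(4)[of "p \<otimes> c"] m.Icarr[OF p] c by simp
  \<comment> \<open>Such \<open>m'\<close> exists because \<open>x = k c\<close> is nonzero, that
    is, \<open>c\<close> is not in the radical. For \<open>p \<in> m\<close> the product
    \<open>p c\<close> is in the radical, hence in \<open>m'\<close>; as \<open>c\<close> is
    invertible modulo \<open>m'\<close>, also \<open>p \<in> m'\<close>, and maximality gives
    \<open>m = m'\<close>.\<close>
  obtain m' where m': "maximalideal m' R" "c \<notin> m'"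
    using c x(2) k(4) by (auto simp: jacobson_radical_def)
  interpret m': maximalideal m' R by fact
  obtain u q where u: "u \<in> carrier R" "q \<in> m'" "\<one> = q \<oplus> u \<otimes> c"
    using R.maximalideal_coprime[OF m'(1) c(1) m'(2)] by blast
  have "m \<subseteq> m'"
  proof
    fix p assume p: "p \<in> m"
    have pc: "p \<in> carrier R" "q \<in> carrier R" using p u(2) m.Icarr m'.Icarr by auto
    have "p = p \<otimes> (q \<oplus> u \<otimes> c)" using pc by (simp flip: u(3))
    also have "\<dots> = p \<otimes> q \<oplus> u \<otimes> (p \<otimes> c)"
      using pc u(1) c(1) by (simp add: R.r_distr R.m_ac)
    also have "\<dots> \<in> m'"
    proof (rule m'.a_closed)
      have "p \<otimes> c \<in> m'" using rad[OF p] m'(1) by (simp add: jacobson_radical_def)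
      then show "u \<otimes> (p \<otimes> c) \<in> m'" using u(1) by (rule m'.I_l_closed)
      show "p \<otimes> q \<in> m'" using u(2) pc(1) by (rule m'.I_l_closed)
    qed
    finally show "p \<in> m'" .
  qed
  then have q: "q \<in> m" using maximalideal_eqI[OF m m'(1)] u(2) by simp
  have qc: "q \<in> carrier R" using q m.Icarr by blast
  \<comment> \<open>The summand \<open>q \<in> m\<close> kills \<open>y\<close>, and in
    \<open>u c k d = k (d u c)\<close> commutativity lets \<open>c\<close> and \<open>d\<close>
    exchange roles.\<close>
  have "y = (q \<oplus> u \<otimes> c) \<odot>\<^bsub>J\<^esub> y" using y(1) by (simp flip: u(3))
  also have "\<dots> = (u \<otimes> c) \<odot>\<^bsub>J\<^esub> k d"
    using u(1) qc c(1) y by (simp add: J.smult_l_distr q flip: d(2))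
  also have "\<dots> = k ((d \<otimes> u) \<otimes> c)"
    using u(1) c(1) d(1) by (simp add: R.m_ac flip: k(3))
  also have "\<dots> = (d \<otimes> u) \<odot>\<^bsub>J\<^esub> x"
    using u(1) c d(1) k(3) by simp
  finally show ?thesis using u(1) d(1) by blast
qed

text \<open>It is enough to find \<open>c\<close> outside \<open>m\<close> but in every other
  maximal ideal: then \<open>m c\<close> is contained in the radical while \<open>c\<close> is not,
  so \<open>k c\<close> is nonzero and killed by \<open>m\<close>.\<close>

lemma socle_element:
  assumes m: "maximalideal m R"
  obtains z where "z \<in> carrier J" "z \<noteq> \<zero>\<^bsub>J\<^esub>" "\<And>s. s \<in> m \<Longrightarrow> s \<odot>\<^bsub>J\<^esub> z = \<zero>\<^bsub>J\<^esub>"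
proof -
  interpret m: maximalideal m R by fact
  interpret p: primeideal m R using R.maximalideal_prime[OF m] .
  define F where "F = {I. ideal I R \<and> \<not> I \<subseteq> m}"
  have "carrier R \<in> F" using R.oneideal m.I_notcarr m.Icarr by (auto simp: F_def)
  then have "F \<noteq> {}" by blast
  moreover have "ideal I R" if "I \<in> F" for I using that by (simp add: F_def)
  ultimately obtain I where I: "I \<in> F" "\<And>Q. Q \<in> F \<Longrightarrow> Q \<subseteq> I \<Longrightarrow> Q = I"
    using artinian_minimal_ideal[OF artin, of F "\<lambda>I. I"] by metis
  obtain c where c: "c \<in> I" "c \<notin> m" using I(1) by (auto simp: F_def)
  interpret I: ideal I R using I(1) by (simp add: F_def)
  have cc: "c \<in> carrier R" using c by auto
  \<comment> \<open>\<open>I\<close> is minimal among the ideals not inside \<open>m\<close>. As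
    \<open>m\<close> is prime, \<open>I \<inter> m'\<close> is again not inside \<open>m\<close>, so
    by minimality \<open>I \<subseteq> m'\<close>.\<close>
  have other: "c \<in> m'" if m': "maximalideal m' R" "m' \<noteq> m" for m'
  proof -
    interpret m': maximalideal m' R by fact
    obtain q where q: "q \<in> m'" "q \<notin> m" using maximalideal_eqI[OF m'(1) m] m'(2) by blast
    have qc: "q \<in> carrier R" using q m'.Icarr by blast
    have "c \<otimes> q \<in> I \<inter> m'" using c(1) q(1) qc cc I.I_r_closed m'.I_l_closed by blast
    moreover have "c \<otimes> q \<notin> m" using p.I_prime[OF cc qc] c q by blast
    moreover have "ideal (I \<inter> m') R" by (rule R.i_intersect[OF I.ideal_axioms m'.ideal_axioms])
    ultimately have "I \<inter> m' \<in> F" by (auto simp: F_def)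
    then have "I \<inter> m' = I" by (rule I(2)) blast
    then show ?thesis using c(1) by blast
  qed
  obtain k where k: "radical_embedding R J k"
    by (rule dualizing_embedding[OF R.is_cring dualizing])
  note k = radical_embedding.closed[OF k] radical_embedding.add[OF k] radical_embedding.smult[OF k]
    radical_embedding.kernel[OF k] radical_embedding.essential[OF k]
  show thesis
  proof (rule that[of "k c"])
    show "k c \<in> carrier J" using k(1) cc .
    show "k c \<noteq> \<zero>\<^bsub>J\<^esub>" using k(4)[OF cc] c(2) m by (auto simp: jacobson_radical_def)
    fix s assume s: "s \<in> m"
    have sc: "s \<in> carrier R" using s m.Icarr by blast
    have "s \<otimes> c \<in> m'" if "maximalideal m' R" for m'
    proof (cases "m' = m")
      case True
      then show ?thesis using m.I_r_closed[OF s cc] by simp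
    next
      case False
      then show ?thesis using ideal.I_l_closed[OF maximalideal.axioms(1)[OF that] other[OF that False] sc] by simp
    qed
    then have "k (s \<otimes> c) = \<zero>\<^bsub>J\<^esub>" using k(4)[of "s \<otimes> c"] sc cc by (simp add: jacobson_radical_def)
    then show "s \<odot>\<^bsub>J\<^esub> k c = \<zero>\<^bsub>J\<^esub>" using k(3)[of s c] sc cc by simp
  qed
qed

text \<open>Some multiple \<open>w = r v\<close> generates a simple module. Sending \<open>w\<close>
  to a nonzero socle element of \<open>J\<close> with the same annihilator is consistent and extends
  to \<open>V\<close> by injectivity; as \<open>r f' v\<close> is nonzero, so is
  \<open>f' v\<close>.\<close>

lemma cogenerator:
  assumes V: "left_module R V" and fg: "fin_gen R V" and v: "v \<in> carrier V" "v \<noteq> \<zero>\<^bsub>V\<^esub>"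
  obtains f where "f \<in> mhom R V J" "f v \<noteq> \<zero>\<^bsub>J\<^esub>"
proof -
  interpret V: left_module R V by fact
  obtain r where r: "r \<in> carrier R" "r \<odot>\<^bsub>V\<^esub> v \<notin> {\<zero>\<^bsub>V\<^esub>}"
    and m: "maximalideal {s \<in> carrier R. s \<odot>\<^bsub>V\<^esub> (r \<odot>\<^bsub>V\<^esub> v) \<in> {\<zero>\<^bsub>V\<^esub>}} R"
    using V.simple_in_quotient[OF R.is_cring artin V.submodule_zero v(1)] v(2) by blast
  define w where "w = r \<odot>\<^bsub>V\<^esub> v"
  have w: "w \<in> carrier V" using r v by (simp add: w_def)
  obtain z where z: "z \<in> carrier J" "z \<noteq> \<zero>\<^bsub>J\<^esub>"
      "\<And>s. s \<in> {s \<in> carrier R. s \<odot>\<^bsub>V\<^esub> (r \<odot>\<^bsub>V\<^esub> v) \<in> {\<zero>\<^bsub>V\<^esub>}} \<Longrightarrow> s \<odot>\<^bsub>J\<^esub> z = \<zero>\<^bsub>J\<^esub>"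
    using socle_element[OF m] by blast
  have f0: "(\<lambda>x\<in>{\<zero>\<^bsub>V\<^esub>}. \<zero>\<^bsub>J\<^esub>) \<in> mhom R (V\<lparr>carrier := {\<zero>\<^bsub>V\<^esub>}\<rparr>) J"
    by (auto simp: mhom_def)
  obtain f where f: "f \<in> mhom R (V\<lparr>carrier := V.adjoin {\<zero>\<^bsub>V\<^esub>} w\<rparr>) J" "f w = z"
    by (rule V.mhom_adjoin[OF J.left_module_axioms V.submodule_zero w f0 z(1)])
      (use z(3) in \<open>auto simp: w_def\<close>)
  obtain f' where f': "f' \<in> mhom R V J" "\<And>h. h \<in> V.adjoin {\<zero>\<^bsub>V\<^esub>} w \<Longrightarrow> f' h = f h"
    using V.injective_extend[OF R.is_cring fg injective V.submodule_adjoin[OF V.submodule_zero w] f(1)]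
    by blast
  have "f' w = z" using f'(2) V.adjoin_self[OF V.submodule_zero w] f(2) by simp
  then have "r \<odot>\<^bsub>J\<^esub> f' v \<noteq> \<zero>\<^bsub>J\<^esub>"
    using mhomD(3)[OF f'(1) r(1) v(1)] z(2) by (simp add: w_def)
  then have "f' v \<noteq> \<zero>\<^bsub>J\<^esub>" using r(1) by auto
  then show thesis using that f'(1) by blast
qed

text \<open>The evaluations form a submodule of \<open>DDV\<close> annihilated by no nonzero element
  of \<open>DV\<close>. In the pairing of \<open>DV\<close> with \<open>DDV\<close> every submodule
  is its own double annihilator, so the evaluations are everything.\<close>

lemma reflexive:
  assumes V: "left_module R V" and fg: "fin_gen R V" and F: "F \<in> mhom R (hom_mod R V J) J"
  obtains v where "v \<in> carrier V" "\<And>f. f \<in> mhom R V J \<Longrightarrow> F f = f v"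
proof -
  interpret V: left_module R V by fact
  let ?U = "hom_mod R V J"
  interpret U: left_module R ?U
    by (rule left_module_hom_mod[OF R.is_cring V J.left_module_axioms])
  let ?W = "hom_mod R ?U J"
  interpret W: left_module R ?W
    by (rule left_module_hom_mod[OF R.is_cring U.left_module_axioms J.left_module_axioms])
  have faithful: "f = \<zero>\<^bsub>hom_mod R X J\<^esub>"
    if "f \<in> carrier (hom_mod R X J)" "\<And>x. x \<in> carrier X \<Longrightarrow> f x = \<zero>\<^bsub>J\<^esub>" for X f
    using that mhomD(4)[of f R X J] by (intro extensionalityI[of f "carrier X"]) auto
  \<comment> \<open>The pairing of \<open>V\<close> with \<open>DV\<close> serves to show that
    \<open>DV\<close> is finitely generated, which yields the descending chain condition that the
    second pairing requires.\<close>
  interpret VU: dual_pairing R V ?U J "\<lambda>v f. f v"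
  proof unfold_locales
    show "artinian R" by (rule artin)
    show "dcc_on R V (carrier V)" by (rule V.fin_gen_dcc[OF R.is_cring artin fg])
    fix m x y
    assume "maximalideal m R" "x \<in> carrier J" "y \<in> carrier J" "x \<noteq> \<zero>\<^bsub>J\<^esub>"
      "\<And>s. s \<in> m \<Longrightarrow> s \<odot>\<^bsub>J\<^esub> x = \<zero>\<^bsub>J\<^esub>" "\<And>s. s \<in> m \<Longrightarrow> s \<odot>\<^bsub>J\<^esub> y = \<zero>\<^bsub>J\<^esub>"
    then show "\<exists>r\<in>carrier R. y = r \<odot>\<^bsub>J\<^esub> x" by (metis socle_line)
  next
    fix f assume "f \<in> carrier ?U" "\<And>v. v \<in> carrier V \<Longrightarrow> f v = \<zero>\<^bsub>J\<^esub>"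
    then show "f = \<zero>\<^bsub>?U\<^esub>" by (rule faithful)
  qed (simp_all add: mhomD(1-3))
  interpret UW: dual_pairing R ?U ?W J "\<lambda>f F. F f"
  proof unfold_locales
    show "artinian R" by (rule artin)
    show "dcc_on R ?U (carrier ?U)"
      by (rule U.fin_gen_dcc[OF R.is_cring artin VU.fin_gen_right])
    show "\<exists>r\<in>carrier R. y = r \<odot>\<^bsub>J\<^esub> x"
      if "maximalideal m R" "x \<in> carrier J" "y \<in> carrier J" "x \<noteq> \<zero>\<^bsub>J\<^esub>"
        "\<And>s. s \<in> m \<Longrightarrow> s \<odot>\<^bsub>J\<^esub> x = \<zero>\<^bsub>J\<^esub>" "\<And>s. s \<in> m \<Longrightarrow> s \<odot>\<^bsub>J\<^esub> y = \<zero>\<^bsub>J\<^esub>" for m x y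
      using that by (rule VU.line)
    show "F = \<zero>\<^bsub>?W\<^esub>" if "F \<in> carrier ?W" "\<And>f. f \<in> carrier ?U \<Longrightarrow> F f = \<zero>\<^bsub>J\<^esub>" for F
      using that by (rule faithful)
    fix f F assume f: "f \<in> carrier ?U" and "F \<in> carrier ?W"
    then have F: "F \<in> mhom R ?U J" by simp
    show "F f \<in> carrier J" by (rule mhomD(1)[OF F f])
    show "(F \<oplus>\<^bsub>?W\<^esub> F') f = F f \<oplus>\<^bsub>J\<^esub> F' f" for F' using f by simp
    show "F (f \<oplus>\<^bsub>?U\<^esub> f') = F f \<oplus>\<^bsub>J\<^esub> F f'" if "f' \<in> carrier ?U" for f' by (rule mhomD(2)[OF F f that])
    show "F (r \<odot>\<^bsub>?U\<^esub> f) = r \<odot>\<^bsub>J\<^esub> F f" "(r \<odot>\<^bsub>?W\<^esub> F) f = r \<odot>\<^bsub>J\<^esub> F f" if "r \<in> carrier R" for r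
      using mhomD(3)[OF F that f] f by simp_all
  qed
  define ev where "ev v = (\<lambda>f\<in>carrier ?U. f v)" for v
  have ev: "ev v \<in> carrier ?W" if "v \<in> carrier V" for v
    unfolding ev_def hom_mod_simps(1)[of R ?U J] using that
    by (intro U.mhom_restrictI) (auto simp: mhomD)
  define N where "N = ev ` carrier V"
  have N: "submodule N R ?W"
  proof (rule W.submoduleI)
    show "N \<subseteq> carrier ?W" using ev by (auto simp: N_def)
    have ev_add: "ev x \<oplus>\<^bsub>?W\<^esub> ev y = ev (x \<oplus>\<^bsub>V\<^esub> y)" if "x \<in> carrier V" "y \<in> carrier V" for x y
      using that by (auto simp: ev_def mhomD intro!: restrict_ext)
    have ev_smult: "a \<odot>\<^bsub>?W\<^esub> ev x = ev (a \<odot>\<^bsub>V\<^esub> x)" if "x \<in> carrier V" "a \<in> carrier R" for x a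
      using that by (auto simp: ev_def mhomD intro!: restrict_ext)
    have "ev \<zero>\<^bsub>V\<^esub> = \<zero>\<^bsub>?W\<^esub>"
      using mhom_additive[OF _ V.M.abelian_group_axioms J.M.abelian_group_axioms]
      by (auto simp: ev_def additive_map.zero intro!: restrict_ext)
    then show "\<zero>\<^bsub>?W\<^esub> \<in> N" unfolding N_def by (metis V.M.zero_closed imageI)
    show "x \<oplus>\<^bsub>?W\<^esub> y \<in> N" if "x \<in> N" "y \<in> N" for x y
      using that unfolding N_def by (elim imageE) (simp add: ev_add del: hom_mod_simps)
    show "a \<odot>\<^bsub>?W\<^esub> x \<in> N" if "a \<in> carrier R" "x \<in> N" for x a
      using that unfolding N_def by (elim imageE) (simp add: ev_smult del: hom_mod_simps)
  qed
  \<comment> \<open>An \<open>f\<close> killed by all evaluations is zero, so \<open>F\<close>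
    vanishes on the annihilator of \<open>N\<close> for trivial reasons; closedness of
    \<open>N\<close> then puts \<open>F\<close> into \<open>N\<close>.\<close>
  have "F \<in> N"
  proof (rule UW.submodule_closed[OF N, unfolded UW.closed_def, rule_format])
    show FW: "F \<in> carrier ?W" using F by simp
    fix f assume f: "f \<in> UW.perp N"
    then have fU: "f \<in> carrier ?U" by (simp add: UW.perp_def)
    have "f v = \<zero>\<^bsub>J\<^esub>" if "v \<in> carrier V" for v
      using UW.perpD[OF f, of "ev v"] that fU by (simp add: N_def ev_def)
    then have "f = \<zero>\<^bsub>?U\<^esub>" using fU by (rule faithful[rotated])
    then show "F f = \<zero>\<^bsub>J\<^esub>" using UW.e_zero(1)[OF FW] by simp
  qed
  then obtain v where "v \<in> carrier V" "F = ev v" by (auto simp: N_def)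
  then show thesis using that by (simp add: ev_def)
qed

end

section \<open>Dual bases of projective modules\<close>

text \<open>The free module on \<open>I\<close>. Its indices are natural numbers so that sets of its
  elements have the type of the test modules of \<open>projective_mod\<close>.\<close>

definition fun_mod :: "nat set \<Rightarrow> ('a, 'z) ring_scheme \<Rightarrow> ('a, nat \<Rightarrow> 'a) module" where
  "fun_mod I A = \<lparr>carrier = I \<rightarrow>\<^sub>E carrier A, mult = undefined, one = undefined,
     ring.zero = (\<lambda>i\<in>I. \<zero>\<^bsub>A\<^esub>), add = (\<lambda>f g. \<lambda>i\<in>I. f i \<oplus>\<^bsub>A\<^esub> g i), smult = (\<lambda>a f. \<lambda>i\<in>I. a \<otimes>\<^bsub>A\<^esub> f i)\<rparr>"

lemma fun_mod_simps [simp]: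
  "carrier (fun_mod I A) = (I \<rightarrow>\<^sub>E carrier A)" "\<zero>\<^bsub>fun_mod I A\<^esub> = (\<lambda>i\<in>I. \<zero>\<^bsub>A\<^esub>)"
  "f \<oplus>\<^bsub>fun_mod I A\<^esub> g = (\<lambda>i\<in>I. f i \<oplus>\<^bsub>A\<^esub> g i)" "a \<odot>\<^bsub>fun_mod I A\<^esub> f = (\<lambda>i\<in>I. a \<otimes>\<^bsub>A\<^esub> f i)"
  by (simp_all add: fun_mod_def)

lemma left_module_fun_mod:
  assumes "ring A"
  shows "left_module A (fun_mod I A)"
proof -
  interpret A: ring A by fact
  have mem: "f i \<in> carrier A" if "f \<in> I \<rightarrow>\<^sub>E carrier A" "i \<in> I" for f i
    using that by auto
  have eqI: "f = g" if "f \<in> I \<rightarrow>\<^sub>E carrier A" "g \<in> I \<rightarrow>\<^sub>E carrier A" "\<And>i. i \<in> I \<Longrightarrow> f i = g i" for f g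
    using that by (rule PiE_ext)
  have restr: "(\<lambda>i\<in>I. f i) \<in> I \<rightarrow>\<^sub>E carrier A" if "\<And>i. i \<in> I \<Longrightarrow> f i \<in> carrier A" for f
    using that by auto
  show ?thesis
  proof (intro left_module.intro left_module_axioms.intro A.ring_axioms abelian_groupI; unfold fun_mod_simps)
    fix f assume f: "f \<in> I \<rightarrow>\<^sub>E carrier A"
    show "\<exists>g\<in>I \<rightarrow>\<^sub>E carrier A. (\<lambda>i\<in>I. g i \<oplus>\<^bsub>A\<^esub> f i) = (\<lambda>i\<in>I. \<zero>\<^bsub>A\<^esub>)"
      by (rule bexI[OF _ restr[of "\<lambda>i. \<ominus>\<^bsub>A\<^esub> f i"]])
        (auto intro!: restrict_ext simp: mem[OF f] A.l_neg)
  qed (rule eqI restr; simp add: mem A.a_ac A.l_distr A.r_distr A.m_assoc)+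
qed

text \<open>Projectivity splits the surjection \<open>lin\<close> from the free module on the
  generators \<open>m i\<close>, and the coordinates of the section \<open>k\<close> are the linear
  forms. The identity map of \<open>P\<close> is lifted after encoding both modules in the type of
  the test modules.\<close>

lemma projective_dual_basis:
  assumes proj: "projective_mod A P" and fg: "fin_gen A P"
  obtains n :: nat and m \<phi> where "\<forall>i<n. m i \<in> carrier P" "\<forall>i<n. \<phi> i \<in> mhom A P (self_mod A)"
    "\<forall>x\<in>carrier P. x = (\<Oplus>\<^bsub>P\<^esub>i\<in>{..<n}. \<phi> i x \<odot>\<^bsub>P\<^esub> m i)"
proof -
  interpret P: left_module A P using proj by (simp add: projective_mod_def)
  obtain S where S: "finite S" "S \<subseteq> carrier P" "\<And>H. submodule H A P \<Longrightarrow> S \<subseteq> H \<Longrightarrow> H = carrier P"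
    using fg unfolding fin_gen_def by blast
  obtain n :: nat and m where m: "S = m ` {i. i < n}"
    using finite_imp_nat_seg_image_inj_on[OF S(1)] by blast
  define I where "I = {..<n}"
  have fin: "finite I" by (simp add: I_def)
  have mc: "m i \<in> carrier P" if "i \<in> I" for i using that S(2) m by (auto simp: I_def)
  let ?F = "fun_mod I A"
  interpret F: left_module A ?F by (rule left_module_fun_mod) (rule P.A.ring_axioms)
  define lin where "lin = (\<lambda>f\<in>carrier ?F. \<Oplus>\<^bsub>P\<^esub>i\<in>I. f i \<odot>\<^bsub>P\<^esub> m i)"
  have mem: "f i \<in> carrier A" if "f \<in> I \<rightarrow>\<^sub>E carrier A" "i \<in> I" for f i
    using that by auto
  have lin: "lin \<in> mhom A ?F P"
    unfolding lin_def
  proof (rule F.mhom_restrictI)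
    fix f assume "f \<in> carrier ?F"
    then have f: "f \<in> I \<rightarrow>\<^sub>E carrier A" by simp
    show "(\<Oplus>\<^bsub>P\<^esub>i\<in>I. f i \<odot>\<^bsub>P\<^esub> m i) \<in> carrier P"
      by (rule P.M.finsum_closed) (simp add: mc mem[OF f])
    show "(\<Oplus>\<^bsub>P\<^esub>i\<in>I. (f \<oplus>\<^bsub>?F\<^esub> g) i \<odot>\<^bsub>P\<^esub> m i) = (\<Oplus>\<^bsub>P\<^esub>i\<in>I. f i \<odot>\<^bsub>P\<^esub> m i) \<oplus>\<^bsub>P\<^esub> (\<Oplus>\<^bsub>P\<^esub>i\<in>I. g i \<odot>\<^bsub>P\<^esub> m i)"
      if "g \<in> carrier ?F" for g
    proof -
      have g: "g \<in> I \<rightarrow>\<^sub>E carrier A" using that by simp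
      have "(\<Oplus>\<^bsub>P\<^esub>i\<in>I. (f \<oplus>\<^bsub>?F\<^esub> g) i \<odot>\<^bsub>P\<^esub> m i) = (\<Oplus>\<^bsub>P\<^esub>i\<in>I. f i \<odot>\<^bsub>P\<^esub> m i \<oplus>\<^bsub>P\<^esub> g i \<odot>\<^bsub>P\<^esub> m i)"
        by (rule P.M.finsum_cong') (auto simp: mc mem[OF f] mem[OF g] P.smult_l_distr)
      then show ?thesis by (simp add: P.M.finsum_addf Pi_def mc mem[OF f] mem[OF g])
    qed
    show "(\<Oplus>\<^bsub>P\<^esub>i\<in>I. (a \<odot>\<^bsub>?F\<^esub> f) i \<odot>\<^bsub>P\<^esub> m i) = a \<odot>\<^bsub>P\<^esub> (\<Oplus>\<^bsub>P\<^esub>i\<in>I. f i \<odot>\<^bsub>P\<^esub> m i)"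
      if a: "a \<in> carrier A" for a
    proof -
      have "(\<Oplus>\<^bsub>P\<^esub>i\<in>I. (a \<odot>\<^bsub>?F\<^esub> f) i \<odot>\<^bsub>P\<^esub> m i) = (\<Oplus>\<^bsub>P\<^esub>i\<in>I. a \<odot>\<^bsub>P\<^esub> (f i \<odot>\<^bsub>P\<^esub> m i))"
        by (rule P.M.finsum_cong') (auto simp: mc mem[OF f] a P.smult_assoc)
      then show ?thesis by (simp add: P.finsum_smult fin a Pi_def mc mem[OF f])
    qed
  qed
  note linD = mhomD(1-3)[OF lin]
  have sub: "submodule (lin ` carrier ?F) A P"
  proof (rule P.submoduleI)
    show "lin ` carrier ?F \<subseteq> carrier P" using linD(1) by blast
    show "\<zero>\<^bsub>P\<^esub> \<in> lin ` carrier ?F"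
      using additive_map.zero[OF mhom_additive[OF lin F.M.abelian_group_axioms P.M.abelian_group_axioms]]
      by (metis F.M.zero_closed imageI)
    show "x \<oplus>\<^bsub>P\<^esub> y \<in> lin ` carrier ?F" if "x \<in> lin ` carrier ?F" "y \<in> lin ` carrier ?F" for x y
      using that
    proof (elim imageE)
      fix f g assume fg: "x = lin f" "y = lin g" and c: "f \<in> carrier ?F" "g \<in> carrier ?F"
      show ?thesis unfolding fg linD(2)[OF c, symmetric] using c by (intro imageI F.M.a_closed)
    qed
    show "a \<odot>\<^bsub>P\<^esub> x \<in> lin ` carrier ?F" if a: "a \<in> carrier A" and "x \<in> lin ` carrier ?F" for a x
      using that(2)
    proof (elim imageE)
      fix f assume fg: "x = lin f" and c: "f \<in> carrier ?F"
      show ?thesis unfolding fg linD(3)[OF a c, symmetric] using a c by (intro imageI F.smult_closed)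
    qed
  qed
  have "S \<subseteq> lin ` carrier ?F"
  proof
    fix s assume "s \<in> S"
    then obtain i where i: "i \<in> I" "s = m i" using m by (auto simp: I_def)
    define f where "f = (\<lambda>j\<in>I. if i = j then \<one>\<^bsub>A\<^esub> else \<zero>\<^bsub>A\<^esub>)"
    have f: "f \<in> carrier ?F" by (auto simp: f_def)
    have "lin f = (\<Oplus>\<^bsub>P\<^esub>j\<in>I. if i = j then m j else \<zero>\<^bsub>P\<^esub>)"
      using f unfolding lin_def by (simp, intro P.M.finsum_cong') (auto simp: f_def mc)
    also have "\<dots> = s" using P.M.finsum_singleton[OF i(1) fin, of m] mc i(2) by simp
    finally show "s \<in> lin ` carrier ?F" using f by blast
  qed
  then have surj: "lin ` carrier ?F = carrier P" by (rule S(3)[OF sub])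
  define e1 :: "(nat \<Rightarrow> 'a) \<Rightarrow> (nat \<Rightarrow> 'a) set" where "e1 f = {f}" for f
  \<comment> \<open>\<open>P\<close> is encoded by the fibres of \<open>lin\<close>, which are sets
    of functions on natural numbers as required. They are distinct for distinct elements because
    \<open>lin\<close> is surjective.\<close>
  define e2 where "e2 y = {f \<in> carrier ?F. lin f = y}" for y
  have e1: "inj_on e1 (carrier ?F)" by (simp add: e1_def inj_on_def)
  have e2: "inj_on e2 (carrier P)"
  proof (rule inj_onI)
    fix x y assume "x \<in> carrier P" and eq: "e2 x = e2 y"
    then obtain f where "f \<in> carrier ?F" "x = lin f" using surj by blast
    then have "f \<in> e2 x" by (simp add: e2_def)
    then have "f \<in> e2 y" by (simp add: eq)
    then show "x = y" using \<open>x = lin f\<close> by (simp add: e2_def)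
  qed
  let ?X = "transport e1 ?F" and ?Y = "transport e2 P"
  have X: "left_module A ?X" and Y: "left_module A ?Y"
    by (rule F.left_module_transport[OF e1], rule P.left_module_transport[OF e2])
  define i1 where "i1 = restrict (the_inv_into (carrier ?F) e1) (e1 ` carrier ?F)"
  have i1: "i1 \<in> mhom A ?X ?F" unfolding i1_def by (rule F.transport_inv_mhom[OF e1])
  have i1_e1: "i1 (e1 f) = f" if "f \<in> carrier ?F" for f
    using that the_inv_into_f_f[OF e1 that] by (simp add: i1_def del: fun_mod_simps)
  have E2: "restrict e2 (carrier P) \<in> mhom A P ?Y" by (rule P.transport_mhom[OF e2])
  define p where "p = compose (carrier ?X) (compose (carrier ?F) (restrict e2 (carrier P)) lin) i1"
  have p: "p \<in> mhom A ?X ?Y"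
    unfolding p_def by (rule mhom_compose[OF i1 mhom_compose[OF lin E2 F.left_module_axioms] X])
  have p_e1: "p (e1 f) = e2 (lin f)" if f: "f \<in> carrier ?F" for f
  proof -
    have "e1 f \<in> carrier ?X" using f unfolding carrier_transport by (rule imageI)
    then show ?thesis using f linD(1)[OF f] by (simp add: p_def compose_def i1_e1 del: fun_mod_simps)
  qed
  have "p ` carrier ?X = e2 ` lin ` carrier ?F"
    unfolding carrier_transport image_image using p_e1 by (rule image_cong[OF refl])
  then have "p ` carrier ?X = carrier ?Y" unfolding surj carrier_transport .
  then obtain h where h: "h \<in> mhom A P ?X" "\<forall>x\<in>carrier P. p (h x) = restrict e2 (carrier P) x"
    using proj X Y p E2 unfolding projective_mod_def by blast
  define k where "k = compose (carrier P) i1 h"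
  have k: "k \<in> mhom A P ?F" unfolding k_def by (rule mhom_compose[OF h(1) i1 P.left_module_axioms])
  note kD = mhomD(1-3)[OF k]
  have lin_k: "lin (k x) = x" if x: "x \<in> carrier P" for x
  proof -
    obtain f where f: "f \<in> carrier ?F" "h x = e1 f"
      using mhomD(1)[OF h(1) x] unfolding carrier_transport by blast
    have "k x = f" using x f by (simp add: k_def compose_def i1_e1 del: fun_mod_simps)
    then have "e2 (lin (k x)) = e2 x" using h(2) x f p_e1 by auto
    then show ?thesis using inj_onD[OF e2] linD(1) kD(1) x by blast
  qed
  define \<phi> where "\<phi> i = (\<lambda>x\<in>carrier P. k x i)" for i
  show thesis
  proof (rule that; intro allI impI ballI)
    show "m i \<in> carrier P" if "i < n" for i using mc that by (simp add: I_def)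
    show "\<phi> i \<in> mhom A P (self_mod A)" if "i < n" for i
      unfolding \<phi>_def
    proof (rule P.mhom_restrictI)
      have i: "i \<in> I" using that by (simp add: I_def)
      fix x assume x: "x \<in> carrier P"
      show "k x i \<in> carrier (self_mod A)" using kD(1)[OF x] i by auto
      show "k (x \<oplus>\<^bsub>P\<^esub> y) i = k x i \<oplus>\<^bsub>self_mod A\<^esub> k y i" if "y \<in> carrier P" for y
        using kD(2)[OF x that] i by simp
      show "k (a \<odot>\<^bsub>P\<^esub> x) i = a \<odot>\<^bsub>self_mod A\<^esub> k x i" if "a \<in> carrier A" for a
        using kD(3)[OF that x] i by simp
    qed
    show "x = (\<Oplus>\<^bsub>P\<^esub>i\<in>{..<n}. \<phi> i x \<odot>\<^bsub>P\<^esub> m i)" if "x \<in> carrier P" for x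
      using lin_k[OF that] kD(1)[OF that] that by (simp add: lin_def \<phi>_def I_def)
  qed
qed

section \<open>Homomorphisms into a tensor product\<close>

text \<open>
  Stated for left modules over one ring, this covers both \<open>Hom\<^sub>A(DA, DA \<otimes>\<^sub>A M)\<close> (with \<open>C = A\<close> and
  \<open>act\<close> the right action on \<open>DA\<close>) and \<open>Hom\<^sub>B(DB, M \<otimes>\<^sub>B DB)\<close> (with \<open>C\<close> the opposite of \<open>B\<close> and
  \<open>act\<close> the left action on \<open>DB\<close>). Only the homomorphisms \<open>P \<rightarrow> X\<close> induced by linear forms on \<open>M\<close>
  are needed of the universal property.
\<close>

locale projective_pairing = M: left_module C M + X: left_module C X + P: left_module C P
  for C :: "('c, 'y) ring_scheme" and M :: "('c, 'm, 'z1) module_scheme"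
    and X :: "('c, 'x, 'z2) module_scheme" and P :: "('c, 'p, 'z3) module_scheme" +
  fixes act :: "'x \<Rightarrow> 'c \<Rightarrow> 'x" and t :: "'m \<Rightarrow> 'x \<Rightarrow> 'p"
  assumes proj: "projective_mod C M" and fg: "fin_gen C M"
    and act_closed: "\<lbrakk>x \<in> carrier X; c \<in> carrier C\<rbrakk> \<Longrightarrow> act x c \<in> carrier X"
    and act_faithful: "\<lbrakk>c \<in> carrier C; \<And>x. x \<in> carrier X \<Longrightarrow> act x c = \<zero>\<^bsub>X\<^esub>\<rbrakk> \<Longrightarrow> c = \<zero>\<^bsub>C\<^esub>"
    and act_full: "h \<in> mhom C X X \<Longrightarrow> \<exists>c\<in>carrier C. \<forall>x\<in>carrier X. h x = act x c"
    and t_closed: "\<lbrakk>m \<in> carrier M; x \<in> carrier X\<rbrakk> \<Longrightarrow> t m x \<in> carrier P"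
    and t_add_l: "\<lbrakk>m \<in> carrier M; m' \<in> carrier M; x \<in> carrier X\<rbrakk> \<Longrightarrow> t (m \<oplus>\<^bsub>M\<^esub> m') x = t m x \<oplus>\<^bsub>P\<^esub> t m' x"
    and t_add_r: "\<lbrakk>m \<in> carrier M; x \<in> carrier X; x' \<in> carrier X\<rbrakk> \<Longrightarrow> t m (x \<oplus>\<^bsub>X\<^esub> x') = t m x \<oplus>\<^bsub>P\<^esub> t m x'"
    and t_balanced: "\<lbrakk>m \<in> carrier M; c \<in> carrier C; x \<in> carrier X\<rbrakk> \<Longrightarrow> t (c \<odot>\<^bsub>M\<^esub> m) x = t m (act x c)"
    and t_generates: "\<lbrakk>\<And>m x. \<lbrakk>m \<in> carrier M; x \<in> carrier X\<rbrakk> \<Longrightarrow> Q (t m x); Q \<zero>\<^bsub>P\<^esub>;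
        \<And>u v. \<lbrakk>u \<in> carrier P; v \<in> carrier P; Q u; Q v\<rbrakk> \<Longrightarrow> Q (u \<oplus>\<^bsub>P\<^esub> v); p \<in> carrier P\<rbrakk> \<Longrightarrow> Q p"
    and t_form: "\<phi> \<in> mhom C M (self_mod C) \<Longrightarrow>
        \<exists>\<psi>\<in>mhom C P X. \<forall>m\<in>carrier M. \<forall>x\<in>carrier X. \<psi> (t m x) = act x (\<phi> m)"
begin

lemma additive_l: "x \<in> carrier X \<Longrightarrow> additive_map M P (\<lambda>m. t m x)"
  by unfold_locales (auto simp: t_closed t_add_l)

lemma additive_r: "m \<in> carrier M \<Longrightarrow> additive_map X P (t m)"
  by unfold_locales (auto simp: t_closed t_add_r)

text \<open>The map \<open>\<psi>\<close> induced by a coordinate form sends \<open>t m x\<close> to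
  \<open>x\<close> acted on by the coordinate \<open>\<phi> i m\<close>. If all \<open>t m x\<close>
  vanish, every coordinate acts as zero, hence is zero, and so is \<open>m\<close>.\<close>

lemma injective:
  assumes m: "m \<in> carrier M" and zero: "\<And>x. x \<in> carrier X \<Longrightarrow> t m x = \<zero>\<^bsub>P\<^esub>"
  shows "m = \<zero>\<^bsub>M\<^esub>"
proof -
  obtain n :: nat and b \<phi> where "\<forall>i<n. b i \<in> carrier M" "\<forall>i<n. \<phi> i \<in> mhom C M (self_mod C)"
    and "\<forall>x\<in>carrier M. x = (\<Oplus>\<^bsub>M\<^esub>i\<in>{..<n}. \<phi> i x \<odot>\<^bsub>M\<^esub> b i)"
    by (rule projective_dual_basis[OF proj fg])
  note b = this(1)[rule_format] and \<phi> = this(2)[rule_format] and sum = this(3)[rule_format]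
  have \<phi>_zero: "\<phi> i m = \<zero>\<^bsub>C\<^esub>" if i: "i < n" for i
  proof (rule act_faithful)
    show "\<phi> i m \<in> carrier C" using mhomD(1)[OF \<phi>[OF i] m] by simp
    obtain \<psi> where \<psi>: "\<psi> \<in> mhom C P X" "\<forall>m\<in>carrier M. \<forall>x\<in>carrier X. \<psi> (t m x) = act x (\<phi> i m)"
      using t_form[OF \<phi>[OF i]] by blast
    fix x assume x: "x \<in> carrier X"
    have "act x (\<phi> i m) = \<psi> \<zero>\<^bsub>P\<^esub>" using \<psi>(2) m x zero[OF x] by metis
    also have "\<dots> = \<zero>\<^bsub>X\<^esub>"
      by (rule additive_map.zero[OF mhom_additive[OF \<psi>(1) P.M.abelian_group_axioms X.M.abelian_group_axioms]])
    finally show "act x (\<phi> i m) = \<zero>\<^bsub>X\<^esub>" .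
  qed
  have "m = (\<Oplus>\<^bsub>M\<^esub>i\<in>{..<n}. \<phi> i m \<odot>\<^bsub>M\<^esub> b i)" by (rule sum[OF m])
  also have "\<dots> = (\<Oplus>\<^bsub>M\<^esub>i\<in>{..<n}. \<zero>\<^bsub>M\<^esub>)"
    by (rule M.M.finsum_cong') (auto simp: \<phi>_zero b)
  finally show ?thesis by simp
qed

text \<open>By the expansion of elements of \<open>P\<close> along the dual basis, \<open>h\<close>
  is the sum of the maps \<open>t (b i)\<close> after \<open>\<psi> i\<close> after
  \<open>h\<close>. Each \<open>\<psi> i\<close> after \<open>h\<close> is an endomorphism of
  \<open>X\<close>, hence the action of some \<open>c i\<close>, and balancing collects these into
  \<open>m = \<Sum> c i b i\<close>.\<close>

lemma surjective:
  assumes h: "h \<in> mhom C X P"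
  shows "\<exists>m\<in>carrier M. \<forall>x\<in>carrier X. h x = t m x"
proof -
  obtain n :: nat and b \<phi> where "\<forall>i<n. b i \<in> carrier M" "\<forall>i<n. \<phi> i \<in> mhom C M (self_mod C)"
    and "\<forall>x\<in>carrier M. x = (\<Oplus>\<^bsub>M\<^esub>i\<in>{..<n}. \<phi> i x \<odot>\<^bsub>M\<^esub> b i)"
    by (rule projective_dual_basis[OF proj fg])
  note b = this(1)[rule_format] and \<phi> = this(2)[rule_format] and sum = this(3)[rule_format]
  have \<phi>c: "\<phi> i m \<in> carrier C" if "i < n" "m \<in> carrier M" for i m
    using mhomD(1)[OF \<phi>[OF that(1)] that(2)] by simp
  have "\<forall>i. \<exists>\<psi>. i < n \<longrightarrow> \<psi> \<in> mhom C P X \<and> (\<forall>m\<in>carrier M. \<forall>x\<in>carrier X. \<psi> (t m x) = act x (\<phi> i m))"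
    using t_form[OF \<phi>] by blast
  then obtain \<psi> where \<psi>: "\<And>i. i < n \<Longrightarrow> \<psi> i \<in> mhom C P X"
    "\<And>i m x. \<lbrakk>i < n; m \<in> carrier M; x \<in> carrier X\<rbrakk> \<Longrightarrow> \<psi> i (t m x) = act x (\<phi> i m)"
    by metis
  note \<psi>c = mhomD(1)[OF \<psi>(1)]
  \<comment> \<open>For \<open>p = t m x\<close> this is the dual basis expansion of
    \<open>m\<close> with the coefficients moved over to \<open>x\<close>. Both sides are additive
    in \<open>p\<close>, which settles the rest.\<close>
  have expand: "p = (\<Oplus>\<^bsub>P\<^esub>i\<in>{..<n}. t (b i) (\<psi> i p))" if "p \<in> carrier P" for p
  proof (rule t_generates[where Q = "\<lambda>p. p = (\<Oplus>\<^bsub>P\<^esub>i\<in>{..<n}. t (b i) (\<psi> i p))", OF _ _ _ that])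
    fix m x assume m: "m \<in> carrier M" and x: "x \<in> carrier X"
    have "t m x = t (\<Oplus>\<^bsub>M\<^esub>i\<in>{..<n}. \<phi> i m \<odot>\<^bsub>M\<^esub> b i) x" using sum[OF m] by simp
    also have "\<dots> = (\<Oplus>\<^bsub>P\<^esub>i\<in>{..<n}. t (\<phi> i m \<odot>\<^bsub>M\<^esub> b i) x)"
      by (rule additive_map.finsum[OF additive_l[OF x]]) (auto simp: \<phi>c m b)
    also have "\<dots> = (\<Oplus>\<^bsub>P\<^esub>i\<in>{..<n}. t (b i) (\<psi> i (t m x)))"
      by (rule P.M.finsum_cong') (auto simp: \<phi>c m b t_balanced x \<psi>(2) act_closed t_closed)
    finally show "t m x = \<dots>" .
  next
    have "(\<Oplus>\<^bsub>P\<^esub>i\<in>{..<n}. t (b i) (\<psi> i \<zero>\<^bsub>P\<^esub>)) = (\<Oplus>\<^bsub>P\<^esub>i\<in>{..<n}. \<zero>\<^bsub>P\<^esub>)"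
      using additive_map.zero[OF mhom_additive[OF \<psi>(1) P.M.abelian_group_axioms X.M.abelian_group_axioms]]
        additive_map.zero[OF additive_r[OF b]]
      by (intro P.M.finsum_cong') auto
    then show "\<zero>\<^bsub>P\<^esub> = (\<Oplus>\<^bsub>P\<^esub>i\<in>{..<n}. t (b i) (\<psi> i \<zero>\<^bsub>P\<^esub>))" by simp
  next
    fix u v assume uv: "u \<in> carrier P" "v \<in> carrier P"
      and u: "u = (\<Oplus>\<^bsub>P\<^esub>i\<in>{..<n}. t (b i) (\<psi> i u))" and v: "v = (\<Oplus>\<^bsub>P\<^esub>i\<in>{..<n}. t (b i) (\<psi> i v))"
    have "(\<Oplus>\<^bsub>P\<^esub>i\<in>{..<n}. t (b i) (\<psi> i (u \<oplus>\<^bsub>P\<^esub> v))) =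
        (\<Oplus>\<^bsub>P\<^esub>i\<in>{..<n}. t (b i) (\<psi> i u) \<oplus>\<^bsub>P\<^esub> t (b i) (\<psi> i v))"
      using uv by (intro P.M.finsum_cong') (auto simp: t_closed b \<psi>c mhomD(2)[OF \<psi>(1)] t_add_r)
    also have "\<dots> = (\<Oplus>\<^bsub>P\<^esub>i\<in>{..<n}. t (b i) (\<psi> i u)) \<oplus>\<^bsub>P\<^esub> (\<Oplus>\<^bsub>P\<^esub>i\<in>{..<n}. t (b i) (\<psi> i v))"
      using uv by (intro P.M.finsum_addf) (auto simp: t_closed b \<psi>c)
    finally show "u \<oplus>\<^bsub>P\<^esub> v = (\<Oplus>\<^bsub>P\<^esub>i\<in>{..<n}. t (b i) (\<psi> i (u \<oplus>\<^bsub>P\<^esub> v)))" by (simp flip: u v)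
  qed
  have "\<exists>c\<in>carrier C. \<forall>x\<in>carrier X. \<psi> i (h x) = act x c" if "i < n" for i
    using act_full[OF mhom_compose[OF h \<psi>(1)[OF that] X.left_module_axioms]] by (simp add: compose_def)
  then obtain c where c: "\<And>i. i < n \<Longrightarrow> c i \<in> carrier C"
    "\<And>i x. i < n \<Longrightarrow> x \<in> carrier X \<Longrightarrow> \<psi> i (h x) = act x (c i)" by metis
  show ?thesis
  proof (intro bexI[of _ "\<Oplus>\<^bsub>M\<^esub>i\<in>{..<n}. c i \<odot>\<^bsub>M\<^esub> b i"] ballI)
    show "(\<Oplus>\<^bsub>M\<^esub>i\<in>{..<n}. c i \<odot>\<^bsub>M\<^esub> b i) \<in> carrier M"
      by (rule M.M.finsum_closed) (auto simp: c b)
    fix x assume x: "x \<in> carrier X"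
    have "h x = (\<Oplus>\<^bsub>P\<^esub>i\<in>{..<n}. t (b i) (\<psi> i (h x)))" by (rule expand[OF mhomD(1)[OF h x]])
    also have "\<dots> = (\<Oplus>\<^bsub>P\<^esub>i\<in>{..<n}. t (c i \<odot>\<^bsub>M\<^esub> b i) x)"
      by (rule P.M.finsum_cong') (auto simp: c b x t_balanced act_closed t_closed)
    also have "\<dots> = t (\<Oplus>\<^bsub>M\<^esub>i\<in>{..<n}. c i \<odot>\<^bsub>M\<^esub> b i) x"
      by (rule additive_map.finsum[OF additive_l[OF x], symmetric]) (auto simp: c b)
    finally show "h x = \<dots>" .
  qed
qed

end

section \<open>Bimodules\<close>

text \<open>Stripped of the ground ring and of finiteness, so that duals, tensor products and
  \<open>T\<close> itself are all instances.\<close>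

locale bimod = A: ring A + B: ring B + M: abelian_group M
  for A :: "('a, 'y) ring_scheme" and B :: "('b, 'z) ring_scheme" and M :: "('a, 'b, 'm) bimodule" +
  assumes lact_closed [simp]: "\<lbrakk>a \<in> carrier A; x \<in> carrier M\<rbrakk> \<Longrightarrow> lact M a x \<in> carrier M"
    and lact_l_distr: "\<lbrakk>a \<in> carrier A; a' \<in> carrier A; x \<in> carrier M\<rbrakk> \<Longrightarrow>
      lact M (a \<oplus>\<^bsub>A\<^esub> a') x = lact M a x \<oplus>\<^bsub>M\<^esub> lact M a' x"
    and lact_r_distr: "\<lbrakk>a \<in> carrier A; x \<in> carrier M; y \<in> carrier M\<rbrakk> \<Longrightarrow>
      lact M a (x \<oplus>\<^bsub>M\<^esub> y) = lact M a x \<oplus>\<^bsub>M\<^esub> lact M a y"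
    and lact_assoc: "\<lbrakk>a \<in> carrier A; a' \<in> carrier A; x \<in> carrier M\<rbrakk> \<Longrightarrow>
      lact M (a \<otimes>\<^bsub>A\<^esub> a') x = lact M a (lact M a' x)"
    and lact_one [simp]: "x \<in> carrier M \<Longrightarrow> lact M \<one>\<^bsub>A\<^esub> x = x"
    and ract_closed [simp]: "\<lbrakk>b \<in> carrier B; x \<in> carrier M\<rbrakk> \<Longrightarrow> ract M x b \<in> carrier M"
    and ract_r_distr: "\<lbrakk>b \<in> carrier B; b' \<in> carrier B; x \<in> carrier M\<rbrakk> \<Longrightarrow>
      ract M x (b \<oplus>\<^bsub>B\<^esub> b') = ract M x b \<oplus>\<^bsub>M\<^esub> ract M x b'"
    and ract_l_distr: "\<lbrakk>b \<in> carrier B; x \<in> carrier M; y \<in> carrier M\<rbrakk> \<Longrightarrow>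
      ract M (x \<oplus>\<^bsub>M\<^esub> y) b = ract M x b \<oplus>\<^bsub>M\<^esub> ract M y b"
    and ract_assoc: "\<lbrakk>b \<in> carrier B; b' \<in> carrier B; x \<in> carrier M\<rbrakk> \<Longrightarrow>
      ract M x (b \<otimes>\<^bsub>B\<^esub> b') = ract M (ract M x b) b'"
    and ract_one [simp]: "x \<in> carrier M \<Longrightarrow> ract M x \<one>\<^bsub>B\<^esub> = x"
    and lact_ract: "\<lbrakk>a \<in> carrier A; x \<in> carrier M; b \<in> carrier B\<rbrakk> \<Longrightarrow>
      ract M (lact M a x) b = lact M a (ract M x b)"

lemma opp_simps [simp]:
  "carrier (opp A) = carrier A" "\<zero>\<^bsub>opp A\<^esub> = \<zero>\<^bsub>A\<^esub>" "\<one>\<^bsub>opp A\<^esub> = \<one>\<^bsub>A\<^esub>" "x \<oplus>\<^bsub>opp A\<^esub> y = x \<oplus>\<^bsub>A\<^esub> y"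
  "x \<otimes>\<^bsub>opp A\<^esub> y = y \<otimes>\<^bsub>A\<^esub> x"
  by (simp_all add: opp_def)

lemma opp_opp [simp]: "opp (opp A) = A"
  by (simp add: opp_def)

lemma opp_smult [simp]: "smult (opp A) = smult A"
  by (simp add: opp_def)

lemma ring_opp: "ring A \<Longrightarrow> ring (opp A)"
proof -
  assume "ring A"
  then interpret A: ring A .
  show ?thesis
    by (rule ringI) (auto simp: A.a_ac A.l_distr A.r_distr A.m_assoc intro!: abelian_groupI monoidI
        bexI[of _ "\<ominus>\<^bsub>A\<^esub> _"] A.l_neg)
qed

context bimod
begin

lemma lmod: "left_module A (lmod M)"
  by (intro left_module.intro left_module_axioms.intro A.ring_axioms abelian_groupI)
    (auto simp: M.a_ac lact_l_distr lact_r_distr lact_assoc intro!: bexI[of _ "\<ominus>\<^bsub>M\<^esub> _"] M.l_neg)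

lemma rmod: "left_module (opp B) (rmod M)"
  by (intro left_module.intro left_module_axioms.intro ring_opp B.ring_axioms abelian_groupI)
    (auto simp: M.a_ac ract_l_distr ract_r_distr ract_assoc intro!: bexI[of _ "\<ominus>\<^bsub>M\<^esub> _"] M.l_neg)

lemma lact_null [simp]: "x \<in> carrier M \<Longrightarrow> lact M \<zero>\<^bsub>A\<^esub> x = \<zero>\<^bsub>M\<^esub>"
  "a \<in> carrier A \<Longrightarrow> lact M a \<zero>\<^bsub>M\<^esub> = \<zero>\<^bsub>M\<^esub>"
  using left_module.smult_l_null[OF lmod, of x] left_module.smult_r_null[OF lmod, of a] by simp_all

lemma ract_null [simp]: "x \<in> carrier M \<Longrightarrow> ract M x \<zero>\<^bsub>B\<^esub> = \<zero>\<^bsub>M\<^esub>"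
  "b \<in> carrier B \<Longrightarrow> ract M \<zero>\<^bsub>M\<^esub> b = \<zero>\<^bsub>M\<^esub>"
  using left_module.smult_l_null[OF rmod, of x] left_module.smult_r_null[OF rmod, of b] by simp_all

end

lemma bimodI:
  assumes L: "left_module A (lmod M)" and R: "left_module (opp B) (rmod M)" and "ring B"
    and "\<And>a x b. \<lbrakk>a \<in> carrier A; x \<in> carrier M; b \<in> carrier B\<rbrakk> \<Longrightarrow> ract M (lact M a x) b = lact M a (ract M x b)"
  shows "bimod A B M"
proof -
  interpret L: left_module A "lmod M" by fact
  interpret R: left_module "opp B" "rmod M" by fact
  have "abelian_group M"
    using L.M.l_neg L.M.r_neg by (intro abelian_groupI) (auto simp: L.M.a_ac[simplified] intro!: bexI[of _ "\<ominus>\<^bsub>lmod M\<^esub> _"]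
      intro: L.M.a_closed[simplified] L.M.zero_closed[simplified] L.M.l_zero[simplified]
        L.M.a_inv_closed[simplified])
  then show ?thesis
    using assms(3,4) L.A.ring_axioms L.smult_closed L.smult_l_distr L.smult_r_distr L.smult_assoc L.smult_one
      R.smult_closed R.smult_l_distr R.smult_r_distr R.smult_assoc R.smult_one
    by (simp add: bimod_def bimod_axioms_def)
qed

section \<open>The dual of an Artin algebra\<close>

lemma restrict_scalars_simps [simp]:
  "carrier (restrict_scalars A M) = carrier M" "\<zero>\<^bsub>restrict_scalars A M\<^esub> = \<zero>\<^bsub>M\<^esub>"
  "x \<oplus>\<^bsub>restrict_scalars A M\<^esub> y = x \<oplus>\<^bsub>M\<^esub> y"
  "r \<odot>\<^bsub>restrict_scalars A M\<^esub> x = (r \<odot>\<^bsub>A\<^esub> \<one>\<^bsub>A\<^esub>) \<odot>\<^bsub>M\<^esub> x"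
  by (simp_all add: restrict_scalars_def)

lemma dual_simps [simp]:
  "carrier (dual R J A X) = mhom R (restrict_scalars A (lmod X)) J"
  "\<zero>\<^bsub>dual R J A X\<^esub> = (\<lambda>x\<in>carrier X. \<zero>\<^bsub>J\<^esub>)"
  "f \<oplus>\<^bsub>dual R J A X\<^esub> h = (\<lambda>x\<in>carrier X. f x \<oplus>\<^bsub>J\<^esub> h x)"
  "lact (dual R J A X) b f = (\<lambda>x\<in>carrier X. f (ract X x b))"
  "ract (dual R J A X) f a = (\<lambda>x\<in>carrier X. f (lact X a x))"
  by (simp_all add: dual_def)

context artin_algebra
begin

lemma scalar_mult:
  assumes "r \<in> carrier R" "x \<in> carrier A"
  shows "(r \<odot>\<^bsub>A\<^esub> \<one>\<^bsub>A\<^esub>) \<otimes>\<^bsub>A\<^esub> x = r \<odot>\<^bsub>A\<^esub> x" "x \<otimes>\<^bsub>A\<^esub> (r \<odot>\<^bsub>A\<^esub> \<one>\<^bsub>A\<^esub>) = r \<odot>\<^bsub>A\<^esub> x"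
  using assms by (simp_all add: smult_mult_left smult_mult_right)

text \<open>\<open>A\<close> as an \<open>R\<close>-module in the shape in which it occurs in
  \<open>dual_alg\<close>, with \<open>r\<close> acting as multiplication by \<open>r 1\<close>. By
  \<open>scalar_mult\<close> this is the given action of \<open>R\<close>.\<close>

abbreviation V where "V \<equiv> restrict_scalars A (self_mod A)"

lemma left_module_restrict_scalars:
  assumes "left_module A N"
  shows "left_module R (restrict_scalars A N)"
proof -
  interpret N: left_module A N by fact
  have "((r \<otimes>\<^bsub>R\<^esub> s) \<odot>\<^bsub>A\<^esub> \<one>\<^bsub>A\<^esub>) = (r \<odot>\<^bsub>A\<^esub> \<one>\<^bsub>A\<^esub>) \<otimes>\<^bsub>A\<^esub> (s \<odot>\<^bsub>A\<^esub> \<one>\<^bsub>A\<^esub>)"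
    if "r \<in> carrier R" "s \<in> carrier R" for r s
    using that by (simp add: smult_mult_left smult_assoc1)
  then show ?thesis
    by (intro left_module.intro left_module_axioms.intro R.ring_axioms abelian_groupI)
      (auto simp: smult_l_distr N.smult_l_distr N.smult_r_distr N.smult_assoc N.M.a_ac
        intro: N.M.l_neg N.M.r_neg intro!: bexI[of _ "\<ominus>\<^bsub>N\<^esub> _"])
qed

lemma left_module_scalars: "left_module R V"
  by (rule left_module_restrict_scalars[OF left_module_self[OF ring_axioms]])

lemma fin_gen_scalars: "fin_gen R V"
proof -
  interpret V: left_module R V by (rule left_module_scalars)
  have "left_module R A"
    by (intro left_module.intro left_module_axioms.intro R.ring_axioms M.abelian_group_axioms)
      (simp_all add: smult_l_distr smult_r_distr smult_assoc1)
  then show ?thesis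
    by (rule V.fin_gen_restrict[OF _ fin_gen]) (auto simp: scalar_mult)
qed

end

locale dual_algebra = artin_duality R J + A: artin_algebra R A
  for R :: "('r, 'y) ring_scheme" (structure) and J :: "('r, 'j, 'z) module_scheme"
    and A :: "('r, 'a, 'v) module_scheme"
begin

abbreviation "DA \<equiv> dual_alg R J A"

sublocale V: left_module R A.V
  by (rule A.left_module_scalars)

lemma dualD:
  assumes "f \<in> carrier DA"
  shows "x \<in> carrier A \<Longrightarrow> f x \<in> carrier J"
    and "\<lbrakk>x \<in> carrier A; y \<in> carrier A\<rbrakk> \<Longrightarrow> f (x \<oplus>\<^bsub>A\<^esub> y) = f x \<oplus>\<^bsub>J\<^esub> f y"
    and "\<lbrakk>r \<in> carrier R; x \<in> carrier A\<rbrakk> \<Longrightarrow> f (r \<odot>\<^bsub>A\<^esub> x) = r \<odot>\<^bsub>J\<^esub> f x"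
proof -
  have f: "f \<in> mhom R A.V J" using assms by simp
  show "x \<in> carrier A \<Longrightarrow> f x \<in> carrier J"
    and "\<lbrakk>x \<in> carrier A; y \<in> carrier A\<rbrakk> \<Longrightarrow> f (x \<oplus>\<^bsub>A\<^esub> y) = f x \<oplus>\<^bsub>J\<^esub> f y"
    using mhomD(1,2)[OF f] by simp_all
  show "\<lbrakk>r \<in> carrier R; x \<in> carrier A\<rbrakk> \<Longrightarrow> f (r \<odot>\<^bsub>A\<^esub> x) = r \<odot>\<^bsub>J\<^esub> f x"
    using mhomD(3)[OF f, of r x] by (simp add: A.scalar_mult)
qed

lemma dual_restrictI:
  assumes "\<And>x. x \<in> carrier A \<Longrightarrow> f x \<in> carrier J"
    and "\<And>x y. \<lbrakk>x \<in> carrier A; y \<in> carrier A\<rbrakk> \<Longrightarrow> f (x \<oplus>\<^bsub>A\<^esub> y) = f x \<oplus>\<^bsub>J\<^esub> f y"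
    and "\<And>r x. \<lbrakk>r \<in> carrier R; x \<in> carrier A\<rbrakk> \<Longrightarrow> f (r \<odot>\<^bsub>A\<^esub> x) = r \<odot>\<^bsub>J\<^esub> f x"
  shows "restrict f (carrier A) \<in> carrier DA"
  using V.mhom_restrictI[of f J] assms by (simp add: A.scalar_mult)

lemma dual_eqI:
  assumes "f \<in> carrier DA" "h \<in> carrier DA" "\<And>x. x \<in> carrier A \<Longrightarrow> f x = h x"
  shows "f = h"
  by (rule mhom_eqI[of f R A.V J h A.V J]) (use assms in auto)

lemma dual_acts:
  assumes "f \<in> carrier DA" "a \<in> carrier A"
  shows dual_lact_closed: "lact DA a f \<in> carrier DA" and dual_ract_closed: "ract DA f a \<in> carrier DA"
proof -
  note f = dualD[OF assms(1)]
  have "(\<lambda>x\<in>carrier A. f (x \<otimes>\<^bsub>A\<^esub> a)) \<in> carrier DA"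
    by (rule dual_restrictI) (simp_all add: f A.l_distr A.smult_mult_left assms(2))
  then show "lact DA a f \<in> carrier DA" by simp
  have "(\<lambda>x\<in>carrier A. f (a \<otimes>\<^bsub>A\<^esub> x)) \<in> carrier DA"
    by (rule dual_restrictI) (simp_all add: f A.r_distr A.smult_mult_right assms(2))
  then show "ract DA f a \<in> carrier DA" by simp
qed

lemma bimod_dual: "bimod A A DA"
proof -
  interpret H: left_module R "hom_mod R A.V J"
    by (rule left_module_hom_mod[OF R.is_cring V.left_module_axioms J.left_module_axioms])
  have ab: "abelian_group DA"
    using H.M.a_closed H.M.zero_closed H.M.a_assoc H.M.a_comm H.M.l_zero abelian_groupE(6)[OF H.M.abelian_group_axioms]
    by (intro abelian_groupI) simp_all
  note cl = abelian_groupE(1)[OF ab] dual_lact_closed dual_ract_closed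
  note simps = dualD A.l_distr A.r_distr A.m_assoc
  have sum: "(f \<oplus>\<^bsub>DA\<^esub> h) x = f x \<oplus>\<^bsub>J\<^esub> h x" if "x \<in> carrier A" for f h x
    using that by simp
  have l: "lact DA a f x = f (x \<otimes>\<^bsub>A\<^esub> a)" "ract DA f a x = f (a \<otimes>\<^bsub>A\<^esub> x)" if "x \<in> carrier A" for a f x
    using that by simp_all
  show ?thesis
    by (intro bimod.intro bimod_axioms.intro A.ring_axioms ab)
      (rule dual_eqI cl | assumption | simp add: cl simps sum l del: dual_simps)+
qed

text \<open>Makes maps of \<open>DA\<close> that are linear over \<open>A\<close> on either side
  linear over \<open>R\<close>, so that reflexivity applies to them; it also makes \<open>R\<close>
  act centrally on \<open>DA\<close>.\<close>

lemma scalar_dual: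
  assumes "r \<in> carrier R" "f \<in> carrier DA"
  shows "lact DA (r \<odot>\<^bsub>A\<^esub> \<one>\<^bsub>A\<^esub>) f = r \<odot>\<^bsub>hom_mod R A.V J\<^esub> f" "ract DA f (r \<odot>\<^bsub>A\<^esub> \<one>\<^bsub>A\<^esub>) = r \<odot>\<^bsub>hom_mod R A.V J\<^esub> f"
  using assms by (auto simp: A.scalar_mult dualD simp del: dual_simps(1) intro!: restrict_ext)

text \<open>This is injectivity of \<open>A \<rightarrow> DDA\<close>, from the cogenerator
  property. Because \<open>(a f) 1 = f a = (f a) 1\<close>, with \<open>f a\<close> on the left the
  value and on the right the action, it gives faithfulness of both actions on
  \<open>DA\<close>.\<close>

lemma dual_faithful:
  assumes a: "a \<in> carrier A" and zero: "\<And>f. f \<in> carrier DA \<Longrightarrow> f a = \<zero>\<^bsub>J\<^esub>"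
  shows "a = \<zero>\<^bsub>A\<^esub>"
proof (rule ccontr)
  assume "a \<noteq> \<zero>\<^bsub>A\<^esub>"
  then obtain f where "f \<in> mhom R A.V J" "f a \<noteq> \<zero>\<^bsub>J\<^esub>"
    using cogenerator[OF V.left_module_axioms A.fin_gen_scalars, of a] a by auto
  then show False using zero[of f] by simp
qed

lemma lact_faithful:
  assumes "a \<in> carrier A" "\<And>f. f \<in> carrier DA \<Longrightarrow> lact DA a f = \<zero>\<^bsub>DA\<^esub>"
  shows "a = \<zero>\<^bsub>A\<^esub>"
proof (rule dual_faithful[OF assms(1)])
  fix f assume "f \<in> carrier DA"
  then have "lact DA a f \<one>\<^bsub>A\<^esub> = \<zero>\<^bsub>DA\<^esub> \<one>\<^bsub>A\<^esub>" using assms(2) by simp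
  then show "f a = \<zero>\<^bsub>J\<^esub>" using assms(1) by simp
qed

lemma ract_faithful:
  assumes "a \<in> carrier A" "\<And>f. f \<in> carrier DA \<Longrightarrow> ract DA f a = \<zero>\<^bsub>DA\<^esub>"
  shows "a = \<zero>\<^bsub>A\<^esub>"
proof (rule dual_faithful[OF assms(1)])
  fix f assume "f \<in> carrier DA"
  then have "ract DA f a \<one>\<^bsub>A\<^esub> = \<zero>\<^bsub>DA\<^esub> \<one>\<^bsub>A\<^esub>" using assms(2) by simp
  then show "f a = \<zero>\<^bsub>J\<^esub>" using assms(1) by simp
qed

text \<open>An endomorphism \<open>h\<close> of \<open>DA\<close> is determined by the functional \<open>f \<mapsto> h f 1\<close>, which is an evaluation.\<close>

lemma additive_dual_evaluation:
  assumes closed: "\<And>f. f \<in> carrier DA \<Longrightarrow> h f \<in> carrier DA"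
    and add: "\<And>f f'. f \<in> carrier DA \<Longrightarrow> f' \<in> carrier DA \<Longrightarrow> h (f \<oplus>\<^bsub>DA\<^esub> f') = h f \<oplus>\<^bsub>DA\<^esub> h f'"
    and smult: "\<And>r f. r \<in> carrier R \<Longrightarrow> f \<in> carrier DA \<Longrightarrow>
      h (r \<odot>\<^bsub>hom_mod R A.V J\<^esub> f) = r \<odot>\<^bsub>hom_mod R A.V J\<^esub> h f"
  obtains a where "a \<in> carrier A" "\<forall>f\<in>carrier DA. h f \<one>\<^bsub>A\<^esub> = f a"
proof -
  interpret H: left_module R "hom_mod R A.V J"
    by (rule left_module_hom_mod[OF R.is_cring V.left_module_axioms J.left_module_axioms])
  define F where "F = restrict (\<lambda>f. h f \<one>\<^bsub>A\<^esub>) (carrier (hom_mod R A.V J))"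
  have "F \<in> mhom R (hom_mod R A.V J) J"
    unfolding F_def
  proof (rule H.mhom_restrictI)
    fix f assume "f \<in> carrier (hom_mod R A.V J)"
    then have f: "f \<in> carrier DA" by simp
    show "h f \<one>\<^bsub>A\<^esub> \<in> carrier J" using dualD(1)[OF closed[OF f]] by simp
    show "h (f \<oplus>\<^bsub>hom_mod R A.V J\<^esub> f') \<one>\<^bsub>A\<^esub> = h f \<one>\<^bsub>A\<^esub> \<oplus>\<^bsub>J\<^esub> h f' \<one>\<^bsub>A\<^esub>"
      if "f' \<in> carrier (hom_mod R A.V J)" for f'
      using add[OF f, of f'] that by simp
    show "h (r \<odot>\<^bsub>hom_mod R A.V J\<^esub> f) \<one>\<^bsub>A\<^esub> = r \<odot>\<^bsub>J\<^esub> h f \<one>\<^bsub>A\<^esub>" if "r \<in> carrier R" for r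
      using smult[OF that f] by simp
  qed
  then obtain v where "v \<in> carrier A.V" "\<And>f. f \<in> mhom R A.V J \<Longrightarrow> F f = f v"
    using reflexive[OF V.left_module_axioms A.fin_gen_scalars] by metis
  then show thesis by (intro that[of v]) (simp_all add: F_def)
qed

text \<open>Linearity over \<open>A\<close> turns the value at \<open>x\<close> into a value at
  \<open>1\<close>: \<open>h f x\<close> is \<open>x (h f) = h (x f)\<close> evaluated at
  \<open>1\<close>, which is \<open>x f\<close> evaluated at \<open>a\<close>, that is,
  \<open>f\<close> at the product of \<open>a\<close> and \<open>x\<close>.\<close>

lemma End_dual_left:
  assumes h: "h \<in> mhom A (lmod DA) (lmod DA)"
  shows "\<exists>a\<in>carrier A. \<forall>f\<in>carrier DA. h f = ract DA f a"
proof -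
  note hD = mhomD(1-3)[OF h, unfolded lmod_simps]
  have sm: "h (r \<odot>\<^bsub>hom_mod R A.V J\<^esub> f) = r \<odot>\<^bsub>hom_mod R A.V J\<^esub> h f" if "r \<in> carrier R" "f \<in> carrier DA" for r f
    using hD(3)[of "r \<odot>\<^bsub>A\<^esub> \<one>\<^bsub>A\<^esub>" f] hD(1) that
    by (simp add: scalar_dual[symmetric] del: dual_simps hom_mod_simps)
  obtain a where a: "a \<in> carrier A" "\<forall>f\<in>carrier DA. h f \<one>\<^bsub>A\<^esub> = f a"
    by (rule additive_dual_evaluation[of h]) (rule hD(1) hD(2) sm that; assumption)+
  have "h f = ract DA f a" if f: "f \<in> carrier DA" for f
  proof (rule dual_eqI)
    fix x assume x: "x \<in> carrier A"
    have "h f x = lact DA x (h f) \<one>\<^bsub>A\<^esub>" using x by simp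
    also have "\<dots> = h (lact DA x f) \<one>\<^bsub>A\<^esub>" using hD(3)[OF x f] by simp
    also have "\<dots> = lact DA x f a" using a(2) dual_lact_closed[OF f x] by blast
    also have "\<dots> = ract DA f a x" using a(1) x by simp
    finally show "h f x = ract DA f a x" .
  qed (use hD(1) f a dual_ract_closed in auto)
  then show ?thesis using a(1) by blast
qed

lemma End_dual_right:
  assumes h: "h \<in> mhom (opp A) (rmod DA) (rmod DA)"
  shows "\<exists>a\<in>carrier A. \<forall>f\<in>carrier DA. h f = lact DA a f"
proof -
  note hD = mhomD(1-3)[OF h, unfolded rmod_simps opp_simps]
  have sm: "h (r \<odot>\<^bsub>hom_mod R A.V J\<^esub> f) = r \<odot>\<^bsub>hom_mod R A.V J\<^esub> h f" if "r \<in> carrier R" "f \<in> carrier DA" for r f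
    using hD(3)[of "r \<odot>\<^bsub>A\<^esub> \<one>\<^bsub>A\<^esub>" f] hD(1) that
    by (simp add: scalar_dual(2)[symmetric] del: dual_simps hom_mod_simps)
  obtain a where a: "a \<in> carrier A" "\<forall>f\<in>carrier DA. h f \<one>\<^bsub>A\<^esub> = f a"
    by (rule additive_dual_evaluation[of h]) (rule hD(1) hD(2) sm that; assumption)+
  have "h f = lact DA a f" if f: "f \<in> carrier DA" for f
  proof (rule dual_eqI)
    fix x assume x: "x \<in> carrier A"
    have "h f x = ract DA (h f) x \<one>\<^bsub>A\<^esub>" using x by simp
    also have "\<dots> = h (ract DA f x) \<one>\<^bsub>A\<^esub>" using hD(3)[OF x f] by simp
    also have "\<dots> = ract DA f x a" using a(2) dual_ract_closed[OF f x] by blast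
    also have "\<dots> = lact DA a f x" using a(1) x by simp
    finally show "h f x = lact DA a f x" .
  qed (use hD(1) f a dual_lact_closed in auto)
  then show ?thesis using a(1) by blast
qed

end

section \<open>Tensor products of bimodules\<close>

locale balanced = M: bimod A B M + N: bimod B C N + G: abelian_group G
  for A :: "('a, 'y1) ring_scheme" and B :: "('b, 'y2) ring_scheme" and C :: "('c, 'y3) ring_scheme"
    and M :: "('a, 'b, 'm) bimodule" and N :: "('b, 'c, 'n) bimodule"
    and G :: "('g, 'y4) ring_scheme" +
  fixes t :: "'m \<Rightarrow> 'n \<Rightarrow> 'g"
  assumes t_closed: "\<lbrakk>m \<in> carrier M; n \<in> carrier N\<rbrakk> \<Longrightarrow> t m n \<in> carrier G"
    and t_add_l: "\<lbrakk>m \<in> carrier M; m' \<in> carrier M; n \<in> carrier N\<rbrakk> \<Longrightarrow> t (m \<oplus>\<^bsub>M\<^esub> m') n = t m n \<oplus>\<^bsub>G\<^esub> t m' n"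
    and t_add_r: "\<lbrakk>m \<in> carrier M; n \<in> carrier N; n' \<in> carrier N\<rbrakk> \<Longrightarrow> t m (n \<oplus>\<^bsub>N\<^esub> n') = t m n \<oplus>\<^bsub>G\<^esub> t m n'"
    and t_balanced: "\<lbrakk>m \<in> carrier M; b \<in> carrier B; n \<in> carrier N\<rbrakk> \<Longrightarrow> t (ract M m b) n = t m (lact N b n)"

locale tensor_product = M: bimod A B M + N: bimod B C N
  for A :: "('a, 'y1) ring_scheme" and B :: "('b, 'y2) ring_scheme" and C :: "('c, 'y3) ring_scheme"
    and M :: "('a, 'b, 'm) bimodule" and N :: "('b, 'c, 'n) bimodule"
begin

abbreviation "F \<equiv> free_Abelian_group (carrier M \<times> carrier N)"
abbreviation "K \<equiv> tensor_rel B M N"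
abbreviation "MN \<equiv> tensor B M N"
abbreviation "cl \<equiv> tensor_class B M N"
abbreviation pure (infixl "\<otimes>\<otimes>" 75) where "pure \<equiv> pure_tensor B M N"

definition gens where
  "gens = {frag_of (x \<oplus>\<^bsub>M\<^esub> x', y) - frag_of (x, y) - frag_of (x', y) | x x' y.
         x \<in> carrier M \<and> x' \<in> carrier M \<and> y \<in> carrier N} \<union>
      {frag_of (x, y \<oplus>\<^bsub>N\<^esub> y') - frag_of (x, y) - frag_of (x, y') | x y y'.
         x \<in> carrier M \<and> y \<in> carrier N \<and> y' \<in> carrier N} \<union>
      {frag_of (ract M x b, y) - frag_of (x, lact N b y) | x b y.
         x \<in> carrier M \<and> b \<in> carrier B \<and> y \<in> carrier N}"

lemma gensI:
  "\<lbrakk>x \<in> carrier M; x' \<in> carrier M; y \<in> carrier N\<rbrakk> \<Longrightarrow> frag_of (x \<oplus>\<^bsub>M\<^esub> x', y) - frag_of (x, y) - frag_of (x', y) \<in> gens"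
  "\<lbrakk>x \<in> carrier M; y \<in> carrier N; y' \<in> carrier N\<rbrakk> \<Longrightarrow> frag_of (x, y \<oplus>\<^bsub>N\<^esub> y') - frag_of (x, y) - frag_of (x, y') \<in> gens"
  "\<lbrakk>x \<in> carrier M; b \<in> carrier B; y \<in> carrier N\<rbrakk> \<Longrightarrow> frag_of (ract M x b, y) - frag_of (x, lact N b y) \<in> gens"
  unfolding gens_def by ((rule UnI1, rule UnI1, blast) | (rule UnI1, rule UnI2, blast) | (rule UnI2, blast))+

lemma K_eq: "K = generate F gens"
  by (simp add: tensor_rel_def gens_def)

sublocale F: comm_group F
  by (rule abelian_free_Abelian_group)

lemma F_diff: "x \<in> carrier F \<Longrightarrow> y \<in> carrier F \<Longrightarrow> x - y \<in> carrier F"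
  using keys_diff[of x y] by auto

lemma gens_subset: "gens \<subseteq> carrier F"
  unfolding gens_def
  by (intro Un_least; clarsimp simp del: carrier_free_Abelian_group_iff; intro F_diff; simp)

lemma K_subgroup: "subgroup K F"
  unfolding K_eq by (rule F.generate_is_subgroup[OF gens_subset])

sublocale K: normal K F
  by (rule F.subgroup_imp_normal[OF K_subgroup])

lemma cl_eq_iff:
  assumes "c \<in> carrier F" "d \<in> carrier F"
  shows "cl c = cl d \<longleftrightarrow> c - d \<in> K"
proof -
  have "cl c = cl d \<longleftrightarrow> c \<in> K #>\<^bsub>F\<^esub> d"
    unfolding tensor_class_def using F.repr_independence[of c K d] assms K_subgroup F.rcos_self[of c K]
    by metis
  also have "\<dots> \<longleftrightarrow> c - d \<in> K"
    by (auto simp: r_coset_def intro!: bexI[of _ "c - d"])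
  finally show ?thesis .
qed

lemma tensor_simps:
  "carrier MN = cl ` carrier F" "\<zero>\<^bsub>MN\<^esub> = cl 0"
  "\<lbrakk>c \<in> carrier F; d \<in> carrier F\<rbrakk> \<Longrightarrow> cl c \<oplus>\<^bsub>MN\<^esub> cl d = cl (c + d)"
proof -
  show "carrier MN = cl ` carrier F"
    by (auto simp: tensor_def Let_def FactGroup_def RCOSETS_def tensor_class_def simp del: carrier_free_Abelian_group_iff)
  show "\<zero>\<^bsub>MN\<^esub> = cl 0"
    using F.coset_mult_one[OF K.subset] by (simp add: tensor_def Let_def FactGroup_def tensor_class_def)
  show "cl c \<oplus>\<^bsub>MN\<^esub> cl d = cl (c + d)" if "c \<in> carrier F" "d \<in> carrier F"
    using K.rcos_sum[OF that] by (simp add: tensor_def Let_def FactGroup_def tensor_class_def)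
qed

lemma abelian_group_tensor: "abelian_group MN"
proof (rule abelian_groupI)
  have F0: "(0 :: ('m \<times> 'n) \<Rightarrow>\<^sub>0 int) \<in> carrier F" using F.one_closed by simp
  have Fadd: "c + d \<in> carrier F" if "c \<in> carrier F" "d \<in> carrier F" for c d
    using F.m_closed[OF that] by simp
  note s = tensor_simps F0 Fadd
  note [simp del] = carrier_free_Abelian_group_iff
  fix x assume "x \<in> carrier MN"
  then obtain c where c: "c \<in> carrier F" "x = cl c" by (auto simp: s)
  show "\<zero>\<^bsub>MN\<^esub> \<oplus>\<^bsub>MN\<^esub> x = x" using c by (simp add: s)
  have "cl (- c) \<oplus>\<^bsub>MN\<^esub> x = \<zero>\<^bsub>MN\<^esub>" "cl (- c) \<in> carrier MN"
    using F_diff[OF F0 c(1)] c by (simp_all add: s)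
  then show "\<exists>y\<in>carrier MN. y \<oplus>\<^bsub>MN\<^esub> x = \<zero>\<^bsub>MN\<^esub>" by blast
  fix y assume "y \<in> carrier MN"
  then obtain d where d: "d \<in> carrier F" "y = cl d" by (auto simp: s)
  show "x \<oplus>\<^bsub>MN\<^esub> y \<in> carrier MN" "x \<oplus>\<^bsub>MN\<^esub> y = y \<oplus>\<^bsub>MN\<^esub> x"
    using c d by (simp_all add: s add.commute)
  fix z assume "z \<in> carrier MN"
  then obtain e where e: "e \<in> carrier F" "z = cl e" by (auto simp: s)
  show "x \<oplus>\<^bsub>MN\<^esub> y \<oplus>\<^bsub>MN\<^esub> z = x \<oplus>\<^bsub>MN\<^esub> (y \<oplus>\<^bsub>MN\<^esub> z)"
    using c d e by (simp add: s add.assoc)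
qed (use F.one_closed in \<open>simp add: tensor_simps\<close>)

sublocale MN: abelian_group MN
  by (rule abelian_group_tensor)

lemma cl_diff3:
  assumes "c \<in> carrier F" "d \<in> carrier F" "e \<in> carrier F" "c - d - e \<in> K"
  shows "cl c = cl d \<oplus>\<^bsub>MN\<^esub> cl e"
  using cl_eq_iff[of c "d + e"] F.m_closed[of d e] tensor_simps(3)[of d e] assms
  by (simp add: diff_diff_eq del: carrier_free_Abelian_group_iff)

lemma gens_in_K: "c \<in> gens \<Longrightarrow> c \<in> K"
  unfolding K_eq by (rule generate.incl)

sublocale pure: balanced A B C M N MN pure
proof unfold_locales
  fix m n assume m: "m \<in> carrier M" and n: "n \<in> carrier N"
  show "m \<otimes>\<otimes> n \<in> carrier MN" using m n by (simp add: tensor_simps(1) pure_tensor_def)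
  show "(m \<oplus>\<^bsub>M\<^esub> m') \<otimes>\<otimes> n = m \<otimes>\<otimes> n \<oplus>\<^bsub>MN\<^esub> m' \<otimes>\<otimes> n" if "m' \<in> carrier M" for m'
    unfolding pure_tensor_def
    by (rule cl_diff3) (use m n that in \<open>simp_all add: gens_in_K gensI\<close>)
  show "m \<otimes>\<otimes> (n \<oplus>\<^bsub>N\<^esub> n') = m \<otimes>\<otimes> n \<oplus>\<^bsub>MN\<^esub> m \<otimes>\<otimes> n'" if "n' \<in> carrier N" for n'
    unfolding pure_tensor_def
    by (rule cl_diff3) (use m n that in \<open>simp_all add: gens_in_K gensI\<close>)
  show "ract M m b \<otimes>\<otimes> n = m \<otimes>\<otimes> lact N b n" if "b \<in> carrier B" for b
  proof -
    have "frag_of (ract M m b, n) - frag_of (m, lact N b n) \<in> K"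
      using m n that by (simp add: gens_in_K gensI)
    then show ?thesis
      unfolding pure_tensor_def using m n that by (subst cl_eq_iff) simp_all
  qed
qed

text \<open>Sums suffice, without negatives or integer multiples, because the negative of a pure
  tensor is again pure: \<open>-(m \<otimes> n) = (-m) \<otimes> n\<close>.\<close>

lemma tensor_induct [consumes 1, case_names pure zero add]:
  assumes "x \<in> carrier MN"
    and pure: "\<And>m n. m \<in> carrier M \<Longrightarrow> n \<in> carrier N \<Longrightarrow> Q (m \<otimes>\<otimes> n)"
    and zero: "Q \<zero>\<^bsub>MN\<^esub>"
    and add: "\<And>x y. \<lbrakk>x \<in> carrier MN; y \<in> carrier MN; Q x; Q y\<rbrakk> \<Longrightarrow> Q (x \<oplus>\<^bsub>MN\<^esub> y)"
  shows "Q x"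
proof -
  obtain c where c: "c \<in> carrier F" "x = cl c" using assms(1) by (auto simp: tensor_simps(1))
  have "Poly_Mapping.keys c \<subseteq> carrier M \<times> carrier N" using c by simp
  \<comment> \<open>The induction principle of the free abelian group uses differences; carrying
    \<open>c\<close> and \<open>-c\<close> together turns these into sums.\<close>
  then have "Q (cl c) \<and> Q (cl (- c))"
  proof (induction c rule: free_Abelian_group_induct[consumes 1, case_names zero diff of])
    case zero
    show ?case using assms(3) by (simp add: tensor_simps(2))
  next
    case (diff c d)
    then have cd: "c \<in> carrier F" "d \<in> carrier F" "- c \<in> carrier F" "- d \<in> carrier F" by simp_all
    have "cl c \<oplus>\<^bsub>MN\<^esub> cl (- d) = cl (c - d)" "cl d \<oplus>\<^bsub>MN\<^esub> cl (- c) = cl (- (c - d))"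
      using tensor_simps(3)[OF cd(1,4)] tensor_simps(3)[OF cd(2,3)] by simp_all
    moreover have "cl c \<in> carrier MN" "cl d \<in> carrier MN" "cl (- c) \<in> carrier MN" "cl (- d) \<in> carrier MN"
      unfolding tensor_simps(1) using cd by blast+
    ultimately show ?case using add[of "cl c" "cl (- d)"] add[of "cl d" "cl (- c)"] diff by simp
  next
    case (of a)
    then obtain m n where a: "a = (m, n)" "m \<in> carrier M" "n \<in> carrier N" by auto
    have mn: "cl (- frag_of (m, n)) \<in> carrier MN" "frag_of (m, n) \<in> carrier F" "- frag_of (m, n) \<in> carrier F"
      using a by (auto simp: tensor_simps(1))
    have "(\<ominus>\<^bsub>M\<^esub> m) \<otimes>\<otimes> n \<oplus>\<^bsub>MN\<^esub> m \<otimes>\<otimes> n = \<zero>\<^bsub>M\<^esub> \<otimes>\<otimes> n"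
      using a pure.t_add_l[of "\<ominus>\<^bsub>M\<^esub> m" m n] by (simp add: M.M.l_neg)
    also have "\<dots> = \<zero>\<^bsub>MN\<^esub>"
      using a pure.t_add_l[of "\<zero>\<^bsub>M\<^esub>" "\<zero>\<^bsub>M\<^esub>" n] pure.t_closed[of "\<zero>\<^bsub>M\<^esub>" n] by (simp add: MN.add.r_cancel_one')
    also have "\<zero>\<^bsub>MN\<^esub> = cl (- frag_of (m, n)) \<oplus>\<^bsub>MN\<^esub> m \<otimes>\<otimes> n"
      unfolding pure_tensor_def tensor_simps(3)[OF mn(3,2)] by (simp add: tensor_simps(2))
    finally have "(\<ominus>\<^bsub>M\<^esub> m) \<otimes>\<otimes> n = cl (- frag_of (m, n))"
      using mn(1) pure.t_closed a by (simp del: carrier_free_Abelian_group_iff)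
    moreover have "Q ((\<ominus>\<^bsub>M\<^esub> m) \<otimes>\<otimes> n)" "Q (m \<otimes>\<otimes> n)" using pure a by simp_all
    ultimately show ?case by (simp add: a(1) pure_tensor_def)
  qed
  then show ?thesis using c by simp
qed

text \<open>The homomorphism that \<open>f\<close> induces on the free abelian group kills the three
  kinds of relations, so it is constant on classes and may be evaluated at a chosen representative.
  It is additive; linearity is checked on pure tensors wherever it is wanted.\<close>

lemma tensor_lift:
  assumes "balanced A B C M N G f"
  obtains h where "additive_map MN G h" "\<forall>m\<in>carrier M. \<forall>n\<in>carrier N. h (m \<otimes>\<otimes> n) = f m n"
proof -
  interpret f: balanced A B C M N G f by fact
  have "(\<lambda>(m, n). f m n) ` (carrier M \<times> carrier N) \<subseteq> carrier (add_monoid G)"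
    using f.t_closed by auto
  then obtain h0 where h0: "h0 \<in> hom F (add_monoid G)"
    and "\<forall>x\<in>carrier M \<times> carrier N. h0 (frag_of x) = (\<lambda>(m, n). f m n) x"
    using comm_group.free_Abelian_group_universal[OF f.G.a_comm_group] by metis
  then have h0_of: "h0 (frag_of (m, n)) = f m n" if "m \<in> carrier M" "n \<in> carrier N" for m n
    using that by simp
  interpret h0: group_hom F "add_monoid G" h0
    by (intro group_hom.intro group_hom_axioms.intro F.is_group f.G.a_group h0)
  have h0c: "h0 c \<in> carrier G" if "c \<in> carrier F" for c using h0.hom_closed[OF that] by simp
  have h0_add: "h0 (c + d) = h0 c \<oplus>\<^bsub>G\<^esub> h0 d" if "c \<in> carrier F" "d \<in> carrier F" for c d
    using h0.hom_mult[OF that] by simp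
  have h0_diff: "h0 (c - d) = h0 c \<ominus>\<^bsub>G\<^esub> h0 d" if "c \<in> carrier F" "d \<in> carrier F" for c d
    using h0_add[OF F_diff[OF that] that(2)] h0c F_diff that
    by (simp add: a_minus_def f.G.a_assoc f.G.r_neg del: carrier_free_Abelian_group_iff)
  have h0_diff3: "h0 (c - d - e) = \<zero>\<^bsub>G\<^esub>" if "c \<in> carrier F" "d \<in> carrier F" "e \<in> carrier F" "h0 c = h0 d \<oplus>\<^bsub>G\<^esub> h0 e" for c d e
  proof -
    have "h0 (c - d) = (h0 e \<oplus>\<^bsub>G\<^esub> h0 d) \<ominus>\<^bsub>G\<^esub> h0 d"
      using that h0c f.G.a_comm by (simp add: h0_diff del: carrier_free_Abelian_group_iff)
    also have "\<dots> = h0 e"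
      using h0c[OF that(2)] h0c[OF that(3)] by (simp add: a_minus_def f.G.a_assoc f.G.r_neg)
    finally show ?thesis
      using h0c[OF that(3)] h0_diff[OF F_diff[OF that(1,2)] that(3)] by (simp add: a_minus_def f.G.r_neg)
  qed
  have "gens \<subseteq> kernel F (add_monoid G) h0"
  proof -
    have "h0 c = \<zero>\<^bsub>G\<^esub>" if "c \<in> gens" for c
      using that unfolding gens_def
    proof (elim UnE CollectE exE conjE)
      fix x x' y assume *: "x \<in> carrier M" "x' \<in> carrier M" "y \<in> carrier N"
        "c = frag_of (x \<oplus>\<^bsub>M\<^esub> x', y) - frag_of (x, y) - frag_of (x', y)"
      show ?thesis unfolding *(4) by (rule h0_diff3) (use * in \<open>simp_all add: h0_of f.t_add_l\<close>)
    next
      fix x y y' assume *: "x \<in> carrier M" "y \<in> carrier N" "y' \<in> carrier N"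
        "c = frag_of (x, y \<oplus>\<^bsub>N\<^esub> y') - frag_of (x, y) - frag_of (x, y')"
      show ?thesis unfolding *(4) by (rule h0_diff3) (use * in \<open>simp_all add: h0_of f.t_add_r\<close>)
    next
      fix x b y assume *: "x \<in> carrier M" "b \<in> carrier B" "y \<in> carrier N"
        "c = frag_of (ract M x b, y) - frag_of (x, lact N b y)"
      then show ?thesis
        using h0_diff[of "frag_of (ract M x b, y)" "frag_of (x, lact N b y)"] f.t_closed
        by (simp add: h0_of f.t_balanced a_minus_def f.G.r_neg)
    qed
    then show ?thesis
      using gens_subset by (auto simp: kernel_def subset_iff simp del: carrier_free_Abelian_group_iff)
  qed
  then have K0: "K \<subseteq> kernel F (add_monoid G) h0"
    unfolding K_eq by (rule F.generate_subgroup_incl[OF _ h0.subgroup_kernel])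
  have wd: "h0 c = h0 d" if "c \<in> carrier F" "d \<in> carrier F" "cl c = cl d" for c d
  proof -
    have "c - d \<in> K" using cl_eq_iff that by blast
    then have "h0 (c - d) = \<zero>\<^bsub>G\<^esub>" using K0 by (auto simp: kernel_def)
    then have "h0 ((c - d) + d) = h0 d"
      using h0_add[OF F_diff[OF that(1,2)] that(2)] h0c[OF that(2)] by simp
    then show ?thesis by simp
  qed
  define h where "h x = h0 (SOME c. c \<in> carrier F \<and> cl c = x)" for x
  have h: "h (cl c) = h0 c" if "c \<in> carrier F" for c
  proof -
    have "(SOME d. d \<in> carrier F \<and> cl d = cl c) \<in> carrier F \<and> cl (SOME d. d \<in> carrier F \<and> cl d = cl c) = cl c"
      by (rule someI[of _ c]) (use that in blast)
    then show ?thesis unfolding h_def using wd that by blast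
  qed
  have "additive_map MN G h"
  proof unfold_locales
    fix x y assume "x \<in> carrier MN" "y \<in> carrier MN"
    then obtain c d where "c \<in> carrier F" "x = cl c" "d \<in> carrier F" "y = cl d" unfolding tensor_simps(1) by blast
    then show "h (x \<oplus>\<^bsub>MN\<^esub> y) = h x \<oplus>\<^bsub>G\<^esub> h y"
      using F.m_closed[of c d] h0_add[of c d] by (simp add: tensor_simps(3) h del: carrier_free_Abelian_group_iff)
  qed (use h h0c in \<open>auto simp: tensor_simps(1)\<close>)
  moreover have "h (m \<otimes>\<otimes> n) = f m n" if "m \<in> carrier M" "n \<in> carrier N" for m n
    using h[of "frag_of (m, n)"] h0_of that by (simp add: pure_tensor_def)
  ultimately show thesis using that by blast
qed

text \<open>\<open>tensor_map\<close> is a union over all representatives of a class. Comparison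
  with the lift \<open>h\<close> shows that every representative contributes the same class, so the
  union is that class.\<close>

lemma tensor_map_balanced:
  assumes \<phi>: "\<phi> \<in> carrier M \<times> carrier N \<rightarrow> carrier M \<times> carrier N"
    and bal: "balanced A B C M N MN (\<lambda>m n. fst (\<phi> (m, n)) \<otimes>\<otimes> snd (\<phi> (m, n)))"
  shows "additive_map MN MN (tensor_map B M N \<phi>)"
    and "\<lbrakk>m \<in> carrier M; n \<in> carrier N\<rbrakk> \<Longrightarrow> tensor_map B M N \<phi> (m \<otimes>\<otimes> n) = fst (\<phi> (m, n)) \<otimes>\<otimes> snd (\<phi> (m, n))"
proof -
  obtain h where h: "additive_map MN MN h"
    and h_pure: "\<forall>m\<in>carrier M. \<forall>n\<in>carrier N. h (m \<otimes>\<otimes> n) = fst (\<phi> (m, n)) \<otimes>\<otimes> snd (\<phi> (m, n))"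
    by (rule tensor_lift[OF bal])
  interpret h: additive_map MN MN h by fact
  define e where "e = frag_extend (frag_of \<circ> \<phi>)"
  have e: "e 0 = 0" "e (c - d) = e c - e d" "e (frag_of x) = frag_of (\<phi> x)" for c d x
    by (simp_all add: e_def frag_extend_diff)
  have ext: "e c \<in> carrier F \<and> cl (e c) = h (cl c)" if "Poly_Mapping.keys c \<subseteq> carrier M \<times> carrier N" for c
    using that
  proof (induction c rule: free_Abelian_group_induct[consumes 1, case_names zero diff of])
    case zero
    show ?case using h.zero by (simp add: e tensor_simps(2))
  next
    case (diff c d)
    have cl_sub: "cl (x - y) = cl x \<ominus>\<^bsub>MN\<^esub> cl y" if "x \<in> carrier F" "y \<in> carrier F" for x y
    proof -
      have "cl y \<in> carrier MN" "cl (x - y) \<in> carrier MN"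
        unfolding tensor_simps(1) using F_diff[OF that] that by blast+
      then have "cl (x - y) = cl (x - y) \<oplus>\<^bsub>MN\<^esub> cl y \<ominus>\<^bsub>MN\<^esub> cl y"
        by (simp add: a_minus_def MN.a_assoc MN.r_neg)
      also have "cl (x - y) \<oplus>\<^bsub>MN\<^esub> cl y = cl x"
        using tensor_simps(3)[OF F_diff[OF that] that(2)] by simp
      finally show ?thesis .
    qed
    have "cl c \<in> carrier MN" "cl d \<in> carrier MN"
      unfolding tensor_simps(1) using diff by auto
    then show ?case
      using diff cl_sub[of c d] cl_sub[of "e c" "e d"] F_diff[of "e c" "e d"]
      by (simp add: e h.minus)
  next
    case (of a)
    then obtain m n where "a = (m, n)" "m \<in> carrier M" "n \<in> carrier N" by auto
    moreover from this have "\<phi> (m, n) \<in> carrier M \<times> carrier N" using \<phi> by blast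
    ultimately show ?case using h_pure by (simp add: e pure_tensor_def)
  qed
  have eq: "tensor_map B M N \<phi> x = h x" if x: "x \<in> carrier MN" for x
  proof -
    obtain c where c: "c \<in> carrier F" "x = cl c" using x unfolding tensor_simps(1) by blast
    have "cl (e d) = h x" if "d \<in> x" for d
    proof -
      have "d \<in> K #>\<^bsub>F\<^esub> c" using that c by (simp add: tensor_class_def)
      moreover from this have "d \<in> carrier F"
        using F.r_coset_subset_G[OF K.subset c(1)] by blast
      ultimately have "d \<in> carrier F" "cl d = x"
        using c(2) F.repr_independence[OF _ c(1) K_subgroup, of d] by (simp_all add: tensor_class_def)
      then show ?thesis using ext[of d] by simp
    qed
    moreover have "c \<in> x" using c F.rcos_self[of c K] K_subgroup by (simp add: tensor_class_def)
    ultimately show ?thesis unfolding tensor_map_def e_def by blast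
  qed
  show "additive_map MN MN (tensor_map B M N \<phi>)"
    by unfold_locales (simp_all add: eq h.closed h.add)
  show "tensor_map B M N \<phi> (m \<otimes>\<otimes> n) = fst (\<phi> (m, n)) \<otimes>\<otimes> snd (\<phi> (m, n))"
    if "m \<in> carrier M" "n \<in> carrier N"
    using eq[OF pure.t_closed[OF that]] h_pure that by simp
qed

section \<open>The bimodule structure of the tensor product\<close>

lemma tensor_acts: "lact MN a = tensor_map B M N (\<lambda>(x, y). (lact M a x, y))"
  "ract MN t c = tensor_map B M N (\<lambda>(x, y). (x, ract N y c)) t"
  by (simp_all add: tensor_def Let_def)

lemma lact_tensor:
  assumes a: "a \<in> carrier A"
  shows "additive_map MN MN (lact MN a)"
    and "\<lbrakk>m \<in> carrier M; n \<in> carrier N\<rbrakk> \<Longrightarrow> lact MN a (m \<otimes>\<otimes> n) = lact M a m \<otimes>\<otimes> n"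
proof -
  let ?f = "\<lambda>(x, y). (lact M a x, y)"
  have f: "?f \<in> carrier M \<times> carrier N \<rightarrow> carrier M \<times> carrier N" using a by auto
  have bal: "balanced A B C M N MN (\<lambda>m n. fst (?f (m, n)) \<otimes>\<otimes> snd (?f (m, n)))"
    using a by unfold_locales (simp_all add: pure.t_closed pure.t_add_l pure.t_add_r M.lact_r_distr pure.t_balanced flip: M.lact_ract)
  show "additive_map MN MN (lact MN a)"
    using tensor_map_balanced(1)[OF f bal] by (simp add: tensor_acts)
  show "lact MN a (m \<otimes>\<otimes> n) = lact M a m \<otimes>\<otimes> n" if "m \<in> carrier M" "n \<in> carrier N"
    using tensor_map_balanced(2)[OF f bal that] by (simp add: tensor_acts)
qed

lemma ract_tensor:
  assumes c: "c \<in> carrier C"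
  shows "additive_map MN MN (\<lambda>x. ract MN x c)"
    and "\<lbrakk>m \<in> carrier M; n \<in> carrier N\<rbrakk> \<Longrightarrow> ract MN (m \<otimes>\<otimes> n) c = m \<otimes>\<otimes> ract N n c"
proof -
  let ?f = "\<lambda>(x, y). (x, ract N y c)"
  have f: "?f \<in> carrier M \<times> carrier N \<rightarrow> carrier M \<times> carrier N" using c by auto
  have bal: "balanced A B C M N MN (\<lambda>m n. fst (?f (m, n)) \<otimes>\<otimes> snd (?f (m, n)))"
    using c by unfold_locales (simp_all add: pure.t_closed pure.t_add_l pure.t_add_r N.ract_l_distr N.lact_ract pure.t_balanced)
  show "additive_map MN MN (\<lambda>x. ract MN x c)"
    using tensor_map_balanced(1)[OF f bal] by (simp add: tensor_acts)
  show "ract MN (m \<otimes>\<otimes> n) c = m \<otimes>\<otimes> ract N n c" if "m \<in> carrier M" "n \<in> carrier N"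
    using tensor_map_balanced(2)[OF f bal that] by (simp add: tensor_acts)
qed

lemma additive_eqI:
  assumes "additive_map MN G f" "additive_map MN G h"
    and "\<And>m n. m \<in> carrier M \<Longrightarrow> n \<in> carrier N \<Longrightarrow> f (m \<otimes>\<otimes> n) = h (m \<otimes>\<otimes> n)" "x \<in> carrier MN"
  shows "f x = h x"
  using assms(4)
proof (induction x rule: tensor_induct)
  case zero
  then show ?case using assms(1,2) by (simp add: additive_map.zero)
next
  case (add x y)
  then show ?case using assms(1,2) by (simp add: additive_map.add)
qed (use assms(3) in simp)

lemma additive_map_comp:
  assumes "additive_map L MN f" "additive_map MN G h"
  shows "additive_map L G (\<lambda>x. h (f x))"
  using assms by (simp add: additive_map_def additive_map_axioms_def)

lemma additive_map_sum:
  assumes "additive_map L MN f" "additive_map L MN h"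
  shows "additive_map L MN (\<lambda>x. f x \<oplus>\<^bsub>MN\<^esub> h x)"
  using assms by (simp add: additive_map_def additive_map_axioms_def MN.a_ac)

text \<open>Each law that compares actions is an equality of two additive maps and is read off on
  pure tensors.\<close>

lemma bimod_tensor: "bimod A C MN"
proof (intro bimod.intro bimod_axioms.intro M.A.ring_axioms N.B.ring_axioms MN.abelian_group_axioms)
  note l = lact_tensor and r = ract_tensor
  note comp = additive_map_comp and sum = additive_map_sum
  have id: "additive_map MN MN (\<lambda>x. x)" by unfold_locales simp_all
  fix x assume x: "x \<in> carrier MN"
  note eqI = additive_eqI[OF _ _ _ x]
  show "lact MN \<one>\<^bsub>A\<^esub> x = x" by (rule eqI[OF l(1) id]) (simp_all add: l)
  show "ract MN x \<one>\<^bsub>C\<^esub> = x" by (rule eqI[OF r(1) id]) (simp_all add: r)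
  fix a assume a: "a \<in> carrier A"
  show "lact MN a x \<in> carrier MN" by (rule additive_map.closed[OF l(1)[OF a] x])
  show "lact MN a (x \<oplus>\<^bsub>MN\<^esub> y) = lact MN a x \<oplus>\<^bsub>MN\<^esub> lact MN a y" if "y \<in> carrier MN" for y
    by (rule additive_map.add[OF l(1)[OF a] x that])
  show "lact MN (a \<oplus>\<^bsub>A\<^esub> a') x = lact MN a x \<oplus>\<^bsub>MN\<^esub> lact MN a' x" if "a' \<in> carrier A" for a'
    by (rule eqI[OF l(1) sum[OF l(1) l(1)]]) (use a that in \<open>simp_all add: l M.lact_l_distr pure.t_add_l\<close>)
  show "lact MN (a \<otimes>\<^bsub>A\<^esub> a') x = lact MN a (lact MN a' x)" if "a' \<in> carrier A" for a'
    by (rule eqI[OF l(1) comp[OF l(1) l(1)]]) (use a that in \<open>simp_all add: l M.lact_assoc\<close>)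
  show "ract MN (lact MN a x) c = lact MN a (ract MN x c)" if "c \<in> carrier C" for c
    by (rule eqI[OF comp[OF l(1) r(1)] comp[OF r(1) l(1)]]) (use a that in \<open>simp_all add: l r\<close>)
next
  note r = ract_tensor
  note comp = additive_map_comp and sum = additive_map_sum
  fix c x assume c: "c \<in> carrier C" and x: "x \<in> carrier MN"
  note eqI = additive_eqI[OF _ _ _ x]
  show "ract MN x c \<in> carrier MN" by (rule additive_map.closed[OF r(1)[OF c] x])
  show "ract MN (x \<oplus>\<^bsub>MN\<^esub> y) c = ract MN x c \<oplus>\<^bsub>MN\<^esub> ract MN y c" if "y \<in> carrier MN" for y
    by (rule additive_map.add[OF r(1)[OF c] x that])
  show "ract MN x (c \<oplus>\<^bsub>C\<^esub> c') = ract MN x c \<oplus>\<^bsub>MN\<^esub> ract MN x c'" if "c' \<in> carrier C" for c'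
    by (rule eqI[OF r(1) sum[OF r(1) r(1)]]) (use c that in \<open>simp_all add: r N.ract_r_distr pure.t_add_r\<close>)
  show "ract MN x (c \<otimes>\<^bsub>C\<^esub> c') = ract MN (ract MN x c) c'" if "c' \<in> carrier C" for c'
    by (rule eqI[OF r(1) comp[OF r(1) r(1)]]) (use c that in \<open>simp_all add: r N.ract_assoc\<close>)
qed

end

section \<open>Endomorphism algebras\<close>

lemma alg_iso_opp: "alg_iso R (opp S) (opp T) = alg_iso R S T"
  by (auto simp: alg_iso_def ring_iso_def ring_hom_def Pi_iff)

lemma End_alg_simps:
  "carrier (End_alg C L) = mhom C L L" "f \<otimes>\<^bsub>End_alg C L\<^esub> h = compose (carrier L) f h"
  "\<one>\<^bsub>End_alg C L\<^esub> = (\<lambda>x\<in>carrier L. x)" "f \<oplus>\<^bsub>End_alg C L\<^esub> h = (\<lambda>x\<in>carrier L. f x \<oplus>\<^bsub>L\<^esub> h x)"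
  "r \<odot>\<^bsub>End_alg C L\<^esub> f = (\<lambda>x\<in>carrier L. (r \<odot>\<^bsub>C\<^esub> \<one>\<^bsub>C\<^esub>) \<odot>\<^bsub>L\<^esub> f x)"
  by (simp_all add: End_alg_def)

text \<open>Here \<open>L\<close> and \<open>K\<close> are the two sides of a bimodule, \<open>K\<close> being written as a left module over the opposite ring.\<close>

lemma End_alg_iso:
  fixes C :: "('r, 'c, 'z1) module_scheme" and L :: "('c, 'm, 'z2) module_scheme" and K :: "('c, 'm, 'z3) module_scheme"
  assumes L: "left_module C L" and K: "left_module (opp C) K"
    and carrier: "carrier K = carrier L" and add: "add K = add L" and zero: "\<zero>\<^bsub>K\<^esub> = \<zero>\<^bsub>L\<^esub>"
    and commute: "\<And>a b x. \<lbrakk>a \<in> carrier C; b \<in> carrier C; x \<in> carrier L\<rbrakk> \<Longrightarrow>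
      b \<odot>\<^bsub>K\<^esub> (a \<odot>\<^bsub>L\<^esub> x) = a \<odot>\<^bsub>L\<^esub> (b \<odot>\<^bsub>K\<^esub> x)"
    and scalar: "\<And>r. r \<in> carrier R \<Longrightarrow> r \<odot>\<^bsub>C\<^esub> \<one>\<^bsub>C\<^esub> \<in> carrier C"
    and smult: "\<And>r c. \<lbrakk>r \<in> carrier R; c \<in> carrier C\<rbrakk> \<Longrightarrow> r \<odot>\<^bsub>C\<^esub> c = (r \<odot>\<^bsub>C\<^esub> \<one>\<^bsub>C\<^esub>) \<otimes>\<^bsub>C\<^esub> c"
    and central: "\<And>r x. \<lbrakk>r \<in> carrier R; x \<in> carrier L\<rbrakk> \<Longrightarrow> (r \<odot>\<^bsub>C\<^esub> \<one>\<^bsub>C\<^esub>) \<odot>\<^bsub>K\<^esub> x = (r \<odot>\<^bsub>C\<^esub> \<one>\<^bsub>C\<^esub>) \<odot>\<^bsub>L\<^esub> x"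
    and full: "\<And>f. f \<in> mhom C L L \<Longrightarrow> \<exists>c\<in>carrier C. \<forall>x\<in>carrier L. f x = c \<odot>\<^bsub>K\<^esub> x"
    and faithful: "\<And>c. \<lbrakk>c \<in> carrier C; \<And>x. x \<in> carrier L \<Longrightarrow> c \<odot>\<^bsub>K\<^esub> x = \<zero>\<^bsub>K\<^esub>\<rbrakk> \<Longrightarrow> c = \<zero>\<^bsub>C\<^esub>"
  shows "\<exists>\<rho>\<in>alg_iso R (opp (End_alg C L)) C. \<forall>f\<in>carrier (End_alg C L). \<forall>x\<in>carrier L. f x = \<rho> f \<odot>\<^bsub>K\<^esub> x"
proof -
  interpret L: left_module C L by fact
  interpret K: left_module "opp C" K by fact
  have unique: "c = d" if c: "c \<in> carrier C" and d: "d \<in> carrier C"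
    and eq: "\<And>x. x \<in> carrier L \<Longrightarrow> c \<odot>\<^bsub>K\<^esub> x = d \<odot>\<^bsub>K\<^esub> x" for c d
  proof -
    have neg: "(c \<oplus>\<^bsub>C\<^esub> \<ominus>\<^bsub>C\<^esub> d) \<odot>\<^bsub>K\<^esub> x = \<zero>\<^bsub>K\<^esub>" if x: "x \<in> carrier L" for x
    proof -
      have "(c \<oplus>\<^bsub>C\<^esub> \<ominus>\<^bsub>C\<^esub> d) \<odot>\<^bsub>K\<^esub> x = (d \<oplus>\<^bsub>C\<^esub> \<ominus>\<^bsub>C\<^esub> d) \<odot>\<^bsub>K\<^esub> x"
        using K.smult_l_distr[of c "\<ominus>\<^bsub>C\<^esub> d" x] K.smult_l_distr[of d "\<ominus>\<^bsub>C\<^esub> d" x] c d x eq[OF x]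
        by (simp add: carrier)
      then show ?thesis using K.smult_l_null[of x] d x by (simp add: L.A.r_neg carrier)
    qed
    have "c \<oplus>\<^bsub>C\<^esub> \<ominus>\<^bsub>C\<^esub> d = \<zero>\<^bsub>C\<^esub>" by (rule faithful[OF _ neg]) (use c d in simp)
    then show ?thesis using c d by (simp add: L.A.add.inv_solve_right')
  qed
  obtain \<rho> where "\<forall>f\<in>mhom C L L. \<rho> f \<in> carrier C \<and> (\<forall>x\<in>carrier L. f x = \<rho> f \<odot>\<^bsub>K\<^esub> x)"
    using full by metis
  then have \<rho>: "\<rho> f \<in> carrier C" and \<rho>_act: "x \<in> carrier L \<Longrightarrow> f x = \<rho> f \<odot>\<^bsub>K\<^esub> x"
    if "f \<in> mhom C L L" for f x using that by auto
  have K_closed: "c \<odot>\<^bsub>K\<^esub> x \<in> carrier L" if "c \<in> carrier C" "x \<in> carrier L" for c x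
    using K.smult_closed[of c x] that by (simp add: carrier)
  \<comment> \<open>Acting from the other side is \<open>C\<close>-linear by \<open>commute\<close>;
    this is the inverse of \<open>\<rho>\<close>.\<close>
  define e where "e c = (\<lambda>x\<in>carrier L. c \<odot>\<^bsub>K\<^esub> x)" for c
  have e: "e c \<in> mhom C L L" if "c \<in> carrier C" for c
    unfolding e_def using K.smult_r_distr[of c] K_closed commute that
    by (intro L.mhom_restrictI) (simp_all add: carrier add)
  have \<rho>_eqI: "\<rho> f = c" if "f \<in> mhom C L L" "c \<in> carrier C" "f = e c" for f c
  proof (rule unique[OF \<rho>[OF that(1)] that(2)])
    fix x assume x: "x \<in> carrier L"
    show "\<rho> f \<odot>\<^bsub>K\<^esub> x = c \<odot>\<^bsub>K\<^esub> x"
      using \<rho>_act[OF that(1) x] fun_cong[OF that(3), of x] x by (simp add: e_def)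
  qed
  have e_\<rho>: "e (\<rho> f) = f" if f: "f \<in> mhom C L L" for f
    by (rule mhom_eqI[OF e[OF \<rho>[OF f]] f refl]) (simp add: e_def \<rho>_act[OF f])
  have "\<rho> \<in> alg_iso R (opp (End_alg C L)) C"
    unfolding alg_iso_def ring_iso_def
  proof (intro CollectI conjI ring_hom_memI ballI)
    fix f assume "f \<in> carrier (opp (End_alg C L))"
    then have f: "f \<in> mhom C L L" by (simp add: End_alg_simps)
    show "\<rho> f \<in> carrier C" by (rule \<rho>[OF f])
    show "\<rho> (r \<odot>\<^bsub>opp (End_alg C L)\<^esub> f) = r \<odot>\<^bsub>C\<^esub> \<rho> f" if r: "r \<in> carrier R" for r
    proof -
      let ?c = "(r \<odot>\<^bsub>C\<^esub> \<one>\<^bsub>C\<^esub>) \<otimes>\<^bsub>C\<^esub> \<rho> f"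
      have c: "?c \<in> carrier C" using scalar[OF r] \<rho>[OF f] by simp
      have "(\<lambda>x\<in>carrier L. (r \<odot>\<^bsub>C\<^esub> \<one>\<^bsub>C\<^esub>) \<odot>\<^bsub>L\<^esub> f x) = e ?c"
        unfolding e_def
        by (rule restrict_ext)
          (use scalar[OF r] \<rho>[OF f] K.smult_assoc[of "\<rho> f" "r \<odot>\<^bsub>C\<^esub> \<one>\<^bsub>C\<^esub>"] in
            \<open>simp add: \<rho>_act[OF f] carrier central[OF r] commute K_closed\<close>)
      then show ?thesis
        using \<rho>_eqI[OF _ c] e[OF c] smult[OF r \<rho>[OF f]] by (simp add: End_alg_simps)
    qed
    fix h assume "h \<in> carrier (opp (End_alg C L))"
    then have h: "h \<in> mhom C L L" by (simp add: End_alg_simps)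
    have c: "\<rho> f \<otimes>\<^bsub>C\<^esub> \<rho> h \<in> carrier C" using \<rho>[OF f] \<rho>[OF h] by simp
    \<comment> \<open>Right actions compose in reverse order: first \<open>f\<close> and then
      \<open>h\<close> is the action of the product of \<open>\<rho> f\<close> and
      \<open>\<rho> h\<close>. This is why the opposite of the endomorphism algebra appears.\<close>
    have "compose (carrier L) h f = e (\<rho> f \<otimes>\<^bsub>C\<^esub> \<rho> h)"
      unfolding e_def compose_def
      by (rule restrict_ext)
        (use \<rho>[OF f] \<rho>[OF h] K.smult_assoc[of "\<rho> h" "\<rho> f"] in \<open>simp add: \<rho>_act[OF f] \<rho>_act[OF h] carrier K_closed\<close>)
    then show "\<rho> (f \<otimes>\<^bsub>opp (End_alg C L)\<^esub> h) = \<rho> f \<otimes>\<^bsub>C\<^esub> \<rho> h"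
      using \<rho>_eqI[OF _ c] e[OF c] by (simp add: End_alg_simps)
    have c: "\<rho> f \<oplus>\<^bsub>C\<^esub> \<rho> h \<in> carrier C" using \<rho>[OF f] \<rho>[OF h] by simp
    have "(\<lambda>x\<in>carrier L. f x \<oplus>\<^bsub>L\<^esub> h x) = e (\<rho> f \<oplus>\<^bsub>C\<^esub> \<rho> h)"
      unfolding e_def
      by (rule restrict_ext)
        (use \<rho>[OF f] \<rho>[OF h] K.smult_l_distr[of "\<rho> f" "\<rho> h"] in \<open>simp add: \<rho>_act[OF f] \<rho>_act[OF h] carrier add\<close>)
    then show "\<rho> (f \<oplus>\<^bsub>opp (End_alg C L)\<^esub> h) = \<rho> f \<oplus>\<^bsub>C\<^esub> \<rho> h"
      using \<rho>_eqI[OF _ c] e[OF c] by (simp add: End_alg_simps)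
  next
    have "(\<lambda>x\<in>carrier L. x) = e \<one>\<^bsub>C\<^esub>"
      unfolding e_def by (rule restrict_ext) (use K.smult_one in \<open>simp add: carrier\<close>)
    then show "\<rho> \<one>\<^bsub>opp (End_alg C L)\<^esub> = \<one>\<^bsub>C\<^esub>"
      using \<rho>_eqI[of "e \<one>\<^bsub>C\<^esub>" "\<one>\<^bsub>C\<^esub>"] e[of "\<one>\<^bsub>C\<^esub>"] by (simp add: End_alg_simps)
  next
    have "bij_betw \<rho> (mhom C L L) (carrier C)"
      by (rule bij_betw_byWitness[where f' = e]) (auto simp: e_\<rho> \<rho> e intro: \<rho>_eqI)
    then show "bij_betw \<rho> (carrier (opp (End_alg C L))) (carrier C)" by (simp add: End_alg_simps)
  qed
  then show ?thesis using \<rho>_act by (intro bexI[of _ \<rho>]) (simp_all add: End_alg_simps)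
qed

section \<open>Triangular bimodules\<close>

text \<open>Abstract form of \<open>T\<close>, with \<open>X\<close>, \<open>P\<close>,
  \<open>Y\<close> for \<open>DA\<close>, \<open>M \<otimes> DB\<close>, \<open>DB\<close> and with
  the products \<open>p\<close> of \<open>M\<close> and \<open>Y\<close> and \<open>q\<close> of
  \<open>X\<close> and \<open>M\<close>. Tensors, duals and \<open>g\<close> disappear from the
  matrix computations, and left and right become symmetric.\<close>

definition tri_bimod ::
  "('a, 'a, 'x) bimodule \<Rightarrow> ('a, 'b, 'p) bimodule \<Rightarrow> ('b, 'b, 'y) bimodule \<Rightarrow> ('m \<Rightarrow> 'y \<Rightarrow> 'p) \<Rightarrow> ('x \<Rightarrow> 'm \<Rightarrow> 'p) \<Rightarrow>
   ('a \<times> 'm \<times> 'b, 'a \<times> 'm \<times> 'b, 'x \<times> 'p \<times> 'y) bimodule"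
where
  "tri_bimod X P Y p q =
     \<lparr>carrier = carrier X \<times> carrier P \<times> carrier Y, mult = undefined, one = undefined,
      ring.zero = (\<zero>\<^bsub>X\<^esub>, \<zero>\<^bsub>P\<^esub>, \<zero>\<^bsub>Y\<^esub>),
      add = (\<lambda>(x, t, y) (x', t', y'). (x \<oplus>\<^bsub>X\<^esub> x', t \<oplus>\<^bsub>P\<^esub> t', y \<oplus>\<^bsub>Y\<^esub> y')),
      lact = (\<lambda>(a, m, b) (x, t, y). (lact X a x, lact P a t \<oplus>\<^bsub>P\<^esub> p m y, lact Y b y)),
      ract = (\<lambda>(x, t, y) (a, m, b). (ract X x a, q x m \<oplus>\<^bsub>P\<^esub> ract P t b, ract Y y b))\<rparr>"

lemma T_bimod_eq_tri_bimod:
  "T_bimod R J A B M g = tri_bimod (dual_alg R J A) (M_tensor_DB R J B M) (dual_alg R J B)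
     (pure_tensor B M (dual_alg R J B)) (\<lambda>\<alpha> m. g (pure_tensor A (dual_alg R J A) M \<alpha> m))"
  by (simp add: T_bimod_def tri_bimod_def Let_def)

text \<open>Together with balancedness, the four assumptions are the associative laws for products
  of matrix entries that involve \<open>M\<close>.\<close>

locale tri_pairing = M: bimod A B M + X: bimod A A X + P: bimod A B P + Y: bimod B B Y +
  p: balanced A B B M Y P p + q: balanced A A B X M P q
  for A :: "('r, 'a, 'v) module_scheme" and B :: "('r, 'b, 'w) module_scheme" and M :: "('a, 'b, 'm) bimodule"
    and X :: "('a, 'a, 'x) bimodule" and P :: "('a, 'b, 'p) bimodule" and Y :: "('b, 'b, 'y) bimodule"
    and p :: "'m \<Rightarrow> 'y \<Rightarrow> 'p" and q :: "'x \<Rightarrow> 'm \<Rightarrow> 'p" +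
  assumes p_lact: "\<lbrakk>a \<in> carrier A; m \<in> carrier M; y \<in> carrier Y\<rbrakk> \<Longrightarrow> lact P a (p m y) = p (lact M a m) y"
    and p_ract: "\<lbrakk>b \<in> carrier B; m \<in> carrier M; y \<in> carrier Y\<rbrakk> \<Longrightarrow> ract P (p m y) b = p m (ract Y y b)"
    and q_lact: "\<lbrakk>a \<in> carrier A; x \<in> carrier X; m \<in> carrier M\<rbrakk> \<Longrightarrow> lact P a (q x m) = q (lact X a x) m"
    and q_ract: "\<lbrakk>b \<in> carrier B; x \<in> carrier X; m \<in> carrier M\<rbrakk> \<Longrightarrow> ract P (q x m) b = q x (ract M m b)"
begin

abbreviation "\<Lambda> \<equiv> tri_alg A B M"
abbreviation "T \<equiv> tri_bimod X P Y p q"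

lemma tri_alg_simps [simp]:
  "carrier \<Lambda> = carrier A \<times> carrier M \<times> carrier B"
  "(a, m, b) \<otimes>\<^bsub>\<Lambda>\<^esub> (a', m', b') = (a \<otimes>\<^bsub>A\<^esub> a', lact M a m' \<oplus>\<^bsub>M\<^esub> ract M m b', b \<otimes>\<^bsub>B\<^esub> b')"
  "\<one>\<^bsub>\<Lambda>\<^esub> = (\<one>\<^bsub>A\<^esub>, \<zero>\<^bsub>M\<^esub>, \<one>\<^bsub>B\<^esub>)" "\<zero>\<^bsub>\<Lambda>\<^esub> = (\<zero>\<^bsub>A\<^esub>, \<zero>\<^bsub>M\<^esub>, \<zero>\<^bsub>B\<^esub>)"
  "(a, m, b) \<oplus>\<^bsub>\<Lambda>\<^esub> (a', m', b') = (a \<oplus>\<^bsub>A\<^esub> a', m \<oplus>\<^bsub>M\<^esub> m', b \<oplus>\<^bsub>B\<^esub> b')"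
  "r \<odot>\<^bsub>\<Lambda>\<^esub> (a, m, b) = (r \<odot>\<^bsub>A\<^esub> a, lact M (r \<odot>\<^bsub>A\<^esub> \<one>\<^bsub>A\<^esub>) m, r \<odot>\<^bsub>B\<^esub> b)"
  by (simp_all add: tri_alg_def)

lemma tri_bimod_simps [simp]:
  "carrier T = carrier X \<times> carrier P \<times> carrier Y" "\<zero>\<^bsub>T\<^esub> = (\<zero>\<^bsub>X\<^esub>, \<zero>\<^bsub>P\<^esub>, \<zero>\<^bsub>Y\<^esub>)"
  "(x, t, y) \<oplus>\<^bsub>T\<^esub> (x', t', y') = (x \<oplus>\<^bsub>X\<^esub> x', t \<oplus>\<^bsub>P\<^esub> t', y \<oplus>\<^bsub>Y\<^esub> y')"
  "lact T (a, m, b) (x, t, y) = (lact X a x, lact P a t \<oplus>\<^bsub>P\<^esub> p m y, lact Y b y)"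
  "ract T (x, t, y) (a, m, b) = (ract X x a, q x m \<oplus>\<^bsub>P\<^esub> ract P t b, ract Y y b)"
  by (simp_all add: tri_bimod_def)

lemma p_null [simp]: "y \<in> carrier Y \<Longrightarrow> p \<zero>\<^bsub>M\<^esub> y = \<zero>\<^bsub>P\<^esub>" "m \<in> carrier M \<Longrightarrow> p m \<zero>\<^bsub>Y\<^esub> = \<zero>\<^bsub>P\<^esub>"
  using p.t_balanced[of m "\<zero>\<^bsub>B\<^esub>" "\<zero>\<^bsub>Y\<^esub>"] p.t_add_l[of "\<zero>\<^bsub>M\<^esub>" "\<zero>\<^bsub>M\<^esub>" y] p.t_add_r[of m "\<zero>\<^bsub>Y\<^esub>" "\<zero>\<^bsub>Y\<^esub>"]
    p.t_closed by (simp_all add: P.M.add.r_cancel_one')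

lemma q_null [simp]: "m \<in> carrier M \<Longrightarrow> q \<zero>\<^bsub>X\<^esub> m = \<zero>\<^bsub>P\<^esub>" "x \<in> carrier X \<Longrightarrow> q x \<zero>\<^bsub>M\<^esub> = \<zero>\<^bsub>P\<^esub>"
  using q.t_add_l[of "\<zero>\<^bsub>X\<^esub>" "\<zero>\<^bsub>X\<^esub>" m] q.t_add_r[of x "\<zero>\<^bsub>M\<^esub>" "\<zero>\<^bsub>M\<^esub>"] q.t_closed
  by (simp_all add: P.M.add.r_cancel_one')

lemma ring_tri_alg: "ring \<Lambda>"
proof (rule ringI)
  show "abelian_group \<Lambda>"
  proof (rule abelian_groupI)
    fix x assume "x \<in> carrier \<Lambda>"
    then show "\<exists>y\<in>carrier \<Lambda>. y \<oplus>\<^bsub>\<Lambda>\<^esub> x = \<zero>\<^bsub>\<Lambda>\<^esub>"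
      by (intro bexI[of _ "(\<ominus>\<^bsub>A\<^esub> fst x, \<ominus>\<^bsub>M\<^esub> fst (snd x), \<ominus>\<^bsub>B\<^esub> snd (snd x))"])
        (auto simp: M.A.l_neg M.M.l_neg M.B.l_neg)
  qed (auto simp: M.A.a_ac M.M.a_ac M.B.a_ac)
  show "monoid \<Lambda>"
    by (rule monoidI)
      (auto simp: M.A.m_assoc M.B.m_assoc M.lact_assoc M.ract_assoc M.lact_r_distr M.ract_l_distr M.lact_ract M.M.a_assoc)
qed (auto simp: M.A.l_distr M.A.r_distr M.B.l_distr M.B.r_distr M.lact_l_distr M.lact_r_distr
    M.ract_l_distr M.ract_r_distr M.M.a_ac)

lemma bimod_T: "bimod \<Lambda> \<Lambda> T"
proof (intro bimod.intro bimod_axioms.intro ring_tri_alg)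
  show "abelian_group T"
  proof (rule abelian_groupI)
    fix x assume "x \<in> carrier T"
    then show "\<exists>y\<in>carrier T. y \<oplus>\<^bsub>T\<^esub> x = \<zero>\<^bsub>T\<^esub>"
      by (intro bexI[of _ "(\<ominus>\<^bsub>X\<^esub> fst x, \<ominus>\<^bsub>P\<^esub> fst (snd x), \<ominus>\<^bsub>Y\<^esub> snd (snd x))"])
        (auto simp: X.M.l_neg P.M.l_neg Y.M.l_neg)
  qed (auto simp: X.M.a_ac P.M.a_ac Y.M.a_ac)
qed (auto simp: p.t_closed q.t_closed X.lact_l_distr X.lact_r_distr X.lact_assoc X.ract_l_distr X.ract_r_distr
    X.ract_assoc X.lact_ract Y.lact_l_distr Y.lact_r_distr Y.lact_assoc Y.ract_l_distr Y.ract_r_distr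
    Y.ract_assoc Y.lact_ract P.lact_l_distr P.lact_r_distr P.lact_assoc P.ract_l_distr P.ract_r_distr
    P.ract_assoc P.lact_ract p.t_add_l p.t_add_r q.t_add_l q.t_add_r p_lact p_ract q_lact q_ract
    p.t_balanced q.t_balanced P.M.a_ac)

sublocale T: bimod \<Lambda> \<Lambda> T
  by (rule bimod_T)

section \<open>Endomorphisms of a triangular bimodule\<close>

abbreviation "inX x \<equiv> (x, \<zero>\<^bsub>P\<^esub>, \<zero>\<^bsub>Y\<^esub>)"
abbreviation "inP t \<equiv> (\<zero>\<^bsub>X\<^esub>, t, \<zero>\<^bsub>Y\<^esub>)"
abbreviation "inY y \<equiv> (\<zero>\<^bsub>X\<^esub>, \<zero>\<^bsub>P\<^esub>, y)"

lemma additive_decompose: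
  assumes add: "\<And>z z'. \<lbrakk>z \<in> carrier T; z' \<in> carrier T\<rbrakk> \<Longrightarrow> f (z \<oplus>\<^bsub>T\<^esub> z') = f z \<oplus>\<^bsub>T\<^esub> f z'"
    and "x \<in> carrier X" "t \<in> carrier P" "y \<in> carrier Y"
  shows "f (x, t, y) = f (inX x) \<oplus>\<^bsub>T\<^esub> f (inP t) \<oplus>\<^bsub>T\<^esub> f (inY y)"
  using add[of "inX x" "inP t"] add[of "(x, t, \<zero>\<^bsub>Y\<^esub>)" "inY y"] assms(2-4) by simp

text \<open>Left multiplication by the idempotents \<open>(1, 0, 0)\<close> and
  \<open>(0, 0, 1)\<close> separates the rows: the image of an \<open>X\<close>-entry lies in the
  first row, and that of a \<open>Y\<close>-entry is again a \<open>Y\<close>-entry. This leaves the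
  components \<open>u\<close>, \<open>w\<close> and \<open>v\<close>, which give the entries
  \<open>a\<close>, \<open>m\<close> and \<open>b\<close> of the multiplier.\<close>

lemma mhom_lmod_T:
  assumes f: "f \<in> mhom \<Lambda> (lmod T) (lmod T)"
    and XX: "\<And>h. h \<in> mhom A (lmod X) (lmod X) \<Longrightarrow> \<exists>a\<in>carrier A. \<forall>x\<in>carrier X. h x = ract X x a"
    and XP: "\<And>h. h \<in> mhom A (lmod X) (lmod P) \<Longrightarrow> \<exists>m\<in>carrier M. \<forall>x\<in>carrier X. h x = q x m"
    and YY: "\<And>h. h \<in> mhom B (lmod Y) (lmod Y) \<Longrightarrow> \<exists>b\<in>carrier B. \<forall>y\<in>carrier Y. h y = ract Y y b"
    and gen: "\<And>Q t. \<lbrakk>t \<in> carrier P; \<And>m y. \<lbrakk>m \<in> carrier M; y \<in> carrier Y\<rbrakk> \<Longrightarrow> Q (p m y); Q \<zero>\<^bsub>P\<^esub>;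
      \<And>s t. \<lbrakk>s \<in> carrier P; t \<in> carrier P; Q s; Q t\<rbrakk> \<Longrightarrow> Q (s \<oplus>\<^bsub>P\<^esub> t)\<rbrakk> \<Longrightarrow> Q t"
  shows "\<exists>c\<in>carrier \<Lambda>. \<forall>z\<in>carrier T. f z = ract T z c"
proof -
  note fD = mhomD(1-3)[OF f, unfolded lmod_simps]
  interpret Xl: left_module A "lmod X" by (rule X.lmod)
  interpret Yl: left_module B "lmod Y" by (rule Y.lmod)
  define u w where "u x = fst (f (inX x))" and "w x = fst (snd (f (inX x)))" for x
  define v where "v y = snd (snd (f (inY y)))" for y
  have uw: "f (inX x) = (u x, w x, \<zero>\<^bsub>Y\<^esub>)" "u x \<in> carrier X" "w x \<in> carrier P" if x: "x \<in> carrier X" for x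
  proof -
    have "f (inX x) \<in> carrier T" using x by (intro fD) simp
    then obtain x' t' y' where e: "f (inX x) = (x', t', y')"
        "x' \<in> carrier X" "t' \<in> carrier P" "y' \<in> carrier Y" by auto
    have "f (inX x) = lact T (\<one>\<^bsub>A\<^esub>, \<zero>\<^bsub>M\<^esub>, \<zero>\<^bsub>B\<^esub>) (x', t', y')"
      using fD(3)[of "(\<one>\<^bsub>A\<^esub>, \<zero>\<^bsub>M\<^esub>, \<zero>\<^bsub>B\<^esub>)" "inX x"] x e by simp
    then show "f (inX x) = (u x, w x, \<zero>\<^bsub>Y\<^esub>)" "u x \<in> carrier X" "w x \<in> carrier P"
      using e by (simp_all add: u_def w_def)
  qed
  have v: "f (inY y) = (\<zero>\<^bsub>X\<^esub>, \<zero>\<^bsub>P\<^esub>, v y)" "v y \<in> carrier Y" if y: "y \<in> carrier Y" for y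
  proof -
    have "f (inY y) \<in> carrier T" using y by (intro fD) simp
    then obtain x' t' y' where e: "f (inY y) = (x', t', y')"
        "x' \<in> carrier X" "t' \<in> carrier P" "y' \<in> carrier Y" by auto
    have "f (inY y) = lact T (\<zero>\<^bsub>A\<^esub>, \<zero>\<^bsub>M\<^esub>, \<one>\<^bsub>B\<^esub>) (x', t', y')"
      using fD(3)[of "(\<zero>\<^bsub>A\<^esub>, \<zero>\<^bsub>M\<^esub>, \<one>\<^bsub>B\<^esub>)" "inY y"] y e by simp
    then show "f (inY y) = (\<zero>\<^bsub>X\<^esub>, \<zero>\<^bsub>P\<^esub>, v y)" "v y \<in> carrier Y"
      using e by (simp_all add: v_def)
  qed
  have u_add: "u (x \<oplus>\<^bsub>X\<^esub> x') = u x \<oplus>\<^bsub>X\<^esub> u x'" "w (x \<oplus>\<^bsub>X\<^esub> x') = w x \<oplus>\<^bsub>P\<^esub> w x'"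
    if "x \<in> carrier X" "x' \<in> carrier X" for x x'
    using fD(2)[of "inX x" "inX x'"] that by (simp_all add: uw)
  have u_smult: "u (lact X a x) = lact X a (u x)" "w (lact X a x) = lact P a (w x)"
    if "a \<in> carrier A" "x \<in> carrier X" for a x
    using fD(3)[of "(a, \<zero>\<^bsub>M\<^esub>, \<zero>\<^bsub>B\<^esub>)" "inX x"] that by (simp_all add: uw)
  have v_add: "v (y \<oplus>\<^bsub>Y\<^esub> y') = v y \<oplus>\<^bsub>Y\<^esub> v y'" if "y \<in> carrier Y" "y' \<in> carrier Y" for y y'
    using fD(2)[of "inY y" "inY y'"] that by (simp add: v)
  have v_smult: "v (lact Y b y) = lact Y b (v y)" if "b \<in> carrier B" "y \<in> carrier Y" for b y
    using fD(3)[of "(\<zero>\<^bsub>A\<^esub>, \<zero>\<^bsub>M\<^esub>, b)" "inY y"] that by (simp add: v)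
  have "restrict u (carrier (lmod X)) \<in> mhom A (lmod X) (lmod X)"
    by (rule Xl.mhom_restrictI) (simp_all add: uw u_add u_smult)
  from XX[OF this] obtain a where a: "a \<in> carrier A" "\<And>x. x \<in> carrier X \<Longrightarrow> u x = ract X x a" by auto
  have "restrict w (carrier (lmod X)) \<in> mhom A (lmod X) (lmod P)"
    by (rule Xl.mhom_restrictI) (simp_all add: uw u_add u_smult)
  from XP[OF this] obtain m where m: "m \<in> carrier M" "\<And>x. x \<in> carrier X \<Longrightarrow> w x = q x m" by auto
  have "restrict v (carrier (lmod Y)) \<in> mhom B (lmod Y) (lmod Y)"
    by (rule Yl.mhom_restrictI) (simp_all add: v v_add v_smult)
  from YY[OF this] obtain b where b: "b \<in> carrier B" "\<And>y. y \<in> carrier Y \<Longrightarrow> v y = ract Y y b" by auto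
  \<comment> \<open>The product \<open>p m' y\<close> is \<open>(0, m', 0)\<close> times the entry
    \<open>y\<close>, so its image is determined by \<open>v y\<close> and has no component in
    \<open>X\<close>.\<close>
  have t: "f (inP t) = (\<zero>\<^bsub>X\<^esub>, ract P t b, \<zero>\<^bsub>Y\<^esub>)" if "t \<in> carrier P" for t
    using that
  proof (rule gen)
    fix m' y assume "m' \<in> carrier M" "y \<in> carrier Y"
    then show "f (inP (p m' y)) = (\<zero>\<^bsub>X\<^esub>, ract P (p m' y) b, \<zero>\<^bsub>Y\<^esub>)"
      using fD(3)[of "(\<zero>\<^bsub>A\<^esub>, m', \<zero>\<^bsub>B\<^esub>)" "inY y"] v b by (simp add: p.t_closed p_ract)
  next
    show "f (\<zero>\<^bsub>X\<^esub>, \<zero>\<^bsub>P\<^esub>, \<zero>\<^bsub>Y\<^esub>) = (\<zero>\<^bsub>X\<^esub>, ract P \<zero>\<^bsub>P\<^esub> b, \<zero>\<^bsub>Y\<^esub>)"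
      using v(1)[of "\<zero>\<^bsub>Y\<^esub>"] b by simp
  next
    fix s t assume "s \<in> carrier P" "t \<in> carrier P"
      "f (inP s) = (\<zero>\<^bsub>X\<^esub>, ract P s b, \<zero>\<^bsub>Y\<^esub>)" "f (inP t) = (\<zero>\<^bsub>X\<^esub>, ract P t b, \<zero>\<^bsub>Y\<^esub>)"
    then show "f (inP (s \<oplus>\<^bsub>P\<^esub> t)) = (\<zero>\<^bsub>X\<^esub>, ract P (s \<oplus>\<^bsub>P\<^esub> t) b, \<zero>\<^bsub>Y\<^esub>)"
      using fD(2)[of "inP s" "inP t"] b(1) by (simp add: P.ract_l_distr)
  qed
  show ?thesis
  proof (intro bexI[of _ "(a, m, b)"] ballI)
    show "(a, m, b) \<in> carrier \<Lambda>" using a b m by simp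
    fix z assume "z \<in> carrier T"
    then obtain x s y where z: "z = (x, s, y)" "x \<in> carrier X" "s \<in> carrier P" "y \<in> carrier Y" by auto
    show "f z = ract T z (a, m, b)"
      using additive_decompose[of f, OF fD(2) z(2-4)] z a b m by (simp add: uw t v q.t_closed)
  qed
qed

text \<open>Mirror image of the left case: the idempotents act on the right and separate the
  columns, so an \<open>X\<close>-entry stays an \<open>X\<close>-entry and a \<open>Y\<close>-entry
  stays in the second column.\<close>

lemma mhom_rmod_T:
  assumes f: "f \<in> mhom (opp \<Lambda>) (rmod T) (rmod T)"
    and XX: "\<And>h. h \<in> mhom (opp A) (rmod X) (rmod X) \<Longrightarrow> \<exists>a\<in>carrier A. \<forall>x\<in>carrier X. h x = lact X a x"
    and YP: "\<And>h. h \<in> mhom (opp B) (rmod Y) (rmod P) \<Longrightarrow> \<exists>m\<in>carrier M. \<forall>y\<in>carrier Y. h y = p m y"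
    and YY: "\<And>h. h \<in> mhom (opp B) (rmod Y) (rmod Y) \<Longrightarrow> \<exists>b\<in>carrier B. \<forall>y\<in>carrier Y. h y = lact Y b y"
    and gen: "\<And>Q t. \<lbrakk>t \<in> carrier P; \<And>x m. \<lbrakk>x \<in> carrier X; m \<in> carrier M\<rbrakk> \<Longrightarrow> Q (q x m); Q \<zero>\<^bsub>P\<^esub>;
      \<And>s t. \<lbrakk>s \<in> carrier P; t \<in> carrier P; Q s; Q t\<rbrakk> \<Longrightarrow> Q (s \<oplus>\<^bsub>P\<^esub> t)\<rbrakk> \<Longrightarrow> Q t"
  shows "\<exists>c\<in>carrier \<Lambda>. \<forall>z\<in>carrier T. f z = lact T c z"
proof -
  note fD = mhomD(1-3)[OF f, unfolded rmod_simps opp_simps]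
  interpret Xr: left_module "opp A" "rmod X" by (rule X.rmod)
  interpret Yr: left_module "opp B" "rmod Y" by (rule Y.rmod)
  define u where "u x = fst (f (inX x))" for x
  define v w where "v y = snd (snd (f (inY y)))" and "w y = fst (snd (f (inY y)))" for y
  have u: "f (inX x) = (u x, \<zero>\<^bsub>P\<^esub>, \<zero>\<^bsub>Y\<^esub>)" "u x \<in> carrier X" if x: "x \<in> carrier X" for x
  proof -
    have "f (inX x) \<in> carrier T" using x by (intro fD) simp
    then obtain x' t' y' where e: "f (inX x) = (x', t', y')"
        "x' \<in> carrier X" "t' \<in> carrier P" "y' \<in> carrier Y" by auto
    have "f (inX x) = ract T (x', t', y') (\<one>\<^bsub>A\<^esub>, \<zero>\<^bsub>M\<^esub>, \<zero>\<^bsub>B\<^esub>)"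
      using fD(3)[of "(\<one>\<^bsub>A\<^esub>, \<zero>\<^bsub>M\<^esub>, \<zero>\<^bsub>B\<^esub>)" "inX x"] x e by simp
    then show "f (inX x) = (u x, \<zero>\<^bsub>P\<^esub>, \<zero>\<^bsub>Y\<^esub>)" "u x \<in> carrier X"
      using e by (simp_all add: u_def)
  qed
  have vw: "f (inY y) = (\<zero>\<^bsub>X\<^esub>, w y, v y)" "v y \<in> carrier Y" "w y \<in> carrier P" if y: "y \<in> carrier Y" for y
  proof -
    have "f (inY y) \<in> carrier T" using y by (intro fD) simp
    then obtain x' t' y' where e: "f (inY y) = (x', t', y')"
        "x' \<in> carrier X" "t' \<in> carrier P" "y' \<in> carrier Y" by auto
    have "f (inY y) = ract T (x', t', y') (\<zero>\<^bsub>A\<^esub>, \<zero>\<^bsub>M\<^esub>, \<one>\<^bsub>B\<^esub>)"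
      using fD(3)[of "(\<zero>\<^bsub>A\<^esub>, \<zero>\<^bsub>M\<^esub>, \<one>\<^bsub>B\<^esub>)" "inY y"] y e by simp
    then show "f (inY y) = (\<zero>\<^bsub>X\<^esub>, w y, v y)" "v y \<in> carrier Y" "w y \<in> carrier P"
      using e by (simp_all add: v_def w_def)
  qed
  have u_add: "u (x \<oplus>\<^bsub>X\<^esub> x') = u x \<oplus>\<^bsub>X\<^esub> u x'" if "x \<in> carrier X" "x' \<in> carrier X" for x x'
    using fD(2)[of "inX x" "inX x'"] that by (simp add: u)
  have u_smult: "u (ract X x a) = ract X (u x) a" if "a \<in> carrier A" "x \<in> carrier X" for a x
    using fD(3)[of "(a, \<zero>\<^bsub>M\<^esub>, \<zero>\<^bsub>B\<^esub>)" "inX x"] that by (simp add: u)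
  have v_add: "v (y \<oplus>\<^bsub>Y\<^esub> y') = v y \<oplus>\<^bsub>Y\<^esub> v y'" "w (y \<oplus>\<^bsub>Y\<^esub> y') = w y \<oplus>\<^bsub>P\<^esub> w y'"
    if "y \<in> carrier Y" "y' \<in> carrier Y" for y y'
    using fD(2)[of "inY y" "inY y'"] that by (simp_all add: vw)
  have v_smult: "v (ract Y y b) = ract Y (v y) b" "w (ract Y y b) = ract P (w y) b"
    if "b \<in> carrier B" "y \<in> carrier Y" for b y
    using fD(3)[of "(\<zero>\<^bsub>A\<^esub>, \<zero>\<^bsub>M\<^esub>, b)" "inY y"] that by (simp_all add: vw)
  have "restrict u (carrier (rmod X)) \<in> mhom (opp A) (rmod X) (rmod X)"
    by (rule Xr.mhom_restrictI) (simp_all add: u u_add u_smult)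
  from XX[OF this] obtain a where a: "a \<in> carrier A" "\<And>x. x \<in> carrier X \<Longrightarrow> u x = lact X a x" by auto
  have "restrict w (carrier (rmod Y)) \<in> mhom (opp B) (rmod Y) (rmod P)"
    by (rule Yr.mhom_restrictI) (simp_all add: vw v_add v_smult)
  from YP[OF this] obtain m where m: "m \<in> carrier M" "\<And>y. y \<in> carrier Y \<Longrightarrow> w y = p m y" by auto
  have "restrict v (carrier (rmod Y)) \<in> mhom (opp B) (rmod Y) (rmod Y)"
    by (rule Yr.mhom_restrictI) (simp_all add: vw v_add v_smult)
  from YY[OF this] obtain b where b: "b \<in> carrier B" "\<And>y. y \<in> carrier Y \<Longrightarrow> v y = lact Y b y" by auto
  \<comment> \<open>Now \<open>P\<close> is reached from \<open>X\<close>: the product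
    \<open>q x m'\<close> is the entry \<open>x\<close> times \<open>(0, m', 0)\<close>.\<close>
  have t: "f (inP t) = (\<zero>\<^bsub>X\<^esub>, lact P a t, \<zero>\<^bsub>Y\<^esub>)" if "t \<in> carrier P" for t
    using that
  proof (rule gen)
    fix x m' assume "x \<in> carrier X" "m' \<in> carrier M"
    then show "f (inP (q x m')) = (\<zero>\<^bsub>X\<^esub>, lact P a (q x m'), \<zero>\<^bsub>Y\<^esub>)"
      using fD(3)[of "(\<zero>\<^bsub>A\<^esub>, m', \<zero>\<^bsub>B\<^esub>)" "inX x"] u a by (simp add: q.t_closed q_lact)
  next
    show "f (\<zero>\<^bsub>X\<^esub>, \<zero>\<^bsub>P\<^esub>, \<zero>\<^bsub>Y\<^esub>) = (\<zero>\<^bsub>X\<^esub>, lact P a \<zero>\<^bsub>P\<^esub>, \<zero>\<^bsub>Y\<^esub>)"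
      using u(1)[of "\<zero>\<^bsub>X\<^esub>"] a by simp
  next
    fix s t assume "s \<in> carrier P" "t \<in> carrier P"
      "f (inP s) = (\<zero>\<^bsub>X\<^esub>, lact P a s, \<zero>\<^bsub>Y\<^esub>)" "f (inP t) = (\<zero>\<^bsub>X\<^esub>, lact P a t, \<zero>\<^bsub>Y\<^esub>)"
    then show "f (inP (s \<oplus>\<^bsub>P\<^esub> t)) = (\<zero>\<^bsub>X\<^esub>, lact P a (s \<oplus>\<^bsub>P\<^esub> t), \<zero>\<^bsub>Y\<^esub>)"
      using fD(2)[of "inP s" "inP t"] a(1) by (simp add: P.lact_r_distr)
  qed
  show ?thesis
  proof (intro bexI[of _ "(a, m, b)"] ballI)
    show "(a, m, b) \<in> carrier \<Lambda>" using a b m by simp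
    fix z assume "z \<in> carrier T"
    then obtain x s y where z: "z = (x, s, y)" "x \<in> carrier X" "s \<in> carrier P" "y \<in> carrier Y" by auto
    show "f z = lact T (a, m, b) z"
      using additive_decompose[of f, OF fD(2) z(2-4)] z a b m by (simp add: u t vw p.t_closed)
  qed
qed

end

section \<open>Exchangeable bimodules\<close>

locale exchange = DA: dual_algebra R J A + DB: dual_algebra R J B + M: bimod A B M
  for R :: "('r, 'y) ring_scheme" and J :: "('r, 'j, 'z) module_scheme"
    and A :: "('r, 'a, 'v) module_scheme" and B :: "('r, 'b, 'w) module_scheme"
    and M :: "('a, 'b, 'm) bimodule" +
  fixes g :: "((('a \<Rightarrow> 'j) \<times> 'm) \<Rightarrow>\<^sub>0 int) set \<Rightarrow> (('m \<times> ('b \<Rightarrow> 'j)) \<Rightarrow>\<^sub>0 int) set"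
  assumes central: "\<lbrakk>r \<in> carrier R; x \<in> carrier M\<rbrakk> \<Longrightarrow>
      lact M (r \<odot>\<^bsub>A\<^esub> \<one>\<^bsub>A\<^esub>) x = ract M x (r \<odot>\<^bsub>B\<^esub> \<one>\<^bsub>B\<^esub>)"
    and fin_gen_lmod: "fin_gen A (lmod M)" and fin_gen_rmod: "fin_gen (opp B) (rmod M)"
    and projective_lmod: "projective_mod A (lmod M)" and projective_rmod: "projective_mod (opp B) (rmod M)"
    and g: "g \<in> bimod_iso A B (DA_tensor_M R J A M) (M_tensor_DB R J B M)"
begin

declare dual_simps [simp del]

abbreviation "X \<equiv> dual_alg R J A"
abbreviation "Y \<equiv> dual_alg R J B"
abbreviation "XM \<equiv> tensor A X M"
abbreviation "MY \<equiv> tensor B M Y"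

sublocale X: bimod A A X by (rule DA.bimod_dual)
sublocale Y: bimod B B Y by (rule DB.bimod_dual)
sublocale XM: tensor_product A A B X M ..
sublocale MY: tensor_product A B B M Y ..
sublocale tXM: bimod A B XM by (rule XM.bimod_tensor)
sublocale tMY: bimod A B MY by (rule MY.bimod_tensor)

abbreviation "p \<equiv> pure_tensor B M Y"
abbreviation "s \<equiv> pure_tensor A X M"

definition q where "q x m = g (s x m)"

lemma g_hom: "g \<in> mhom A (lmod XM) (lmod MY)" "g \<in> mhom (opp B) (rmod XM) (rmod MY)"
    and g_bij: "bij_betw g (carrier XM) (carrier MY)"
  using g by (auto simp: bimod_iso_def)

lemmas gD = mhomD(1-3)[OF g_hom(1), unfolded lmod_simps] mhomD(3)[OF g_hom(2), unfolded rmod_simps opp_simps]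

sublocale tri_pairing A B M X MY Y p q
proof unfold_locales
  fix x m assume x: "x \<in> carrier X" and m: "m \<in> carrier M"
  show "q x m \<in> carrier MY" using gD(1) XM.pure.t_closed x m by (simp add: q_def)
  show "q (x \<oplus>\<^bsub>X\<^esub> x') m = q x m \<oplus>\<^bsub>MY\<^esub> q x' m" if "x' \<in> carrier X" for x'
    using gD(2) XM.pure.t_closed XM.pure.t_add_l x m that by (simp add: q_def)
  show "q x (m \<oplus>\<^bsub>M\<^esub> m') = q x m \<oplus>\<^bsub>MY\<^esub> q x m'" if "m' \<in> carrier M" for m'
    using gD(2) XM.pure.t_closed XM.pure.t_add_r x m that by (simp add: q_def)
  show "q (ract X x a) m = q x (lact M a m)" "lact MY a (q x m) = q (lact X a x) m" if "a \<in> carrier A" for a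
    using gD(3)[OF that, of "s x m"] XM.pure.t_closed XM.pure.t_balanced XM.lact_tensor(2) x m that
    by (simp_all add: q_def)
  show "ract MY (q x m) b = q x (ract M m b)" if "b \<in> carrier B" for b
    using gD(4)[OF that, of "s x m"] XM.pure.t_closed XM.ract_tensor(2) x m that
    by (simp add: q_def)
qed (simp_all add: MY.pure.t_closed MY.pure.t_add_l MY.pure.t_add_r MY.pure.t_balanced MY.lact_tensor
    MY.ract_tensor)

text \<open>Surjectivity of \<open>g\<close> carries generation by pure tensors over from
  \<open>DA \<otimes> M\<close>. Right endomorphisms rely on it, since there the middle entry is
  reached from \<open>DA\<close>.\<close>

lemma q_induct:
  assumes t: "t \<in> carrier MY" and pure: "\<And>x m. \<lbrakk>x \<in> carrier X; m \<in> carrier M\<rbrakk> \<Longrightarrow> Q (q x m)"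
    and zero: "Q \<zero>\<^bsub>MY\<^esub>"
    and add: "\<And>u v. \<lbrakk>u \<in> carrier MY; v \<in> carrier MY; Q u; Q v\<rbrakk> \<Longrightarrow> Q (u \<oplus>\<^bsub>MY\<^esub> v)"
  shows "Q t"
proof -
  have "g \<zero>\<^bsub>XM\<^esub> = \<zero>\<^bsub>MY\<^esub>"
    using additive_map.zero[of XM MY g] gD XM.abelian_group_tensor MY.abelian_group_tensor
    by (simp add: additive_map_def additive_map_axioms_def)
  moreover obtain w where w: "w \<in> carrier XM" "t = g w"
    using t g_bij by (auto simp: bij_betw_def)
  have "Q (g w)"
    using w(1)
  proof (induction w rule: XM.tensor_induct)
    case (pure x m)
    then show ?case using assms(2)[of x m] by (simp add: q_def)
  next
    case zero
    then show ?case using assms(3) calculation by simp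
  next
    case (add u v)
    then show ?case using assms(4)[of "g u" "g v"] gD(1,2) by simp
  qed
  then show ?thesis using w(2) by simp
qed

text \<open>Scalars act on \<open>DA\<close> from the right, and by \<open>End_dual_left\<close>
  they exhaust the left endomorphisms. A form \<open>\<phi>\<close> on \<open>M\<close> gives the
  balanced map \<open>x, m \<mapsto> x \<phi>(m)\<close>, which is left linear because the two
  actions on \<open>DA\<close> commute.\<close>

lemma projective_pairing_left:
  "projective_pairing A (lmod M) (lmod X) (lmod XM) (\<lambda>x a. ract X x a) (\<lambda>m x. s x m)"
proof -
  interpret Ml: left_module A "lmod M" by (rule M.lmod)
  interpret Xl: left_module A "lmod X" by (rule X.lmod)
  interpret Pl: left_module A "lmod XM" by (rule tXM.lmod)
  show ?thesis
  proof (unfold_locales, unfold lmod_simps)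
    show "projective_mod A (lmod M)" "fin_gen A (lmod M)" by (rule projective_lmod, rule fin_gen_lmod)
    show "a = \<zero>\<^bsub>A\<^esub>" if "a \<in> carrier A" "\<And>x. x \<in> carrier X \<Longrightarrow> ract X x a = \<zero>\<^bsub>X\<^esub>" for a
      using that by (rule DA.ract_faithful)
    show "\<exists>a\<in>carrier A. \<forall>x\<in>carrier X. h x = ract X x a" if "h \<in> mhom A (lmod X) (lmod X)" for h
      using that by (rule DA.End_dual_left)
    show "Q t" if "\<And>m x. \<lbrakk>m \<in> carrier M; x \<in> carrier X\<rbrakk> \<Longrightarrow> Q (s x m)" "Q \<zero>\<^bsub>XM\<^esub>"
      "\<And>u v. \<lbrakk>u \<in> carrier XM; v \<in> carrier XM; Q u; Q v\<rbrakk> \<Longrightarrow> Q (u \<oplus>\<^bsub>XM\<^esub> v)" "t \<in> carrier XM" for Q t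
      using that(4,1-3) by (rule XM.tensor_induct)
    show "\<exists>\<psi>\<in>mhom A (lmod XM) (lmod X). \<forall>m\<in>carrier M. \<forall>x\<in>carrier X. \<psi> (s x m) = ract X x (\<phi> m)"
      if \<phi>: "\<phi> \<in> mhom A (lmod M) (self_mod A)" for \<phi>
    proof -
      note \<phi>D = mhomD(1-3)[OF \<phi>, unfolded lmod_simps regular_bimod_simps]
      have bal: "balanced A A B X M X (\<lambda>x m. ract X x (\<phi> m))"
        by unfold_locales (simp_all add: \<phi>D X.ract_l_distr X.ract_r_distr X.ract_assoc)
      obtain h where h: "additive_map XM X h" "\<forall>x\<in>carrier X. \<forall>m\<in>carrier M. h (s x m) = ract X x (\<phi> m)"
        by (rule XM.tensor_lift[OF bal])
      have lX: "additive_map X X (lact X a)" if "a \<in> carrier A" for a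
        by unfold_locales (use that in \<open>simp_all add: X.lact_r_distr\<close>)
      have smult: "h (lact XM a t) = lact X a (h t)" if a: "a \<in> carrier A" and t: "t \<in> carrier XM" for a t
      proof (rule XM.additive_eqI[OF XM.additive_map_comp[OF XM.lact_tensor(1)[OF a] h(1)] _ _ t])
        show "additive_map XM X (\<lambda>t. lact X a (h t))"
          using h(1) lX[OF a] by (simp add: additive_map_def additive_map_axioms_def)
        fix x m assume "x \<in> carrier X" "m \<in> carrier M"
        then show "h (lact XM a (s x m)) = lact X a (h (s x m))"
          using a h(2) by (simp add: XM.lact_tensor(2) \<phi>D X.lact_ract)
      qed
      have "restrict h (carrier (lmod XM)) \<in> mhom A (lmod XM) (lmod X)"
        using additive_map.closed[OF h(1)] additive_map.add[OF h(1)] smult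
        by (intro Pl.mhom_restrictI) simp_all
      then show ?thesis
        using h(2) XM.pure.t_closed
        by (intro bexI[of _ "restrict h (carrier (lmod XM))"]) simp_all
    qed
  qed (simp_all add: XM.pure.t_closed XM.pure.t_add_l XM.pure.t_add_r XM.pure.t_balanced)
qed

text \<open>The mirror image over \<open>opp B\<close>: a form satisfies
  \<open>\<phi>(m b) = \<phi>(m) b\<close>, and the balanced map is
  \<open>m, y \<mapsto> \<phi>(m) y\<close>.\<close>

lemma projective_pairing_right:
  "projective_pairing (opp B) (rmod M) (rmod Y) (rmod MY) (\<lambda>y b. lact Y b y) p"
proof -
  interpret Mr: left_module "opp B" "rmod M" by (rule M.rmod)
  interpret Yr: left_module "opp B" "rmod Y" by (rule Y.rmod)
  interpret Pr: left_module "opp B" "rmod MY" by (rule tMY.rmod)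
  show ?thesis
  proof (unfold_locales, unfold rmod_simps opp_simps)
    show "projective_mod (opp B) (rmod M)" "fin_gen (opp B) (rmod M)" by (rule projective_rmod, rule fin_gen_rmod)
    show "b = \<zero>\<^bsub>B\<^esub>" if "b \<in> carrier B" "\<And>y. y \<in> carrier Y \<Longrightarrow> lact Y b y = \<zero>\<^bsub>Y\<^esub>" for b
      using that by (rule DB.lact_faithful)
    show "\<exists>b\<in>carrier B. \<forall>y\<in>carrier Y. h y = lact Y b y" if "h \<in> mhom (opp B) (rmod Y) (rmod Y)" for h
      using that by (rule DB.End_dual_right)
    show "Q t" if "\<And>m y. \<lbrakk>m \<in> carrier M; y \<in> carrier Y\<rbrakk> \<Longrightarrow> Q (p m y)" "Q \<zero>\<^bsub>MY\<^esub>"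
      "\<And>u v. \<lbrakk>u \<in> carrier MY; v \<in> carrier MY; Q u; Q v\<rbrakk> \<Longrightarrow> Q (u \<oplus>\<^bsub>MY\<^esub> v)" "t \<in> carrier MY" for Q t
      using that(4,1-3) by (rule MY.tensor_induct)
    show "\<exists>\<psi>\<in>mhom (opp B) (rmod MY) (rmod Y). \<forall>m\<in>carrier M. \<forall>y\<in>carrier Y. \<psi> (p m y) = lact Y (\<phi> m) y"
      if \<phi>: "\<phi> \<in> mhom (opp B) (rmod M) (self_mod (opp B))" for \<phi>
    proof -
      note \<phi>D = mhomD(1-3)[OF \<phi>, unfolded rmod_simps lmod_simps regular_bimod_simps opp_simps]
      have bal: "balanced A B B M Y Y (\<lambda>m y. lact Y (\<phi> m) y)"
        by unfold_locales (simp_all add: \<phi>D Y.lact_l_distr Y.lact_r_distr Y.lact_assoc)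
      obtain h where h: "additive_map MY Y h" "\<forall>m\<in>carrier M. \<forall>y\<in>carrier Y. h (p m y) = lact Y (\<phi> m) y"
        by (rule MY.tensor_lift[OF bal])
      have smult: "h (ract MY t b) = ract Y (h t) b" if b: "b \<in> carrier B" and t: "t \<in> carrier MY" for b t
      proof (rule MY.additive_eqI[OF MY.additive_map_comp[OF MY.ract_tensor(1)[OF b] h(1)] _ _ t])
        show "additive_map MY Y (\<lambda>t. ract Y (h t) b)"
          using h(1) b Y.ract_l_distr by (simp add: additive_map_def additive_map_axioms_def)
        fix m y assume "m \<in> carrier M" "y \<in> carrier Y"
        then show "h (ract MY (p m y) b) = ract Y (h (p m y)) b"
          using b h(2) by (simp add: MY.ract_tensor(2) \<phi>D Y.lact_ract)
      qed
      have "restrict h (carrier (rmod MY)) \<in> mhom (opp B) (rmod MY) (rmod Y)"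
        using additive_map.closed[OF h(1)] additive_map.add[OF h(1)] smult
        by (intro Pr.mhom_restrictI) simp_all
      then show ?thesis
        using h(2) MY.pure.t_closed
        by (intro bexI[of _ "restrict h (carrier (rmod MY))"]) simp_all
    qed
  qed (simp_all add: MY.pure.t_closed MY.pure.t_add_l MY.pure.t_add_r MY.pure.t_balanced)
qed

text \<open>Composing with the inverse of \<open>g\<close> gives a map into
  \<open>DA \<otimes> M\<close>, to which the left pairing applies.\<close>

lemma hom_X_MY:
  assumes h: "h \<in> mhom A (lmod X) (lmod MY)"
  shows "\<exists>m\<in>carrier M. \<forall>x\<in>carrier X. h x = q x m"
proof -
  let ?i = "restrict (the_inv_into (carrier XM) g) (carrier MY)"
  have i: "?i \<in> mhom A (lmod MY) (lmod XM)"
    using mhom_inverse[OF g_hom(1) tXM.lmod tMY.lmod] g_bij by simp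
  obtain m where m: "m \<in> carrier M" "\<forall>x\<in>carrier X. compose (carrier X) ?i h x = s x m"
    using projective_pairing.surjective[OF projective_pairing_left mhom_compose[OF h i X.lmod]]
    by (auto)
  have "h x = q x m" if x: "x \<in> carrier X" for x
  proof -
    have "h x \<in> carrier MY" using mhomD(1)[OF h] x by simp
    then have "g (?i (h x)) = h x"
      using f_the_inv_into_f[of g "carrier XM" "h x"] g_bij by (simp add: bij_betw_def)
    then show ?thesis using m(2) x by (simp add: q_def compose_def)
  qed
  then show ?thesis using m(1) by blast
qed

lemma q_injective:
  assumes m: "m \<in> carrier M" and zero: "\<And>x. x \<in> carrier X \<Longrightarrow> q x m = \<zero>\<^bsub>MY\<^esub>"
  shows "m = \<zero>\<^bsub>M\<^esub>"
proof -
  have g0: "g \<zero>\<^bsub>XM\<^esub> = \<zero>\<^bsub>MY\<^esub>"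
    using additive_map.zero[of XM MY g] gD XM.abelian_group_tensor MY.abelian_group_tensor
    by (simp add: additive_map_def additive_map_axioms_def)
  have "s x m = \<zero>\<^bsub>XM\<^esub>" if x: "x \<in> carrier X" for x
    using inj_onD[of g "carrier XM" "s x m" "\<zero>\<^bsub>XM\<^esub>"] g_bij g0 zero[OF x] XM.pure.t_closed[OF x m]
    by (simp add: bij_betw_def q_def)
  then show ?thesis
    using projective_pairing.injective[OF projective_pairing_left, of m] m by simp
qed

lemma p_injective:
  assumes "m \<in> carrier M" "\<And>y. y \<in> carrier Y \<Longrightarrow> p m y = \<zero>\<^bsub>MY\<^esub>"
  shows "m = \<zero>\<^bsub>M\<^esub>"
  using projective_pairing.injective[OF projective_pairing_right, of m] assms by simp

section \<open>Central scalars, faithfulness and the two isomorphisms\<close>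

lemma scalar_tri_alg:
  assumes r: "r \<in> carrier R"
  shows "r \<odot>\<^bsub>\<Lambda>\<^esub> \<one>\<^bsub>\<Lambda>\<^esub> = (r \<odot>\<^bsub>A\<^esub> \<one>\<^bsub>A\<^esub>, \<zero>\<^bsub>M\<^esub>, r \<odot>\<^bsub>B\<^esub> \<one>\<^bsub>B\<^esub>)"
  using r by simp

lemma smult_tri_alg:
  assumes "r \<in> carrier R" "c \<in> carrier \<Lambda>"
  shows "r \<odot>\<^bsub>\<Lambda>\<^esub> c = (r \<odot>\<^bsub>\<Lambda>\<^esub> \<one>\<^bsub>\<Lambda>\<^esub>) \<otimes>\<^bsub>\<Lambda>\<^esub> c" "r \<odot>\<^bsub>\<Lambda>\<^esub> c = c \<otimes>\<^bsub>\<Lambda>\<^esub> (r \<odot>\<^bsub>\<Lambda>\<^esub> \<one>\<^bsub>\<Lambda>\<^esub>)"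
  unfolding scalar_tri_alg[OF assms(1)]
  using assms by (auto simp: DA.A.scalar_mult DB.A.scalar_mult central)

text \<open>A scalar travels through a pure tensor: \<open>r (m \<otimes> y) = (m r) \<otimes> y = m
  \<otimes> (r y) = (m \<otimes> y) r\<close>. The endomorphism algebra takes its
  \<open>R\<close>-structure from one side of \<open>T\<close> and the multipliers act from the
  other, so both must agree on \<open>R\<close>.\<close>

lemma central_T:
  assumes r: "r \<in> carrier R" and z: "z \<in> carrier T"
  shows "ract T z (r \<odot>\<^bsub>\<Lambda>\<^esub> \<one>\<^bsub>\<Lambda>\<^esub>) = lact T (r \<odot>\<^bsub>\<Lambda>\<^esub> \<one>\<^bsub>\<Lambda>\<^esub>) z"
proof -
  obtain x t y where xty: "z = (x, t, y)" "x \<in> carrier X" "t \<in> carrier MY" "y \<in> carrier Y"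
    using z by (auto)
  have rA: "r \<odot>\<^bsub>A\<^esub> \<one>\<^bsub>A\<^esub> \<in> carrier A" and rB: "r \<odot>\<^bsub>B\<^esub> \<one>\<^bsub>B\<^esub> \<in> carrier B" using r by simp_all
  have X: "lact X (r \<odot>\<^bsub>A\<^esub> \<one>\<^bsub>A\<^esub>) x = ract X x (r \<odot>\<^bsub>A\<^esub> \<one>\<^bsub>A\<^esub>)"
    using DA.scalar_dual[OF r xty(2)] by simp
  have Y: "lact Y (r \<odot>\<^bsub>B\<^esub> \<one>\<^bsub>B\<^esub>) y = ract Y y (r \<odot>\<^bsub>B\<^esub> \<one>\<^bsub>B\<^esub>)" if "y \<in> carrier Y" for y
    using DB.scalar_dual[OF r that] by simp
  have "lact MY (r \<odot>\<^bsub>A\<^esub> \<one>\<^bsub>A\<^esub>) t = ract MY t (r \<odot>\<^bsub>B\<^esub> \<one>\<^bsub>B\<^esub>)"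
  proof (rule MY.additive_eqI[OF MY.lact_tensor(1)[OF rA] MY.ract_tensor(1)[OF rB] _ xty(3)])
    fix m y assume m: "m \<in> carrier M" and y: "y \<in> carrier Y"
    show "lact MY (r \<odot>\<^bsub>A\<^esub> \<one>\<^bsub>A\<^esub>) (p m y) = ract MY (p m y) (r \<odot>\<^bsub>B\<^esub> \<one>\<^bsub>B\<^esub>)"
      using m y rA rB Y[OF y]
      by (simp add: MY.lact_tensor(2) MY.ract_tensor(2) central[OF r] MY.pure.t_balanced)
  qed
  then show ?thesis
    unfolding scalar_tri_alg[OF r] xty(1)
    using xty rA rB X Y by simp
qed

lemma T_sides:
  "carrier (rmod T) = carrier (lmod T)" "add (rmod T) = add (lmod T)" "\<zero>\<^bsub>rmod T\<^esub> = \<zero>\<^bsub>lmod T\<^esub>"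
  by (simp_all add: lmod_def rmod_def)

text \<open>Entries of \<open>X\<close> detect \<open>a\<close> and \<open>m\<close>, the latter
  through \<open>q\<close>; entries of \<open>Y\<close> detect \<open>b\<close>.\<close>

lemma ract_T_faithful:
  assumes c: "c \<in> carrier \<Lambda>" and zero: "\<And>z. z \<in> carrier T \<Longrightarrow> ract T z c = \<zero>\<^bsub>T\<^esub>"
  shows "c = \<zero>\<^bsub>\<Lambda>\<^esub>"
proof -
  obtain a m b where abm: "c = (a, m, b)" "a \<in> carrier A" "m \<in> carrier M" "b \<in> carrier B"
    using c by auto
  have "ract X x a = \<zero>\<^bsub>X\<^esub> \<and> q x m = \<zero>\<^bsub>MY\<^esub>" if x: "x \<in> carrier X" for x
    using zero[of "(x, \<zero>\<^bsub>MY\<^esub>, \<zero>\<^bsub>Y\<^esub>)"] x abm X.M.zero_closed Y.M.zero_closed q.t_closed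
    by simp
  moreover have "ract Y y b = \<zero>\<^bsub>Y\<^esub>" if y: "y \<in> carrier Y" for y
    using zero[of "(\<zero>\<^bsub>X\<^esub>, \<zero>\<^bsub>MY\<^esub>, y)"] y abm X.M.zero_closed Y.M.zero_closed by simp
  ultimately show ?thesis
    using DA.ract_faithful[OF abm(2)] DB.ract_faithful[OF abm(4)] q_injective[OF abm(3)] abm(1)
    by simp
qed

text \<open>Here entries of \<open>X\<close> detect \<open>a\<close>, while entries of
  \<open>Y\<close> detect \<open>b\<close> and, through \<open>p\<close>, also
  \<open>m\<close>.\<close>

lemma lact_T_faithful:
  assumes c: "c \<in> carrier \<Lambda>" and zero: "\<And>z. z \<in> carrier T \<Longrightarrow> lact T c z = \<zero>\<^bsub>T\<^esub>"
  shows "c = \<zero>\<^bsub>\<Lambda>\<^esub>"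
proof -
  obtain a m b where abm: "c = (a, m, b)" "a \<in> carrier A" "m \<in> carrier M" "b \<in> carrier B"
    using c by auto
  have "lact X a x = \<zero>\<^bsub>X\<^esub>" if x: "x \<in> carrier X" for x
    using zero[of "(x, \<zero>\<^bsub>MY\<^esub>, \<zero>\<^bsub>Y\<^esub>)"] x abm X.M.zero_closed Y.M.zero_closed by simp
  moreover have "lact Y b y = \<zero>\<^bsub>Y\<^esub> \<and> p m y = \<zero>\<^bsub>MY\<^esub>" if y: "y \<in> carrier Y" for y
    using zero[of "(\<zero>\<^bsub>X\<^esub>, \<zero>\<^bsub>MY\<^esub>, y)"] y abm X.M.zero_closed Y.M.zero_closed MY.pure.t_closed
    by simp
  ultimately show ?thesis
    using DA.lact_faithful[OF abm(2)] DB.lact_faithful[OF abm(4)] p_injective[OF abm(3)] abm(1)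
    by simp
qed

lemma scalar_closed_tri_alg: "r \<in> carrier R \<Longrightarrow> r \<odot>\<^bsub>\<Lambda>\<^esub> \<one>\<^bsub>\<Lambda>\<^esub> \<in> carrier \<Lambda>"
  by (simp add: scalar_tri_alg del: tri_alg_simps(3,6))

lemma End_left_iso:
  "\<exists>\<rho>\<in>alg_iso R (opp (End_alg \<Lambda> (lmod T))) \<Lambda>.
     \<forall>f\<in>carrier (End_alg \<Lambda> (lmod T)). \<forall>z\<in>carrier T. f z = ract T z (\<rho> f)"
proof -
  have "\<exists>\<rho>\<in>alg_iso R (opp (End_alg \<Lambda> (lmod T))) \<Lambda>.
     \<forall>f\<in>carrier (End_alg \<Lambda> (lmod T)). \<forall>z\<in>carrier (lmod T). f z = \<rho> f \<odot>\<^bsub>rmod T\<^esub> z"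
  proof (rule End_alg_iso[OF T.lmod T.rmod T_sides]; (unfold lmod_simps rmod_simps)?)
    show "\<exists>c\<in>carrier \<Lambda>. \<forall>z\<in>carrier T. f z = ract T z c" if "f \<in> mhom \<Lambda> (lmod T) (lmod T)" for f
      using that DA.End_dual_left hom_X_MY DB.End_dual_left MY.tensor_induct by (rule mhom_lmod_T)
    show "ract T (lact T a z) b = lact T a (ract T z b)"
      if "a \<in> carrier \<Lambda>" "b \<in> carrier \<Lambda>" "z \<in> carrier T" for a b z
      using that(1,3,2) by (rule T.lact_ract)
  qed (fact scalar_closed_tri_alg smult_tri_alg(1) central_T ract_T_faithful)+
  then show ?thesis by (simp only: lmod_simps rmod_simps)
qed

text \<open>The general result over \<open>opp \<Lambda>\<close>, with the two sides of
  \<open>T\<close> exchanged, gives an isomorphism of the opposite endomorphism algebra with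
  \<open>opp \<Lambda>\<close>. The same map is an isomorphism of the algebras themselves, so no
  opposite remains.\<close>

lemma End_right_iso:
  "\<exists>\<sigma>\<in>alg_iso R (End_alg (opp \<Lambda>) (rmod T)) \<Lambda>.
     \<forall>f\<in>carrier (End_alg (opp \<Lambda>) (rmod T)). \<forall>z\<in>carrier T. f z = lact T (\<sigma> f) z"
proof -
  have L: "left_module (opp (opp \<Lambda>)) (lmod T)" using T.lmod by (simp only: opp_opp)
  have "\<exists>\<sigma>\<in>alg_iso R (opp (End_alg (opp \<Lambda>) (rmod T))) (opp \<Lambda>).
     \<forall>f\<in>carrier (End_alg (opp \<Lambda>) (rmod T)). \<forall>z\<in>carrier (rmod T). f z = \<sigma> f \<odot>\<^bsub>lmod T\<^esub> z"
  proof (rule End_alg_iso[OF T.rmod L T_sides[symmetric]]; unfold lmod_simps rmod_simps opp_simps opp_smult)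
    show "\<exists>c\<in>carrier \<Lambda>. \<forall>z\<in>carrier T. f z = lact T c z" if "f \<in> mhom (opp \<Lambda>) (rmod T) (rmod T)" for f
      using that DA.End_dual_right projective_pairing.surjective[OF projective_pairing_right, unfolded rmod_simps]
        DB.End_dual_right q_induct by (rule mhom_rmod_T)
    show "lact T b (ract T z a) = ract T (lact T b z) a"
      if "a \<in> carrier \<Lambda>" "b \<in> carrier \<Lambda>" "z \<in> carrier T" for a b z
      using T.lact_ract[OF that(2,3,1)] by (rule sym)
    show "lact T (r \<odot>\<^bsub>\<Lambda>\<^esub> \<one>\<^bsub>\<Lambda>\<^esub>) z = ract T z (r \<odot>\<^bsub>\<Lambda>\<^esub> \<one>\<^bsub>\<Lambda>\<^esub>)" if "r \<in> carrier R" "z \<in> carrier T" for r z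
      using central_T[OF that] by (rule sym)
  qed (fact scalar_closed_tri_alg smult_tri_alg(2) lact_T_faithful)+
  then show ?thesis by (simp only: lmod_simps rmod_simps alg_iso_opp)
qed

end

theorem lemma5p3:
  fixes R :: "('r, 'y) ring_scheme"
    and J :: "('r, 'j, 'z) module_scheme"
    and A :: "('r, 'a, 'v) module_scheme"
    and B :: "('r, 'b, 'w) module_scheme"
    and M :: "('a, 'b, 'm) bimodule"
    and g :: "((('a \<Rightarrow> 'j) \<times> 'm) \<Rightarrow>\<^sub>0 int) set \<Rightarrow> (('m \<times> ('b \<Rightarrow> 'j)) \<Rightarrow>\<^sub>0 int) set"
  assumes "dualizing R J"
    and "artin_bimodule R A B M"
    and "exchangeable R J A B M"
    and "g \<in> bimod_iso A B (DA_tensor_M R J A M) (M_tensor_DB R J B M)"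
  defines "\<Lambda> \<equiv> tri_alg A B M"
    and "T \<equiv> T_bimod R J A B M g"
  shows "(\<exists>\<rho>. \<rho> \<in> alg_iso R (opp (End_alg \<Lambda> (lmod T))) \<Lambda> \<and>
            (\<forall>f \<in> carrier (End_alg \<Lambda> (lmod T)). \<forall>x \<in> carrier T. f x = ract T x (\<rho> f))) \<and>
         (\<exists>\<sigma>. \<sigma> \<in> alg_iso R (End_alg (opp \<Lambda>) (rmod T)) \<Lambda> \<and>
            (\<forall>f \<in> carrier (End_alg (opp \<Lambda>) (rmod T)). \<forall>x \<in> carrier T. f x = lact T (\<sigma> f) x))"
proof -
  interpret M: artin_bimodule R A B M by fact
  \<comment> \<open>Finite generation is given over \<open>R\<close>. It passes to \<open>A\<close>,
    and also to \<open>opp B\<close> because \<open>R\<close> acts on \<open>M\<close> in the same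
    way from both sides.\<close>
  have V: "left_module R (restrict_scalars A (lmod M))"
    by (rule M.A.left_module_restrict_scalars[OF M.L.left_module_axioms])
  have "bimod A B M"
    by (rule bimodI[OF M.L.left_module_axioms M.R.left_module_axioms M.B.ring_axioms M.lact_ract])
  moreover have "fin_gen A (lmod M)"
    by (rule M.L.fin_gen_restrict[OF V M.bimod_fin_gen]) auto
  moreover have "fin_gen (opp B) (rmod M)"
    by (rule M.R.fin_gen_restrict[OF V M.bimod_fin_gen]) (auto simp: M.central)
  moreover have "artin_duality R J"
    using assms(1) M.A.R.is_cring M.A.artinian by (simp add: artin_duality_def artin_duality_axioms_def)
  moreover have "projective_mod A (lmod M)" "projective_mod (opp B) (rmod M)"
    using assms(3) by (simp_all add: exchangeable_def)
  ultimately interpret exchange R J A B M g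
    using assms(4) M.central M.A.artin_algebra_axioms M.B.artin_algebra_axioms
    by (simp add: exchange_def exchange_axioms_def dual_algebra_def)
  have "T_bimod R J A B M g = tri_bimod X MY Y p q"
    by (simp add: T_bimod_eq_tri_bimod q_def[abs_def])
  then show ?thesis
    using End_left_iso End_right_iso unfolding \<Lambda>_def T_def Bex_def by simp
qed

end
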